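(* Let $l\in\{+1,-1\}$ and let $\Gamma_l\subset D^l$ be a $K_B$-bounded contour satisfying $$\mathrm{Var}_{\widetilde A_1}(B,\Gamma_l)<1,\qquad \mathrm{Var}_{\widetilde A_1}(B,\Gamma_l)\,\|\widetilde A_1\|<\tfrac14\,d_0(\Gamma_l)\,[1-\mathrm{Var}_{\widetilde A_1}(B,\Gamma_l)]^2 .$$ Let $\Gamma_{(-l)}\subset D^{(-l)}$ be the contour conjugate to $\Gamma_l$. Then for any $z\in\mathbb{C}\setminus\Gamma_l$ the following equality holds: $$W_1(z,\Gamma_l)\,\bigl(H_1^{(l)}-z\bigr)=\bigl(H_1^{(-l)*}-z\bigr)\,\bigl[W_1(\overline z,\Gamma_{(-l)})\bigr]^* .$$ Further, the spectrum of $H_1^{(-l)*}$ coincides with the spectrum of $H_1^{(l)}$.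
   Context: Setting. $\mathcal H_0,\mathcal H_1$ are separable Hilbert spaces; $I_1$ is the identity in $\mathcal H_1$. $A_0$ is an unbounded selfadjoint operator in $\mathcal H_0$ whose spectrum is absolutely continuous and equal to $\Delta_0=[\alpha_0,+\infty)$, $\alpha_0>0$. $A_1$ is a bounded selfadjoint operator in $\mathcal H_1$. The (possibly unbounded) operators $T_{ij}:\mathcal H_j\to\mathcal H_i$ ($i,j\in\{0,1\}$, $i\ne j$) satisfy $T_{01}^*=T_{10}$ and $\mathcal D(T_{10})\supset\mathcal D(A_0^{1/2})$. Then $B_{10}:=T_{10}A_0^{-1/2}$ is bounded; put $B_{01}:=B_{10}^*$. Let $\widetilde A_1:=A_1-B_{10}B_{01}$, a bounded selfadjoint operator in $\mathcal H_1$; it is assumed that $\sigma(\widetilde A_1)\subset\Delta_0$. The function $K_B$. Let $E_0$ be the spectral measure of $A_0$, $E^0(\mu):=E_0([\alpha_0,\mu))$ and $K_B(\mu):=B_{10}E^0(\mu)B_{01}$. It is assumed that: $K_B$ is differentiable on $\Delta_0$ in the operator norm topology; $K_B'$ is continuous within $\Delta_0$ and admits analytic continuation (in the operator norm topology) from $\Delta_0$ to a simply connected domain $D^+\subset\mathbb{C}^+$ (the upper half-plane) whose boundary includes the entire interval $\Delta_0$. Consequently it is also continued to $D^-:=\{z:\overline z\in D^+\}$, and $[K_B'(\mu)]^*=K_B'(\overline\mu)$ for $\mu\in D^\pm$; the continuations are again denoted $K_B'$. It is assumed that $\|K_B'(\mu)\|\le C|\mu-\alpha_0|^{\gamma}$,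 $\mu\in D^\pm$, for some $C>0$ and $\gamma\in(-1,0]$. For $l=\pm1$ write $D^l$ for $D^\pm$. Contours. $\Gamma_l$ denotes a rectifiable Jordan curve in $D^l$ resulting from continuous deformation of the interval $\Delta_0$, the finite end point $\alpha_0$ being fixed (oriented from $\alpha_0$ to infinity). It is called $K_B$-bounded if $\mathrm{Var}_1(B,\Gamma_l):=\int_{\Gamma_l}|d\mu|\,(1+|\mu|)^{-1}\|K_B'(\mu)\|<\infty$, where $|d\mu|$ is Lebesgue (arc-length) measure on $\Gamma_l$. Put $d_0(\Gamma_l):=\operatorname{dist}\{\sigma(\widetilde A_1),\Gamma_l\}$, assumed positive, and $\mathrm{Var}_{\widetilde A_1}(B,\Gamma_l):=\int_{\Gamma_l}|d\mu|\,\|K_B'(\mu)\|/\operatorname{dist}\{\mu,\sigma(\widetilde A_1)\}$ (which is then finite). Operators $H_1^{(\pm l)}$ and $W_1$. For a bounded operator $Y$ in $\mathcal H_1$ whose spectrum is separated from a contour $\Gamma$, $V_1(Y,\Gamma):=\int_{\Gamma}d\mu\,K_B'(\mu)\,Y(Y-\mu)^{-1}$. Put $$r_{\min}(\Gamma):=\tfrac12 d_0(\Gamma)[1-\mathrm{Var}_{\widetilde A_1}(B,\Gamma)]-\sqrt{\tfrac14 d_0^2(\Gamma)[1-\mathrm{Var}_{\widetilde A_1}(B,\Gamma)]^2-d_0(\Gamma)\mathrm{Var}_{\widetilde A_1}(B,\Gamma)\|\widetilde A_1\|}.$$ For a $K_B$-bounded $\Gamma_l$ satisfying the two inequalities in the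 claim, the equation $X=V_1(\widetilde A_1+X,\Gamma_l)$ has a unique solution in the ball $\|X\|\le r_{\min}(\Gamma_l)$, denoted $X^{(l)}$; for given $l$ it is the same for all such $\Gamma_l\subset D^l$. Put $H_1^{(l)}:=\widetilde A_1+X^{(l)}$. The conjugate contour $\Gamma_{(-l)}=\{\overline\mu:\mu\in\Gamma_l\}\subset D^{(-l)}$ satisfies the same conditions, and it defines $X^{(-l)}$ and $H_1^{(-l)}=\widetilde A_1+X^{(-l)}$; $H_1^{(-l)*}$ denotes the adjoint of $H_1^{(-l)}$. For $l=\pm1$ and $z\in\mathbb{C}\setminus\Gamma_l$, $$W_1(z,\Gamma_l):=I_1-\int_{\Gamma_l}d\mu\,K_B'(\mu)(H_1^{(l)}-\mu)^{-1}+z\int_{\Gamma_l}d\mu\,K_B'(\mu)(z-\mu)^{-1}(H_1^{(l)}-\mu)^{-1}.$$ *)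

theory Defs
  imports "HOL-Analysis.Analysis"
begin

section \<open>Complex Hilbert spaces\<close>

text \<open>
  The inner product is antilinear in the first and linear in the second argument.
  Separability is expressed by adding the class \<open>second_countable_topology\<close>.
\<close>

class complex_hilbert_space = banach +
  fixes scaleC :: "complex \<Rightarrow> 'a \<Rightarrow> 'a" (infixr "*\<^sub>C" 75)
    and cinner :: "'a \<Rightarrow> 'a \<Rightarrow> complex"
  assumes scaleC_add_right: "c *\<^sub>C (x + y) = c *\<^sub>C x + c *\<^sub>C y"
    and scaleC_add_left: "(c + d) *\<^sub>C x = c *\<^sub>C x + d *\<^sub>C x"
    and scaleC_scaleC: "c *\<^sub>C (d *\<^sub>C x) = (c * d) *\<^sub>C x"
    and scaleC_of_real: "complex_of_real r *\<^sub>C x = r *\<^sub>R x"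
    and cinner_commute: "cinner x y = cnj (cinner y x)"
    and cinner_add_right: "cinner x (y + z) = cinner x y + cinner x z"
    and cinner_scaleC_right: "cinner x (c *\<^sub>C y) = c * cinner x y"
    and norm_eq_cinner: "complex_of_real ((norm x)\<^sup>2) = cinner x x"

lemma norm_scaleC:
  fixes x :: "'a::complex_hilbert_space"
  shows "norm (c *\<^sub>C x) = cmod c * norm x"
proof -
  have "cinner (c *\<^sub>C x) (c *\<^sub>C x) = c * (cnj c * cinner x x)"
    by (metis cinner_commute cinner_scaleC_right complex_cnj_mult)
  also have "\<dots> = complex_of_real ((cmod c * norm x)\<^sup>2)"
    by (simp add: norm_eq_cinner[symmetric] power_mult_distrib complex_norm_square[symmetric]
        flip: mult.assoc)
  finally have "(norm (c *\<^sub>C x))\<^sup>2 = (cmod c * norm x)\<^sup>2"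
    by (metis norm_eq_cinner of_real_eq_iff)
  then show ?thesis
    by (simp add: power2_eq_iff_nonneg)
qed

section \<open>Bounded operators\<close>

text \<open>
  Bounded operators are elements of the library type of bounded (real-)linear maps, whose
  norm is the operator norm; complex linearity is a separate predicate.
\<close>

definition clinear_op ::
  "('a::complex_hilbert_space \<Rightarrow>\<^sub>L 'b::complex_hilbert_space) \<Rightarrow> bool" where
  "clinear_op A \<longleftrightarrow> (\<forall>c x. blinfun_apply A (c *\<^sub>C x) = c *\<^sub>C blinfun_apply A x)"

text \<open>\<open>scalar_op c\<close> is $c I$.\<close>

lift_definition scalar_op :: "complex \<Rightarrow> 'a::complex_hilbert_space \<Rightarrow>\<^sub>L 'a" is scaleC
proof
  fix c :: complex and x y :: 'a and r :: real
  show "c *\<^sub>C (x + y) = c *\<^sub>C x + c *\<^sub>C y"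
    by (rule scaleC_add_right)
  show "c *\<^sub>C (r *\<^sub>R x) = r *\<^sub>R (c *\<^sub>C x)"
    by (simp add: scaleC_of_real[symmetric] scaleC_scaleC mult.commute)
  show "\<exists>K. \<forall>x::'a. norm (c *\<^sub>C x) \<le> norm x * K"
    by (rule exI[of _ "cmod c"]) (simp add: norm_scaleC)
qed

definition badj ::
  "('a::complex_hilbert_space \<Rightarrow>\<^sub>L 'b::complex_hilbert_space) \<Rightarrow> ('b \<Rightarrow>\<^sub>L 'a)" where
  "badj A = (THE B. \<forall>x y. cinner (blinfun_apply A x) y = cinner x (blinfun_apply B y))"

definition bselfadjoint :: "('a::complex_hilbert_space \<Rightarrow>\<^sub>L 'a) \<Rightarrow> bool" where
  "bselfadjoint A \<longleftrightarrow> clinear_op A \<and>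
     (\<forall>x y. cinner (blinfun_apply A x) y = cinner x (blinfun_apply A y))"

definition is_binverse ::
  "('a::complex_hilbert_space \<Rightarrow>\<^sub>L 'a) \<Rightarrow> ('a \<Rightarrow>\<^sub>L 'a) \<Rightarrow> bool" where
  "is_binverse A R \<longleftrightarrow> A o\<^sub>L R = id_blinfun \<and> R o\<^sub>L A = id_blinfun"

definition binverse :: "('a::complex_hilbert_space \<Rightarrow>\<^sub>L 'a) \<Rightarrow> ('a \<Rightarrow>\<^sub>L 'a)" where
  "binverse A = (THE R. is_binverse A R)"

definition bspectrum :: "('a::complex_hilbert_space \<Rightarrow>\<^sub>L 'a) \<Rightarrow> complex set" where
  "bspectrum A = {z. \<nexists>R. is_binverse (A - scalar_op z) R}"

text \<open>Complex differentiability in the operator norm topology.\<close>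

definition op_holomorphic_on ::
  "(complex \<Rightarrow> ('a::complex_hilbert_space \<Rightarrow>\<^sub>L 'a)) \<Rightarrow> complex set \<Rightarrow> bool" where
  "op_holomorphic_on F S \<longleftrightarrow>
     (\<forall>z\<in>S. \<exists>D. (F has_derivative (\<lambda>h. scalar_op h o\<^sub>L D)) (at z within S))"

section \<open>Unbounded operators\<close>

text \<open>
  A possibly unbounded operator is a partial map: \<open>dom T\<close> is its domain, equality of partial
  maps is equality of operators (domains included), and \<open>S \<circ>\<^sub>m T\<close> is the product with its
  natural domain.
\<close>

definition linear_operator ::
  "('a::complex_hilbert_space \<rightharpoonup> 'b::complex_hilbert_space) \<Rightarrow> bool" where
  "linear_operator T \<longleftrightarrow> T 0 = Some 0 \<and>
     (\<forall>x y u v. T x = Some u \<longrightarrow> T y = Some v \<longrightarrow> T (x + y) = Some (u + v)) \<and>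
     (\<forall>c x u. T x = Some u \<longrightarrow> T (c *\<^sub>C x) = Some (c *\<^sub>C u))"

definition densely_defined ::
  "('a::complex_hilbert_space \<rightharpoonup> 'b::complex_hilbert_space) \<Rightarrow> bool" where
  "densely_defined T \<longleftrightarrow> closure (dom T) = UNIV"

text \<open>Meaningful for densely defined \<open>T\<close>, where the vector \<open>z\<close> below is unique.\<close>

definition op_adjoint ::
  "('a::complex_hilbert_space \<rightharpoonup> 'b::complex_hilbert_space) \<Rightarrow> ('b \<rightharpoonup> 'a)" where
  "op_adjoint T = (\<lambda>y.
     if \<exists>z. \<forall>x\<in>dom T. cinner (the (T x)) y = cinner x z
     then Some (THE z. \<forall>x\<in>dom T. cinner (the (T x)) y = cinner x z)
     else None)"

definition selfadjoint_operator :: "('a::complex_hilbert_space \<rightharpoonup> 'a) \<Rightarrow> bool" where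
  "selfadjoint_operator T \<longleftrightarrow>
     linear_operator T \<and> densely_defined T \<and> op_adjoint T = T"

definition op_inverse ::
  "('a::complex_hilbert_space \<rightharpoonup> 'b::complex_hilbert_space) \<Rightarrow> ('b \<rightharpoonup> 'a)" where
  "op_inverse T = (\<lambda>y. if \<exists>!x. T x = Some y then Some (THE x. T x = Some y) else None)"

text \<open>\<open>S\<close> is the nonnegative square root $T^{1/2}$ of \<open>T\<close>.\<close>

definition is_positive_sqrt ::
  "('a::complex_hilbert_space \<rightharpoonup> 'a) \<Rightarrow> ('a \<rightharpoonup> 'a) \<Rightarrow> bool" where
  "is_positive_sqrt T S \<longleftrightarrow>
     selfadjoint_operator S \<and> (\<forall>x\<in>dom S. 0 \<le> Re (cinner x (the (S x)))) \<and> S \<circ>\<^sub>m S = T"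

definition op_spectrum :: "('a::complex_hilbert_space \<rightharpoonup> 'a) \<Rightarrow> complex set" where
  "op_spectrum T = {z. \<nexists>R::'a \<Rightarrow>\<^sub>L 'a.
     (\<forall>y. blinfun_apply R y \<in> dom T \<and>
          the (T (blinfun_apply R y)) - z *\<^sub>C blinfun_apply R y = y) \<and>
     (\<forall>x\<in>dom T. blinfun_apply R (the (T x) - z *\<^sub>C x) = x)}"

section \<open>Spectral measures\<close>

definition projection_valued_measure ::
  "(real set \<Rightarrow> ('a::complex_hilbert_space \<Rightarrow>\<^sub>L 'a)) \<Rightarrow> bool" where
  "projection_valued_measure E \<longleftrightarrow>
     (\<forall>S\<in>sets borel. bselfadjoint (E S) \<and> E S o\<^sub>L E S = E S) \<and>
     E UNIV = id_blinfun \<and>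
     (\<forall>F x. range F \<subseteq> sets borel \<longrightarrow> disjoint_family F \<longrightarrow>
        (\<lambda>n::nat. blinfun_apply (E (F n)) x) sums blinfun_apply (E (\<Union>n. F n)) x)"

text \<open>The scalar measure $\langle x, E(\cdot)x\rangle = \|E(\cdot)x\|^2$.\<close>

definition vector_spectral_measure ::
  "(real set \<Rightarrow> ('a::complex_hilbert_space \<Rightarrow>\<^sub>L 'a)) \<Rightarrow> 'a \<Rightarrow> real measure" where
  "vector_spectral_measure E x =
     measure_of UNIV (sets borel) (\<lambda>S. ennreal ((norm (blinfun_apply (E S) x))\<^sup>2))"

text \<open>
  $T = \int t\,E(dt)$ on its natural domain. By polarization it is enough to prescribe the
  quadratic form of the linear operator \<open>T\<close>.
\<close>

definition is_spectral_measure_of ::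
  "(real set \<Rightarrow> ('a::complex_hilbert_space \<Rightarrow>\<^sub>L 'a)) \<Rightarrow> ('a \<rightharpoonup> 'a) \<Rightarrow> bool" where
  "is_spectral_measure_of E T \<longleftrightarrow>
     projection_valued_measure E \<and>
     dom T = {x. (\<integral>\<^sup>+t. ennreal (t\<^sup>2) \<partial>vector_spectral_measure E x) < \<infinity>} \<and>
     (\<forall>x\<in>dom T. cinner x (the (T x)) =
        complex_of_real (\<integral>t. t \<partial>vector_spectral_measure E x))"

definition spectrally_absolutely_continuous ::
  "(real set \<Rightarrow> ('a::complex_hilbert_space \<Rightarrow>\<^sub>L 'a)) \<Rightarrow> bool" where
  "spectrally_absolutely_continuous E \<longleftrightarrow>
     (\<forall>x. absolutely_continuous lborel (vector_spectral_measure E x))"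

section \<open>The standing assumptions\<close>

text \<open>\<open>real_ray a\<close> is $[a,+\infty)$ as a subset of the complex plane.\<close>

definition real_ray :: "real \<Rightarrow> complex set" where
  "real_ray a = complex_of_real ` {a..}"

definition K_B ::
  "(real set \<Rightarrow> ('a::complex_hilbert_space \<Rightarrow>\<^sub>L 'a)) \<Rightarrow>
   ('a \<Rightarrow>\<^sub>L 'b::complex_hilbert_space) \<Rightarrow> real \<Rightarrow> real \<Rightarrow> ('b \<Rightarrow>\<^sub>L 'b)" where
  "K_B E0 B10 \<alpha>0 \<mu> = B10 o\<^sub>L E0 {\<alpha>0..<\<mu>} o\<^sub>L badj B10"

text \<open>
  \<open>sqrtA0\<close> is $A_0^{1/2}$, \<open>B10\<close> is $T_{10}A_0^{-1/2}$, \<open>At\<close> is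
  $\widetilde A_1 = A_1 - B_{10}B_{10}^*$ and \<open>Dp\<close> is $D^+$.
  \<open>KB'\<close> is the derivative of $K_B$ on the interior of $\Delta_0$ together with its analytic
  continuations: on $D^+$ it is holomorphic with norm-continuous boundary values on
  $(\alpha_0,\infty)$, on $D^-$ it is the continuation obtained by reflection.
  Nothing is required at the end point $\alpha_0$, where $K_B'$ may be singular if
  $\gamma<0$.
\<close>

locale block_operator_setting =
  fixes \<alpha>0 :: real
    and A0 :: "'a::{complex_hilbert_space, second_countable_topology} \<rightharpoonup> 'a"
    and sqrtA0 :: "'a \<rightharpoonup> 'a"
    and E0 :: "real set \<Rightarrow> ('a \<Rightarrow>\<^sub>L 'a)"
    and A1 :: "'b::{complex_hilbert_space, second_countable_topology} \<Rightarrow>\<^sub>L 'b"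
    and T01 :: "'b \<rightharpoonup> 'a"
    and T10 :: "'a \<rightharpoonup> 'b"
    and B10 :: "'a \<Rightarrow>\<^sub>L 'b"
    and At :: "'b \<Rightarrow>\<^sub>L 'b"
    and Dp :: "complex set"
    and KB' :: "complex \<Rightarrow> ('b \<Rightarrow>\<^sub>L 'b)"
    and C \<gamma> :: real
  assumes alpha0_pos: "\<alpha>0 > 0"
    and A0_selfadjoint: "selfadjoint_operator A0"
    and A0_spectrum: "op_spectrum A0 = real_ray \<alpha>0"
    and E0_spectral: "is_spectral_measure_of E0 A0"
    and E0_abs_cont: "spectrally_absolutely_continuous E0"
    and sqrtA0: "is_positive_sqrt A0 sqrtA0"
    and A1_selfadjoint: "bselfadjoint A1"
    and T01_linear: "linear_operator T01"
    and T01_dense: "densely_defined T01"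
    and T10_linear: "linear_operator T10"
    and T01_adjoint: "op_adjoint T01 = T10"
    and T10_domain: "dom sqrtA0 \<subseteq> dom T10"
    and B10: "(\<lambda>x. Some (blinfun_apply B10 x)) = T10 \<circ>\<^sub>m op_inverse sqrtA0"
    and At: "At = A1 - (B10 o\<^sub>L badj B10)"
    and At_spectrum: "bspectrum At \<subseteq> real_ray \<alpha>0"
    and Dp_domain: "open Dp" "connected Dp" "simply_connected Dp"
    and Dp_upper: "Dp \<subseteq> {z. Im z > 0}"
    and Dp_boundary: "real_ray \<alpha>0 \<subseteq> frontier Dp"
    and KB_deriv:
      "\<And>\<mu>. \<mu> > \<alpha>0 \<Longrightarrow> (K_B E0 B10 \<alpha>0 has_vector_derivative KB' (complex_of_real \<mu>)) (at \<mu>)"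
    and KB'_clinear: "\<And>\<mu>. \<mu> \<in> Dp \<Longrightarrow> clinear_op (KB' \<mu>)"
    and KB'_continuous: "continuous_on (Dp \<union> complex_of_real ` {\<alpha>0<..}) KB'"
    and KB'_holomorphic: "op_holomorphic_on KB' Dp"
    and KB'_reflection: "\<And>\<mu>. \<mu> \<in> cnj ` Dp \<Longrightarrow> KB' \<mu> = badj (KB' (cnj \<mu>))"
    and C_pos: "C > 0"
    and gamma_range: "-1 < \<gamma>" "\<gamma> \<le> 0"
    and KB'_bound:
      "\<And>\<mu>. \<mu> \<in> Dp \<union> cnj ` Dp \<Longrightarrow>
         norm (KB' \<mu>) \<le> C * (cmod (\<mu> - complex_of_real \<alpha>0)) powr \<gamma>"

definition D_side :: "complex set \<Rightarrow> int \<Rightarrow> complex set" where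
  "D_side Dp l = (if l = 1 then Dp else cnj ` Dp)"

section \<open>Contours\<close>

definition curve_length :: "(real \<Rightarrow> complex) \<Rightarrow> real \<Rightarrow> real \<Rightarrow> ennreal" where
  "curve_length \<Gamma> a b =
     (SUP p\<in>{p::real list. sorted p \<and> set p \<subseteq> {a..b}}.
        ennreal (\<Sum>i<length p - 1. dist (\<Gamma> (p ! i)) (\<Gamma> (p ! Suc i))))"

text \<open>
  An oriented, locally rectifiable contour from $\alpha_0$ to infinity is given by its
  arc-length parametrization $\Gamma$ on $[0,\infty)$, so that $|d\mu|$ is Lebesgue measure in
  the parameter.
\<close>

definition arc_length_parametrized :: "(real \<Rightarrow> complex) \<Rightarrow> bool" where
  "arc_length_parametrized \<Gamma> \<longleftrightarrow>
     (\<forall>s t. 0 \<le> s \<longrightarrow> s \<le> t \<longrightarrow> curve_length \<Gamma> s t = ennreal (t - s))"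

text \<open>
  A homotopy from $[\alpha_0,\infty)$ to \<open>\<Gamma>\<close> inside $D \cup [\alpha_0,\infty)$ which fixes
  $\alpha_0$ and the end at infinity.
\<close>

definition deformation_of_ray :: "real \<Rightarrow> complex set \<Rightarrow> (real \<Rightarrow> complex) \<Rightarrow> bool" where
  "deformation_of_ray \<alpha>0 D \<Gamma> \<longleftrightarrow>
     (\<exists>h :: real \<times> real \<Rightarrow> complex.
        continuous_on ({0..1} \<times> {0..}) h \<and>
        h ` ({0..1} \<times> {0..}) \<subseteq> D \<union> real_ray \<alpha>0 \<and>
        (\<forall>t\<ge>0. h (0, t) = complex_of_real (\<alpha>0 + t)) \<and>
        (\<forall>t\<ge>0. h (1, t) = \<Gamma> t) \<and>
        (\<forall>s\<in>{0..1}. h (s, 0) = complex_of_real \<alpha>0) \<and>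
        (\<forall>R. \<exists>T. \<forall>s\<in>{0..1}. \<forall>t\<ge>0. T \<le> t \<longrightarrow> R \<le> cmod (h (s, t))))"

definition contour_in :: "real \<Rightarrow> complex set \<Rightarrow> (real \<Rightarrow> complex) \<Rightarrow> bool" where
  "contour_in \<alpha>0 D \<Gamma> \<longleftrightarrow>
     \<Gamma> 0 = complex_of_real \<alpha>0 \<and> (\<forall>t>0. \<Gamma> t \<in> D) \<and>
     continuous_on {0..} \<Gamma> \<and> inj_on \<Gamma> {0..} \<and>
     arc_length_parametrized \<Gamma> \<and> deformation_of_ray \<alpha>0 D \<Gamma>"

text \<open>
  The density of the complex measure $d\mu$ with respect to $|d\mu|$. The curve is
  1-Lipschitz, so a density exists; it is unique up to null sets and equals $\Gamma'$ almost
  everywhere.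
\<close>

definition contour_density :: "(real \<Rightarrow> complex) \<Rightarrow> real \<Rightarrow> complex" where
  "contour_density \<Gamma> = (SOME g. \<forall>s t. 0 \<le> s \<longrightarrow> s \<le> t \<longrightarrow>
     g absolutely_integrable_on {s..t} \<and> integral {s..t} g = \<Gamma> t - \<Gamma> s)"

text \<open>$\int_\Gamma d\mu\,F(\mu)$, as an integral in the Banach space of bounded operators.\<close>

definition op_contour_integral ::
  "(real \<Rightarrow> complex) \<Rightarrow> (complex \<Rightarrow> ('b::complex_hilbert_space \<Rightarrow>\<^sub>L 'b)) \<Rightarrow> ('b \<Rightarrow>\<^sub>L 'b)" where
  "op_contour_integral \<Gamma> F =
     integral {0..} (\<lambda>t. scalar_op (contour_density \<Gamma> t) o\<^sub>L F (\<Gamma> t))"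

definition Var_1 ::
  "(complex \<Rightarrow> ('b::complex_hilbert_space \<Rightarrow>\<^sub>L 'b)) \<Rightarrow> (real \<Rightarrow> complex) \<Rightarrow> ennreal" where
  "Var_1 KB' \<Gamma> = (\<integral>\<^sup>+t\<in>{0..}. ennreal (norm (KB' (\<Gamma> t)) / (1 + cmod (\<Gamma> t))) \<partial>lborel)"

definition KB_bounded ::
  "(complex \<Rightarrow> ('b::complex_hilbert_space \<Rightarrow>\<^sub>L 'b)) \<Rightarrow> (real \<Rightarrow> complex) \<Rightarrow> bool" where
  "KB_bounded KB' \<Gamma> \<longleftrightarrow> Var_1 KB' \<Gamma> < \<infinity>"

definition d_0 :: "('b::complex_hilbert_space \<Rightarrow>\<^sub>L 'b) \<Rightarrow> (real \<Rightarrow> complex) \<Rightarrow> real" where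
  "d_0 At \<Gamma> = setdist (bspectrum At) (\<Gamma> ` {0..})"

text \<open>Finite whenever \<open>\<Gamma>\<close> is \<open>KB\<close>-bounded and \<open>d_0 At \<Gamma> > 0\<close>.\<close>

definition Var_A ::
  "(complex \<Rightarrow> ('b::complex_hilbert_space \<Rightarrow>\<^sub>L 'b)) \<Rightarrow> ('b \<Rightarrow>\<^sub>L 'b) \<Rightarrow> (real \<Rightarrow> complex) \<Rightarrow> real"
  where
  "Var_A KB' At \<Gamma> = (LINT t:{0..}|lborel. norm (KB' (\<Gamma> t)) / infdist (\<Gamma> t) (bspectrum At))"

section \<open>The basic equation and the operators built from its solution\<close>

definition V_1 ::
  "(complex \<Rightarrow> ('b::complex_hilbert_space \<Rightarrow>\<^sub>L 'b)) \<Rightarrow> ('b \<Rightarrow>\<^sub>L 'b) \<Rightarrow> (real \<Rightarrow> complex) \<Rightarrow> ('b \<Rightarrow>\<^sub>L 'b)"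
  where
  "V_1 KB' Y \<Gamma> =
     op_contour_integral \<Gamma> (\<lambda>\<mu>. KB' \<mu> o\<^sub>L Y o\<^sub>L binverse (Y - scalar_op \<mu>))"

definition r_min ::
  "(complex \<Rightarrow> ('b::complex_hilbert_space \<Rightarrow>\<^sub>L 'b)) \<Rightarrow> ('b \<Rightarrow>\<^sub>L 'b) \<Rightarrow> (real \<Rightarrow> complex) \<Rightarrow> real"
  where
  "r_min KB' At \<Gamma> =
     1/2 * d_0 At \<Gamma> * (1 - Var_A KB' At \<Gamma>) -
     sqrt (1/4 * (d_0 At \<Gamma>)\<^sup>2 * (1 - Var_A KB' At \<Gamma>)\<^sup>2 - d_0 At \<Gamma> * Var_A KB' At \<Gamma> * norm At)"

text \<open>\<open>X\<close> is the solution of $X = V_1(\widetilde A_1 + X, \Gamma)$ in the ball of radius $r_{\min}$.\<close>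

definition basic_solution ::
  "(complex \<Rightarrow> ('b::complex_hilbert_space \<Rightarrow>\<^sub>L 'b)) \<Rightarrow> ('b \<Rightarrow>\<^sub>L 'b) \<Rightarrow> (real \<Rightarrow> complex) \<Rightarrow>
   ('b \<Rightarrow>\<^sub>L 'b) \<Rightarrow> bool" where
  "basic_solution KB' At \<Gamma> X \<longleftrightarrow>
     clinear_op X \<and> norm X \<le> r_min KB' At \<Gamma> \<and> X = V_1 KB' (At + X) \<Gamma>"

definition W_1 ::
  "(complex \<Rightarrow> ('b::complex_hilbert_space \<Rightarrow>\<^sub>L 'b)) \<Rightarrow> ('b \<Rightarrow>\<^sub>L 'b) \<Rightarrow> complex \<Rightarrow>
   (real \<Rightarrow> complex) \<Rightarrow> ('b \<Rightarrow>\<^sub>L 'b)" where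
  "W_1 KB' H z \<Gamma> =
     id_blinfun
     - op_contour_integral \<Gamma> (\<lambda>\<mu>. KB' \<mu> o\<^sub>L binverse (H - scalar_op \<mu>))
     + (scalar_op z o\<^sub>L op_contour_integral \<Gamma>
          (\<lambda>\<mu>. KB' \<mu> o\<^sub>L scalar_op (inverse (z - \<mu>)) o\<^sub>L binverse (H - scalar_op \<mu>)))"

end

theory Submission
  imports Defs
begin

text \<open>
  Write $H = \widetilde A_1 + X$ and $H_c = \widetilde A_1 + X_c$ for the operators obtained from the contour
  $\Gamma$ and from its conjugate. Inserting $(H-\mu)^{-1}(H-z) = I + (\mu-z)(H-\mu)^{-1}$ under the
  integral and using the basic equation $X = \int K_B'(\mu)\,H(H-\mu)^{-1}d\mu$ one finds
  \[ W_1(z,\Gamma)(H-z) = \widetilde A_1 - z + z\int_\Gamma K_B'(\mu)(z-\mu)^{-1}d\mu, \]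
  in which \<open>X\<close> no longer occurs (\<open>W_factorization\<close>). The same formula holds for
  $\overline z$, $H_c$ and the conjugate contour, and since $K_B'(\overline\mu) = K_B'(\mu)^*$ its right-hand
  side is the adjoint of the one above. This is the asserted equality (\<open>conjugate_contours\<close>).

  For the spectra, let $r$ be \<open>r_min\<close>. As \<open>X\<close> and \<open>Xc\<close> have norm at most $r$ and
  $\widetilde A_1$ is selfadjoint, $H-z$ and $H_c^*-z$ are both invertible if the distance of $z$ from
  $\sigma(\widetilde A_1)$ exceeds $r$ (\<open>selfadjoint_perturbation_resolvent\<close>). If the distance is at most
  $r$, the quadratic equation satisfied by $r$ yields $\|W_1(z,\Gamma)-I\|<1$ (\<open>W_invertible\<close>), likewise for
  the conjugate contour, and the equality shows that $H-z$ is invertible exactly when $H_c^*-z$ is.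

  The analytic input is the absolute convergence of the operator-valued contour integrals
  (\<open>scalar_density_integrable\<close>) and the fact that $d\mu$ has a density with respect to $|d\mu|$ of
  modulus at most 1 (\<open>contour_density_exists\<close>, \<open>contour_density_bounded\<close>), which by its uniqueness
  almost everywhere (\<open>contour_density_unique\<close>) is conjugated together with the contour.
\<close>

section \<open>Complex Hilbert spaces and adjoints\<close>

lemma cinner_add_left: "cinner (x + y) z = cinner x z + cinner y z"
  using cinner_commute[of "x + y" z] cinner_commute[of x z] cinner_commute[of y z]
  by (simp add: cinner_add_right)

lemma cinner_scaleC_left: "cinner (c *\<^sub>C x) y = cnj c * cinner x y"
  using cinner_commute[of "c *\<^sub>C x" y] cinner_commute[of x y] by (simp add: cinner_scaleC_right)

lemma cinner_scaleR_right: "cinner x (r *\<^sub>R y) = of_real r * cinner x y"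
  by (metis cinner_scaleC_right scaleC_of_real)

lemma cinner_scaleR_left: "cinner (r *\<^sub>R x) y = of_real r * cinner x y"
  by (metis cinner_scaleC_left scaleC_of_real complex_cnj_complex_of_real)

lemma cinner_zero_right [simp]: "cinner x 0 = 0"
  using cinner_scaleR_right[of x 0 x] by simp

lemma cinner_minus_right: "cinner x (- y) = - cinner x y"
  using cinner_scaleR_right[of x "-1" y] by simp

lemma cinner_minus_left: "cinner (- x) y = - cinner x y"
  using cinner_scaleR_left[of "-1" x y] by simp

lemma cinner_diff_right: "cinner x (y - z) = cinner x y - cinner x z"
  using cinner_add_right[of x y "- z"] by (simp add: cinner_minus_right)

lemma cinner_diff_left: "cinner (x - y) z = cinner x z - cinner y z"
  using cinner_add_left[of x "- y" z] by (simp add: cinner_minus_left)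

lemmas cinner_simps = cinner_add_left cinner_add_right cinner_diff_left cinner_diff_right
  cinner_scaleC_left cinner_scaleC_right cinner_scaleR_left cinner_scaleR_right
  cinner_minus_left cinner_minus_right

lemma norm_square_cinner: "(norm x)\<^sup>2 = Re (cinner x x)"
  by (metis norm_eq_cinner Re_complex_of_real)

lemma norm_square_diff:
  "(norm (x - y))\<^sup>2 = (norm x)\<^sup>2 - 2 * Re (cinner x y) + (norm y)\<^sup>2"
proof -
  have "Re (cinner y x) = Re (cinner x y)"
    by (subst cinner_commute) simp
  then show ?thesis
    by (simp add: norm_square_cinner cinner_simps)
qed

lemma cauchy_schwarz: "cmod (cinner x y) \<le> norm x * norm y"
proof (cases "y = 0")
  case False
  define c where "c = cinner y x / of_real ((norm y)\<^sup>2)"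
  have n: "norm y > 0" using False by simp
  have e1: "cinner x y = cnj (cinner y x)"
    by (rule cinner_commute)
  have "cinner x (c *\<^sub>C y) = of_real ((cmod (cinner y x))\<^sup>2 / (norm y)\<^sup>2)"
    by (simp add: cinner_simps c_def e1 flip: complex_norm_square)
  moreover have "norm (c *\<^sub>C y) = cmod (cinner y x) / norm y"
    using n by (simp add: norm_scaleC c_def norm_divide norm_mult power2_eq_square)
  ultimately have "(norm (x - c *\<^sub>C y))\<^sup>2
      = (norm x)\<^sup>2 - 2 * ((cmod (cinner y x))\<^sup>2 / (norm y)\<^sup>2) + (cmod (cinner y x) / norm y)\<^sup>2"
    by (simp add: norm_square_diff)
  then have "(cmod (cinner y x))\<^sup>2 / (norm y)\<^sup>2 \<le> (norm x)\<^sup>2"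
    using zero_le_power2[of "norm (x - c *\<^sub>C y)"] by (simp add: power_divide)
  then have "(cmod (cinner y x))\<^sup>2 \<le> (norm x * norm y)\<^sup>2"
    using n by (simp add: power_mult_distrib pos_divide_le_eq)
  then have "cmod (cinner y x) \<le> norm x * norm y"
    by (rule power2_le_imp_le) simp
  then show ?thesis
    by (simp add: e1)
qed simp

lemma bounded_linear_cinner_right: "bounded_linear (\<lambda>y. cinner x y)"
  by (rule bounded_linear_intro[where K = "norm x"])
     (auto simp: cinner_simps scaleR_conv_of_real mult.commute intro: order_trans[OF cauchy_schwarz])

lemma bounded_linear_cinner_left: "bounded_linear (\<lambda>x. cinner x y)"
  by (rule bounded_linear_intro[where K = "norm y"])
     (auto simp: cinner_simps scaleR_conv_of_real intro: order_trans[OF cauchy_schwarz])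

lemma cinner_right_eqI:
  assumes "\<And>x. cinner x y = cinner x z"
  shows "y = z"
proof -
  have "cinner (y - z) (y - z) = 0"
    using assms[of "y - z"] by (simp add: cinner_simps)
  then have "(norm (y - z))\<^sup>2 = 0"
    by (simp add: norm_square_cinner)
  then show ?thesis by simp
qed

lemma scaleC_simps:
  fixes x :: "'a::complex_hilbert_space"
  shows "1 *\<^sub>C x = x" "0 *\<^sub>C x = 0" "c *\<^sub>C (0::'a) = 0" "(- c) *\<^sub>C x = - (c *\<^sub>C x)"
    "c *\<^sub>C (- x) = - (c *\<^sub>C x)" "c *\<^sub>C (x - y) = c *\<^sub>C x - c *\<^sub>C y"
    "(c - d) *\<^sub>C x = c *\<^sub>C x - d *\<^sub>C x" "c *\<^sub>C (r *\<^sub>R x) = r *\<^sub>R (c *\<^sub>C x)"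
proof -
  show "1 *\<^sub>C x = x" "0 *\<^sub>C x = 0"
    using scaleC_of_real[of 1 x] scaleC_of_real[of 0 x] by auto
  have z: "c *\<^sub>C (0::'a) = 0" for c
    using scaleC_add_right[of c 0 "0::'a"] by simp
  show "c *\<^sub>C (0::'a) = 0" by (rule z)
  show m: "(- c) *\<^sub>C x = - (c *\<^sub>C x)" for c x
    using minus_unique[of "c *\<^sub>C x" "(- c) *\<^sub>C x"] scaleC_add_left[of c "- c" x]
      scaleC_of_real[of 0 x] by simp
  show m': "c *\<^sub>C (- x) = - (c *\<^sub>C x)" for x :: 'a
    using minus_unique[of "c *\<^sub>C x" "c *\<^sub>C (- x)"] scaleC_add_right[of c x "- x"] z[of c]
    by simp
  show "c *\<^sub>C (x - y) = c *\<^sub>C x - c *\<^sub>C y"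
    using scaleC_add_right[of c x "- y"] m'[of y] by simp
  show "(c - d) *\<^sub>C x = c *\<^sub>C x - d *\<^sub>C x"
    using scaleC_add_left[of c "- d" x] m[of d x] by simp
  show "c *\<^sub>C (r *\<^sub>R x) = r *\<^sub>R (c *\<^sub>C x)"
    by (simp add: scaleC_of_real[symmetric] scaleC_scaleC mult.commute)
qed

text \<open>The Riesz representation theorem. The minimiser of $\|x\|^2 - 2\,\mathrm{Re}\,f(x)$ represents
  \<open>f\<close>; minimising sequences converge by the parallelogram identity.\<close>

lemma riesz_representation:
  fixes f :: "'a::complex_hilbert_space \<Rightarrow> complex"
  assumes f: "bounded_linear f" and fC: "\<And>c x. f (c *\<^sub>C x) = c * f x"
  shows "\<exists>w. \<forall>x. f x = cinner w x"
proof -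
  interpret bounded_linear f by (rule f)
  define q where "q x = (norm x)\<^sup>2 - 2 * Re (f x)" for x
  obtain K where K: "\<And>x. norm (f x) \<le> norm x * K" using bounded by auto
  have low: "- K\<^sup>2 \<le> q x" for x
  proof -
    have "Re (f x) \<le> norm x * K" using complex_Re_le_cmod K order_trans by blast
    moreover have "0 \<le> (norm x - K)\<^sup>2" by simp
    ultimately show ?thesis unfolding q_def power2_diff by linarith
  qed
  define m where "m = Inf (range q)"
  have bb: "bdd_below (range q)" by (rule bdd_belowI[of _ "- K\<^sup>2"]) (use low in auto)
  have m_le: "m \<le> q x" for x unfolding m_def by (rule cInf_lower[OF _ bb]) simp
  have "\<exists>x. q x < m + 1 / real (Suc n)" for n
  proof -
    have "Inf (range q) < m + 1 / real (Suc n)" by (simp add: m_def)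
    then show ?thesis using cInf_less_iff[OF _ bb] by auto
  qed
  then obtain X where X: "\<And>n. q (X n) < m + 1 / real (Suc n)" by metis
  \<comment> \<open>The parallelogram identity, rewritten for \<open>q\<close>.\<close>
  have par: "(norm (x - y))\<^sup>2 = 2 * q x + 2 * q y - 4 * q ((1/2) *\<^sub>R (x + y))" for x y
  proof -
    have "(norm (x + y))\<^sup>2 = (norm x)\<^sup>2 + 2 * Re (cinner x y) + (norm y)\<^sup>2"
      using norm_square_diff[of x "- y"] by (simp add: cinner_simps)
    moreover have "(norm ((1/2) *\<^sub>R (x + y)))\<^sup>2 = (norm (x + y))\<^sup>2 / 4"
      by (simp only: norm_scaleR power_mult_distrib) (simp add: power_divide)
    ultimately show ?thesis unfolding q_def norm_square_diff
      by (simp add: scaleR add field_simps del: scaleR_add_right)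
  qed
  have close: "(norm (X i - X j))\<^sup>2 \<le> 2 / real (Suc i) + 2 / real (Suc j)" for i j
    using par[of "X i" "X j"] X[of i] X[of j] m_le[of "(1/2) *\<^sub>R (X i + X j)"] by simp
  have "Cauchy X"
  proof (rule metric_CauchyI)
    fix e :: real assume e: "0 < e"
    obtain N where N: "4 / e\<^sup>2 < real N" using reals_Archimedean2 by blast
    moreover have "0 < 4 / e\<^sup>2" using e by simp
    ultimately have N0: "0 < real N" by linarith
    have "dist (X i) (X j) < e" if "N \<le> i" "N \<le> j" for i j
    proof -
      have "2 / real (Suc i) \<le> 2 / real N" "2 / real (Suc j) \<le> 2 / real N"
        using that N0 by (auto intro!: divide_left_mono)
      then have "(norm (X i - X j))\<^sup>2 \<le> 4 / real N" using close[of i j] by linarith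
      also have "4 / real N < e\<^sup>2" using N N0 e by (simp add: field_simps)
      finally show ?thesis using e by (simp add: dist_norm power_less_imp_less_base less_imp_le)
    qed
    then show "\<exists>M. \<forall>i\<ge>M. \<forall>j\<ge>M. dist (X i) (X j) < e" by blast
  qed
  then obtain w where w: "X \<longlonglongrightarrow> w" by (meson Cauchy_convergent convergent_def)
  have "(\<lambda>n. q (X n)) \<longlonglongrightarrow> q w"
    unfolding q_def by (intro tendsto_intros w tendsto)
  moreover have "(\<lambda>n. m + 1 / real (Suc n)) \<longlonglongrightarrow> m + 0"
    by (intro tendsto_intros LIMSEQ_inverse_real_of_nat[unfolded inverse_eq_divide])
  ultimately have "q w \<le> m + 0"
    by (rule LIMSEQ_le) (use X less_imp_le in blast)
  then have min: "q w \<le> q x" for x using m_le[of x] by linarith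
  have re: "Re (f x) = Re (cinner w x)" for x
  proof (cases "x = 0")
    case False
    \<comment> \<open>On the line through \<open>w\<close> in direction \<open>x\<close> the functional \<open>q\<close> is a quadratic polynomial with
      minimum at \<open>t\<close>.\<close>
    define t where "t = (Re (f x) - Re (cinner w x)) / (norm x)\<^sup>2"
    have n: "(norm x)\<^sup>2 > 0" using False by simp
    have "q (w + t *\<^sub>R x) = q w - 2 * t * (Re (f x) - Re (cinner w x)) + t\<^sup>2 * (norm x)\<^sup>2"
      using norm_square_diff[of w "- (t *\<^sub>R x)"]
      by (simp add: q_def cinner_simps add scaleR algebra_simps power_mult_distrib)
    also have "\<dots> = q w - (Re (f x) - Re (cinner w x))\<^sup>2 / (norm x)\<^sup>2"
      using n unfolding t_def by (simp add: power2_eq_square divide_simps)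
    finally have "(Re (f x) - Re (cinner w x))\<^sup>2 / (norm x)\<^sup>2 \<le> 0"
      using min[of "w + t *\<^sub>R x"] by linarith
    then have "(Re (f x) - Re (cinner w x))\<^sup>2 \<le> 0" using n by (simp add: divide_le_0_iff)
    then show ?thesis by simp
  qed (simp add: zero)
  have "f x = cinner w x" for x
    using re[of x] re[of "\<i> *\<^sub>C x"] by (simp add: complex_eq_iff fC cinner_simps)
  then show ?thesis by blast
qed

lemma badj_exists:
  fixes A :: "'a::complex_hilbert_space \<Rightarrow>\<^sub>L 'b::complex_hilbert_space"
  assumes "clinear_op A"
  shows "\<exists>B. \<forall>x y. cinner (blinfun_apply A x) y = cinner x (blinfun_apply B y)"
proof -
  have "\<exists>w. \<forall>x. cinner y (blinfun_apply A x) = cinner w x" for y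
  proof (rule riesz_representation)
    show "bounded_linear (\<lambda>x. cinner y (blinfun_apply A x))"
      by (rule bounded_linear_compose[OF bounded_linear_cinner_right blinfun.bounded_linear_right])
  qed (use assms in \<open>simp add: clinear_op_def cinner_simps\<close>)
  then obtain B where B0: "\<And>y x. cinner y (blinfun_apply A x) = cinner (B y) x" by metis
  have B: "cinner (blinfun_apply A x) y = cinner x (B y)" for x y
    using B0[of y x] cinner_commute[of "blinfun_apply A x" y] cinner_commute[of x "B y"] by simp
  have "bounded_linear B"
  proof (rule bounded_linear_intro[where K = "norm A"])
    show "B (x + y) = B x + B y" for x y
      by (rule cinner_right_eqI) (simp add: cinner_simps flip: B)
    show "B (r *\<^sub>R x) = r *\<^sub>R B x" for r x
      by (rule cinner_right_eqI) (simp add: cinner_simps flip: B)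
    show "norm (B x) \<le> norm x * norm A" for x
    proof -
      have "(norm (B x))\<^sup>2 \<le> cmod (cinner (B x) (B x))"
        by (simp add: norm_square_cinner complex_Re_le_cmod)
      also have "\<dots> = cmod (cinner (blinfun_apply A (B x)) x)" by (simp add: B)
      also have "\<dots> \<le> norm (blinfun_apply A (B x)) * norm x" by (rule cauchy_schwarz)
      also have "\<dots> \<le> norm A * norm (B x) * norm x"
        by (intro mult_right_mono norm_blinfun) auto
      finally show ?thesis
        by (cases "norm (B x) = 0") (auto simp: power2_eq_square mult.commute mult.left_commute)
    qed
  qed
  then show ?thesis
    using B by (intro exI[of _ "Blinfun B"]) (simp add: bounded_linear_Blinfun_apply)
qed

lemma badj_eqI:
  assumes "\<And>x y. cinner (blinfun_apply A x) y = cinner x (blinfun_apply B y)"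
  shows "badj A = B"
  unfolding badj_def
proof (rule the_equality)
  show "B' = B" if "\<forall>x y. cinner (blinfun_apply A x) y = cinner x (blinfun_apply B' y)" for B'
    using that assms by (intro blinfun_eqI cinner_right_eqI) metis
qed (use assms in blast)

lemma cinner_badj_right:
  assumes "clinear_op A"
  shows "cinner x (blinfun_apply (badj A) y) = cinner (blinfun_apply A x) y"
  using badj_exists[OF assms] badj_eqI by metis

lemma cinner_badj_left:
  assumes "clinear_op A"
  shows "cinner (blinfun_apply (badj A) x) y = cinner x (blinfun_apply A y)"
  using cinner_badj_right[OF assms, of y x] cinner_commute[of "blinfun_apply (badj A) x" y]
    cinner_commute[of x "blinfun_apply A y"] by simp

lemma clinear_op_badj:
  assumes "clinear_op A"
  shows "clinear_op (badj A)"
  unfolding clinear_op_def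
  by (intro allI cinner_right_eqI) (simp add: cinner_badj_right[OF assms] cinner_simps)

lemma badj_badj: "clinear_op A \<Longrightarrow> badj (badj A) = A"
  by (rule badj_eqI) (simp add: cinner_badj_left)

lemma norm_badj_le:
  assumes "clinear_op A"
  shows "norm (badj A) \<le> norm A"
proof (rule norm_blinfun_bound)
  fix y
  let ?z = "blinfun_apply (badj A) y"
  have "(norm ?z)\<^sup>2 \<le> cmod (cinner ?z ?z)"
    by (simp add: norm_square_cinner complex_Re_le_cmod)
  also have "\<dots> = cmod (cinner (blinfun_apply A ?z) y)" by (simp add: cinner_badj_right[OF assms])
  also have "\<dots> \<le> norm (blinfun_apply A ?z) * norm y" by (rule cauchy_schwarz)
  also have "\<dots> \<le> norm A * norm ?z * norm y" by (intro mult_right_mono norm_blinfun) auto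
  finally show "norm ?z \<le> norm A * norm y"
    by (cases "norm ?z = 0") (auto simp: power2_eq_square mult.commute mult.left_commute)
qed simp

lemma norm_badj: "clinear_op A \<Longrightarrow> norm (badj A) = norm A"
  using norm_badj_le[of A] norm_badj_le[of "badj A"] by (simp add: badj_badj clinear_op_badj)

section \<open>Inverses and resolvents of bounded operators\<close>

lemma scalar_op_apply [simp]: "blinfun_apply (scalar_op c) x = c *\<^sub>C x"
  by (simp add: scalar_op.rep_eq)

lemma norm_scalar_op_le: "norm (scalar_op c) \<le> cmod c"
  by (rule norm_blinfun_bound) (simp_all add: norm_scaleC)

lemma clinear_op_add: "clinear_op A \<Longrightarrow> clinear_op B \<Longrightarrow> clinear_op (A + B)"
  by (simp add: clinear_op_def blinfun.add_left scaleC_add_right)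

lemma clinear_op_diff: "clinear_op A \<Longrightarrow> clinear_op B \<Longrightarrow> clinear_op (A - B)"
  by (simp add: clinear_op_def blinfun.diff_left scaleC_simps)

lemma clinear_op_compose: "clinear_op A \<Longrightarrow> clinear_op B \<Longrightarrow> clinear_op (A o\<^sub>L B)"
  by (simp add: clinear_op_def)

lemma clinear_op_scalar: "clinear_op (scalar_op c)"
  by (simp add: clinear_op_def scaleC_scaleC mult.commute)

lemma clinear_op_id: "clinear_op id_blinfun"
  by (simp add: clinear_op_def)

lemma clinear_op_commute_scalar:
  "clinear_op A \<Longrightarrow> A o\<^sub>L scalar_op c = scalar_op c o\<^sub>L A"
  by (rule blinfun_eqI) (simp add: clinear_op_def)

lemmas clinear_op_intros =
  clinear_op_add clinear_op_diff clinear_op_compose clinear_op_scalar clinear_op_id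

lemma bselfadjoint_clinear: "bselfadjoint A \<Longrightarrow> clinear_op A"
  by (simp add: bselfadjoint_def)

lemma badj_bselfadjoint: "bselfadjoint A \<Longrightarrow> badj A = A"
  by (rule badj_eqI) (simp add: bselfadjoint_def)

lemma badj_id: "badj id_blinfun = id_blinfun"
  by (rule badj_eqI) simp

lemma badj_scalar: "badj (scalar_op c) = scalar_op (cnj c)"
  by (rule badj_eqI) (simp add: cinner_simps)

lemma badj_compose:
  "clinear_op A \<Longrightarrow> clinear_op B \<Longrightarrow> badj (A o\<^sub>L B) = badj B o\<^sub>L badj A"
  by (rule badj_eqI) (simp add: cinner_badj_right)

lemma badj_add: "clinear_op A \<Longrightarrow> clinear_op B \<Longrightarrow> badj (A + B) = badj A + badj B"
  by (rule badj_eqI) (simp add: cinner_badj_right blinfun.add_left cinner_simps)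

lemma badj_diff: "clinear_op A \<Longrightarrow> clinear_op B \<Longrightarrow> badj (A - B) = badj A - badj B"
  by (rule badj_eqI) (simp add: cinner_badj_right blinfun.diff_left cinner_simps)

lemma is_binverseD:
  assumes "is_binverse A R"
  shows "blinfun_apply A (blinfun_apply R x) = x" "blinfun_apply R (blinfun_apply A x) = x"
  using assms unfolding is_binverse_def
  by (metis blinfun_apply_blinfun_compose id_blinfun.rep_eq)+

lemma is_binverseI:
  assumes "\<And>x. blinfun_apply A (blinfun_apply R x) = x"
    and "\<And>x. blinfun_apply R (blinfun_apply A x) = x"
  shows "is_binverse A R"
  unfolding is_binverse_def using assms by (auto intro!: blinfun_eqI)

lemma binverse_eq: "is_binverse A R \<Longrightarrow> binverse A = R"
  unfolding binverse_def
  by (rule the_equality) (auto intro!: blinfun_eqI dest: is_binverseD, metis is_binverseD)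

lemma is_binverse_compose:
  "is_binverse A R \<Longrightarrow> is_binverse B S \<Longrightarrow> is_binverse (A o\<^sub>L B) (S o\<^sub>L R)"
  by (rule is_binverseI) (simp_all add: is_binverseD)

lemma is_binverse_sym: "is_binverse A R \<Longrightarrow> is_binverse R A"
  by (simp add: is_binverse_def)

lemma is_binverse_clinear:
  assumes "is_binverse A R" "clinear_op A"
  shows "clinear_op R"
  unfolding clinear_op_def
proof (intro allI)
  fix c x
  have "blinfun_apply R (c *\<^sub>C x) = blinfun_apply R (c *\<^sub>C blinfun_apply A (blinfun_apply R x))"
    by (simp add: is_binverseD[OF assms(1)])
  also have "\<dots> = blinfun_apply R (blinfun_apply A (c *\<^sub>C blinfun_apply R x))"
    using assms(2) by (simp add: clinear_op_def)
  also have "\<dots> = c *\<^sub>C blinfun_apply R x" by (simp add: is_binverseD[OF assms(1)])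
  finally show "blinfun_apply R (c *\<^sub>C x) = c *\<^sub>C blinfun_apply R x" .
qed

lemma is_binverse_badj:
  assumes "is_binverse A R" "clinear_op A"
  shows "is_binverse (badj A) (badj R)"
proof -
  have R: "clinear_op R" using is_binverse_clinear assms .
  show ?thesis
    using assms unfolding is_binverse_def
    by (metis R badj_compose badj_id)
qed

text \<open>The inverse is the Neumann series $\sum_n(-T)^n$.\<close>

lemma neumann_inverse:
  fixes T :: "'a::complex_hilbert_space \<Rightarrow>\<^sub>L 'a"
  assumes "norm T < 1"
  shows "\<exists>S. is_binverse (id_blinfun + T) S"
proof -
  define p where "p n = ((\<lambda>U. (- T) o\<^sub>L U) ^^ n) id_blinfun" for n
  have p0: "p 0 = id_blinfun" and pS: "p (Suc n) = (- T) o\<^sub>L p n" for n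
    by (simp_all add: p_def)
  have pS': "p (Suc n) = p n o\<^sub>L (- T)" for n
  proof (induction n)
    case 0
    then show ?case by (rule blinfun_eqI) (simp add: p0 pS)
  next
    case (Suc n)
    have "p (Suc (Suc n)) = (- T) o\<^sub>L (p n o\<^sub>L (- T))" by (simp only: pS[of "Suc n"] Suc)
    also have "\<dots> = p (Suc n) o\<^sub>L (- T)" by (rule blinfun_eqI) (simp add: pS)
    finally show ?case .
  qed
  have "norm (p n) \<le> norm T ^ n" for n
  proof (induction n)
    case 0
    then show ?case by (simp add: p0 norm_blinfun_id_le)
  next
    case (Suc n)
    have "norm (p (Suc n)) \<le> norm (- T) * norm (p n)" unfolding pS by (rule norm_blinfun_compose)
    also have "\<dots> \<le> norm T * norm T ^ n" using Suc by (simp add: mult_left_mono)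
    finally show ?case by simp
  qed
  then have "summable (\<lambda>n. p n)"
    by (intro summable_comparison_test'[OF summable_geometric[of "norm T"], of 0]) (use assms in auto)
  then obtain S where S: "p sums S" by (auto simp: summable_def)
  have Suc: "(\<lambda>n. p (Suc n)) sums (S - id_blinfun)"
    using sums_Suc_iff[of p "S - id_blinfun"] S by (simp add: p0)
  have "(\<lambda>n. (- T) o\<^sub>L p n) sums ((- T) o\<^sub>L S)"
    by (rule bounded_linear.sums[OF bounded_bilinear.bounded_linear_right[OF bounded_bilinear_blinfun_compose] S])
  then have 1: "(- T) o\<^sub>L S = S - id_blinfun"
    using Suc sums_unique2 unfolding pS by blast
  have "(\<lambda>n. p n o\<^sub>L (- T)) sums (S o\<^sub>L (- T))"
    by (rule bounded_linear.sums[OF bounded_bilinear.bounded_linear_left[OF bounded_bilinear_blinfun_compose] S])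
  then have 2: "S o\<^sub>L (- T) = S - id_blinfun"
    using Suc sums_unique2 unfolding pS' by blast
  have "is_binverse (id_blinfun + T) S"
  proof (rule is_binverseI)
    fix x
    show "blinfun_apply (id_blinfun + T) (blinfun_apply S x) = x"
      using arg_cong[OF 1, of "\<lambda>U. blinfun_apply U x"]
      by (simp add: blinfun.add_left blinfun.diff_left blinfun.minus_left algebra_simps)
    show "blinfun_apply S (blinfun_apply (id_blinfun + T) x) = x"
      using arg_cong[OF 2, of "\<lambda>U. blinfun_apply U x"]
      by (simp add: blinfun.add_left blinfun.diff_left blinfun.minus_left blinfun.add_right
          blinfun.minus_right algebra_simps)
  qed
  then show ?thesis ..
qed

lemma bspectrum_bound:
  fixes A :: "'a::complex_hilbert_space \<Rightarrow>\<^sub>L 'a"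
  assumes A: "clinear_op A" and z: "z \<in> bspectrum A"
  shows "cmod z \<le> norm A"
proof (rule ccontr)
  assume "\<not> ?thesis"
  then have lt: "norm A < cmod z" by simp
  then have z0: "z \<noteq> 0" by auto
  let ?T = "scalar_op (- inverse z) o\<^sub>L A"
  have "norm ?T \<le> cmod (- inverse z) * norm A"
    by (intro order_trans[OF norm_blinfun_compose] mult_right_mono norm_scalar_op_le) auto
  also have "\<dots> < 1" using lt z0 by (simp only: norm_minus_cancel norm_inverse) (simp add: field_simps)
  finally obtain S where S: "is_binverse (id_blinfun + ?T) S" using neumann_inverse by blast
  have "is_binverse (scalar_op (- z)) (scalar_op (- inverse z) :: 'a \<Rightarrow>\<^sub>L 'a)"
    using z0 by (intro is_binverseI) (simp_all add: scaleC_scaleC scaleC_simps)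
  from is_binverse_compose[OF this S]
  have "is_binverse (scalar_op (- z) o\<^sub>L (id_blinfun + ?T)) (S o\<^sub>L scalar_op (- inverse z))" .
  moreover have "scalar_op (- z) o\<^sub>L (id_blinfun + ?T) = A - scalar_op z"
    using z0 by (intro blinfun_eqI)
      (simp add: blinfun.add_left blinfun.diff_left scaleC_add_right scaleC_scaleC scaleC_simps)
  ultimately show False using z by (auto simp: bspectrum_def)
qed

text \<open>If the spectrum of a selfadjoint operator misses the interval $(a-c,a+c)$, then $A-a$ is
  bounded below by \<open>c\<close>. The inverse \<open>B\<close> of $A-a$ is selfadjoint, hence one of the numbers
  $\pm\|B\|$ belongs to its spectrum: otherwise $u - \|B\|^{-2}B^2u$ would dominate $B^2u$, which
  fails for unit vectors \<open>u\<close> with $\|Bu\|$ close to $\|B\|$.\<close>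

lemma selfadjoint_gap_lower_bound:
  fixes A :: "'a::complex_hilbert_space \<Rightarrow>\<^sub>L 'a"
  assumes A: "bselfadjoint A" and c: "0 < c"
    and gap: "\<And>t::real. \<bar>t - a\<bar> < c \<Longrightarrow> of_real t \<notin> bspectrum A"
  shows "c * norm x \<le> norm (blinfun_apply (A - scalar_op (of_real a)) x)"
proof -
  define S where "S = A - scalar_op (of_real a)"
  have S_sym: "cinner (blinfun_apply S u) v = cinner u (blinfun_apply S v)" for u v
    using A by (simp add: S_def bselfadjoint_def blinfun.diff_left cinner_simps)
  have inv: "\<exists>R. is_binverse (S - scalar_op (of_real b)) R" if "\<bar>b\<bar> < c" for b :: real
  proof -
    have "S - scalar_op (of_real b) = A - scalar_op (of_real (a + b))"
      by (rule blinfun_eqI) (simp add: S_def blinfun.diff_left scaleC_add_left)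
    then show ?thesis using gap[of "a + b"] that by (simp add: bspectrum_def)
  qed
  have "S - scalar_op (of_real 0) = S"
    by (rule blinfun_eqI) (simp add: blinfun.diff_left scaleC_simps)
  then obtain B where B: "is_binverse S B" using inv[of 0] c by auto
  note B1 = is_binverseD[OF B]
  define m where "m = norm B"
  have m0: "0 \<le> m" by (simp add: m_def)
  have Bm: "norm (blinfun_apply B u) \<le> m * norm u" for u by (simp add: m_def norm_blinfun)
  have B_sym: "cinner (blinfun_apply B u) v = cinner u (blinfun_apply B v)" for u v
    by (metis B1(1) S_sym)
  have "m * c \<le> 1"
  proof (rule ccontr)
    assume "\<not> m * c \<le> 1"
    then have mc: "1 < m * c" by simp
    have mpos: "0 < m" using mc m0 c by (cases "m = 0") auto
    define b where "b = 1 / m"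
    have b: "0 < b" "b < c" using mpos mc by (auto simp: b_def field_simps)
    obtain R1 where R1: "is_binverse (S - scalar_op (of_real b)) R1" using inv[of b] b by auto
    obtain R2 where R2: "is_binverse (S - scalar_op (of_real (- b))) R2" using inv[of "- b"] b by auto
    define K where "K = norm (R2 o\<^sub>L R1) + 1"
    have K: "0 < K" unfolding K_def by (smt (verit) norm_ge_zero)
    have dom: "norm (blinfun_apply B (blinfun_apply B u))
        \<le> K * norm (u - b\<^sup>2 *\<^sub>R blinfun_apply B (blinfun_apply B u))" for u
    proof -
      let ?v = "blinfun_apply B (blinfun_apply B u)"
      have eq: "blinfun_apply (S - scalar_op (of_real b)) (blinfun_apply (S - scalar_op (of_real (- b))) ?v)
          = u - b\<^sup>2 *\<^sub>R ?v"
        by (simp only: scalar_op_apply blinfun.diff_left scaleC_of_real)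
           (simp add: blinfun.diff_right blinfun.add_right blinfun.scaleR_right B1 scaleR_diff_right
            scaleR_add_right power2_eq_square blinfun.minus_right)
      then have "blinfun_apply (R2 o\<^sub>L R1) (u - b\<^sup>2 *\<^sub>R ?v) = ?v"
        by (simp only: blinfun_apply_blinfun_compose is_binverseD(2)[OF R1] is_binverseD(2)[OF R2]
            flip: eq)
      then have "norm ?v \<le> norm (R2 o\<^sub>L R1) * norm (u - b\<^sup>2 *\<^sub>R ?v)"
        using norm_blinfun[of "R2 o\<^sub>L R1" "u - b\<^sup>2 *\<^sub>R ?v"] by simp
      also have "\<dots> \<le> K * norm (u - b\<^sup>2 *\<^sub>R ?v)"
        unfolding K_def by (intro mult_right_mono) auto
      finally show ?thesis .
    qed
    \<comment> \<open>If $\|Bu\|^2 \ge \frac12 m^2\|u\|^2$, then $\|B^2u\|$ is bounded below, and so is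
      $\|u-b^2B^2u\|$ by \<open>dom\<close>; this keeps $\|Bu\|$ away from $m\|u\|$.\<close>
    define \<rho> where "\<rho> = max (1/2) (1 - m ^ 4 / (4 * K\<^sup>2))"
    have \<rho>: "0 < \<rho>" "\<rho> < 1" using mpos K by (auto simp: \<rho>_def)
    have small: "norm (blinfun_apply B u) \<le> sqrt \<rho> * m * norm u" for u
    proof -
      let ?v = "blinfun_apply B (blinfun_apply B u)"
      define s n where "s = (norm (blinfun_apply B u))\<^sup>2" and "n = (norm u)\<^sup>2"
      have s0: "0 \<le> s" "0 \<le> n" by (auto simp: s_def n_def)
      have uv: "Re (cinner u ?v) = s"
        by (simp add: s_def norm_square_cinner B_sym)
      have "s \<le> norm u * norm ?v"
        using complex_Re_le_cmod[of "cinner u ?v"] cauchy_schwarz[of u ?v] uv by linarith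
      then have 1: "s\<^sup>2 \<le> n * (norm ?v)\<^sup>2"
        using s0 by (metis n_def power_mono power_mult_distrib)
      have "(norm ?v)\<^sup>2 \<le> (K * norm (u - b\<^sup>2 *\<^sub>R ?v))\<^sup>2"
        using dom[of u] by (rule power_mono) simp
      also have "\<dots> = K\<^sup>2 * (n - 2 * b\<^sup>2 * s + (b\<^sup>2)\<^sup>2 * (norm ?v)\<^sup>2)"
        by (simp add: power_mult_distrib norm_square_diff cinner_simps uv n_def algebra_simps)
      also have "\<dots> \<le> K\<^sup>2 * (n - 2 * b\<^sup>2 * s + (b\<^sup>2)\<^sup>2 * (m\<^sup>2 * s))"
      proof -
        have "(norm ?v)\<^sup>2 \<le> (m * norm (blinfun_apply B u))\<^sup>2" by (rule power_mono[OF Bm]) simp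
        then have "(norm ?v)\<^sup>2 \<le> m\<^sup>2 * s" by (simp add: s_def power_mult_distrib)
        then show ?thesis by (intro mult_left_mono add_left_mono) auto
      qed
      also have "\<dots> = K\<^sup>2 * (n - s / m\<^sup>2)"
        using mpos by (simp add: b_def power_divide power2_eq_square)
      finally have 2: "s\<^sup>2 \<le> n * (K\<^sup>2 * (n - s / m\<^sup>2))"
        using 1 s0 by (meson mult_left_mono order_trans)
      have "s \<le> \<rho> * m\<^sup>2 * n"
      proof (rule ccontr)
        assume "\<not> ?thesis"
        then have s: "\<rho> * m\<^sup>2 * n < s" by simp
        have n: "0 < n"
        proof (rule ccontr)
          assume "\<not> 0 < n"
          then have "u = 0" using s0 by (simp add: n_def)
          then show False using s by (simp add: s_def n_def)
        qed
        have "1/2 * (m\<^sup>2 * n) \<le> \<rho> * (m\<^sup>2 * n)"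
          by (rule mult_right_mono) (simp_all add: \<rho>_def s0)
        then have "m\<^sup>2 * n / 2 \<le> s" using s by (simp add: mult.assoc)
        then have "(m\<^sup>2 * n / 2)\<^sup>2 \<le> s\<^sup>2" by (rule power_mono) (simp add: s0)
        moreover have "n - s / m\<^sup>2 < n * (m ^ 4 / (4 * K\<^sup>2))"
        proof -
          have "(1 - m ^ 4 / (4 * K\<^sup>2)) * (m\<^sup>2 * n) \<le> \<rho> * (m\<^sup>2 * n)"
            by (intro mult_right_mono) (auto simp: \<rho>_def s0)
          then have "(1 - m ^ 4 / (4 * K\<^sup>2)) * n < s / m\<^sup>2"
            using s mpos by (simp add: field_simps)
          then show ?thesis by (simp add: algebra_simps)
        qed
        then have "n * (K\<^sup>2 * (n - s / m\<^sup>2)) < n * (K\<^sup>2 * (n * (m ^ 4 / (4 * K\<^sup>2))))"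
          using n K by (intro mult_strict_left_mono) auto
        moreover have "n * (K\<^sup>2 * (n * (m ^ 4 / (4 * K\<^sup>2)))) = (m\<^sup>2 * n / 2)\<^sup>2"
          using K by (simp add: field_simps power2_eq_square power4_eq_xxxx)
        ultimately show False using 2 by linarith
      qed
      then have "(norm (blinfun_apply B u))\<^sup>2 \<le> (sqrt \<rho> * m * norm u)\<^sup>2"
        using \<rho> by (simp add: s_def n_def power_mult_distrib)
      then show ?thesis by (rule power2_le_imp_le) (use \<rho> m0 in auto)
    qed
    have "m \<le> sqrt \<rho> * m"
      unfolding m_def by (rule norm_blinfun_bound) (use small \<rho> in \<open>auto simp: m_def\<close>)
    then show False using mpos \<rho> by simp
  qed
  have "norm x \<le> m * norm (blinfun_apply S x)" using Bm[of "blinfun_apply S x"] by (simp add: B1)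
  then have "c * norm x \<le> (m * c) * norm (blinfun_apply S x)"
    using c by (simp add: mult.commute mult.left_commute)
  also have "\<dots> \<le> 1 * norm (blinfun_apply S x)" using \<open>m * c \<le> 1\<close> by (intro mult_right_mono) auto
  finally show ?thesis by (simp add: S_def)
qed

text \<open>Since $\|(A-\mu)x\|^2 = \|(A-\mathrm{Re}\,\mu)x\|^2 + (\mathrm{Im}\,\mu)^2\|x\|^2$, the estimate follows from
  the one for a gap around the real point $\mathrm{Re}\,\mu$.\<close>

lemma selfadjoint_resolvent_lower_bound:
  fixes A :: "'a::complex_hilbert_space \<Rightarrow>\<^sub>L 'a"
  assumes A: "bselfadjoint A" and real: "bspectrum A \<subseteq> \<real>" and ne: "bspectrum A \<noteq> {}"
  shows "infdist \<mu> (bspectrum A) * norm x \<le> norm (blinfun_apply (A - scalar_op \<mu>) x)"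
proof -
  define d where "d = infdist \<mu> (bspectrum A)"
  define a b where "a = Re \<mu>" and "b = Im \<mu>"
  define S where "S = A - scalar_op (of_real a)"
  have db: "\<bar>b\<bar> \<le> d"
    unfolding d_def infdist_notempty[OF ne]
  proof (rule cINF_greatest[OF ne])
    fix y assume "y \<in> bspectrum A"
    then have "Im y = 0" using real by (auto simp: complex_is_Real_iff)
    then show "\<bar>b\<bar> \<le> dist \<mu> y" using abs_Im_le_cmod[of "\<mu> - y"] by (simp add: b_def dist_norm)
  qed
  define c where "c = sqrt (d\<^sup>2 - b\<^sup>2)"
  have "b\<^sup>2 \<le> d\<^sup>2" using db by (metis abs_ge_zero power2_abs power_mono)
  then have c0: "0 \<le> c" and c2: "c\<^sup>2 = d\<^sup>2 - b\<^sup>2" by (auto simp: c_def)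
  have low: "c * norm x \<le> norm (blinfun_apply S x)"
  proof (cases "c = 0")
    case False
    show ?thesis unfolding S_def
    proof (rule selfadjoint_gap_lower_bound[OF A])
      show "0 < c" using False c0 by simp
      fix t :: real assume t: "\<bar>t - a\<bar> < c"
      show "of_real t \<notin> bspectrum A"
      proof
        assume "of_real t \<in> bspectrum A"
        then have "d \<le> dist \<mu> (of_real t)" unfolding d_def by (rule infdist_le)
        then have "d\<^sup>2 \<le> (dist \<mu> (of_real t))\<^sup>2"
          using db by (intro power_mono) auto
        also have "\<dots> = (t - a)\<^sup>2 + b\<^sup>2"
          by (simp add: dist_norm cmod_def a_def b_def power2_commute)
        also have "(t - a)\<^sup>2 < c\<^sup>2" using t c0 by (metis abs_ge_zero power2_abs power_strict_mono pos2)
        finally show False using c2 by simp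
      qed
    qed
  qed simp
  have im: "Re (cinner (blinfun_apply S x) ((\<i> * of_real b) *\<^sub>C x)) = 0"
  proof -
    have "cinner (blinfun_apply S x) x = cinner x (blinfun_apply S x)"
      using A by (simp add: S_def bselfadjoint_def blinfun.diff_left cinner_simps)
    then have "Im (cinner (blinfun_apply S x) x) = 0"
      by (metis cinner_commute complex_is_Real_iff Reals_cnj_iff)
    then show ?thesis by (simp add: cinner_simps)
  qed
  have mu: "\<mu> = of_real a + \<i> * of_real b" by (simp add: a_def b_def complex_eq_iff)
  have "blinfun_apply (A - scalar_op \<mu>) x = blinfun_apply S x - (\<i> * of_real b) *\<^sub>C x"
    by (subst mu) (simp add: S_def blinfun.diff_left scaleC_add_left)
  then have "(norm (blinfun_apply (A - scalar_op \<mu>) x))\<^sup>2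
      = (norm (blinfun_apply S x))\<^sup>2 + b\<^sup>2 * (norm x)\<^sup>2"
    using im by (simp add: norm_square_diff norm_scaleC norm_mult power_mult_distrib)
  also have "\<dots> \<ge> (c * norm x)\<^sup>2 + b\<^sup>2 * (norm x)\<^sup>2"
    using low c0 by (intro add_right_mono power_mono) auto
  finally have "(d * norm x)\<^sup>2 \<le> (norm (blinfun_apply (A - scalar_op \<mu>) x))\<^sup>2"
    by (simp add: power_mult_distrib c2 algebra_simps)
  then show ?thesis unfolding d_def by (rule power2_le_imp_le) simp
qed

lemma infdist_bspectrum_ge:
  fixes A :: "'a::complex_hilbert_space \<Rightarrow>\<^sub>L 'a"
  assumes "clinear_op A" "bspectrum A \<noteq> {}"
  shows "cmod \<mu> - norm A \<le> infdist \<mu> (bspectrum A)"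
  unfolding infdist_notempty[OF assms(2)]
proof (rule cINF_greatest[OF assms(2)])
  fix y assume "y \<in> bspectrum A"
  from bspectrum_bound[OF assms(1) this] show "cmod \<mu> - norm A \<le> dist \<mu> y"
    using norm_triangle_ineq2[of \<mu> y] by (simp add: dist_norm)
qed

lemma selfadjoint_perturbation_resolvent:
  fixes A :: "'a::complex_hilbert_space \<Rightarrow>\<^sub>L 'a"
  assumes A: "bselfadjoint A" and real: "bspectrum A \<subseteq> \<real>" and ne: "bspectrum A \<noteq> {}"
    and X: "norm X < infdist \<mu> (bspectrum A)"
  shows "\<exists>R. is_binverse (A + X - scalar_op \<mu>) R \<and>
    norm R \<le> 1 / (infdist \<mu> (bspectrum A) - norm X)"
proof -
  define d where "d = infdist \<mu> (bspectrum A)"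
  have d: "norm X < d" "0 < d" using X norm_ge_zero[of X] unfolding d_def by linarith+
  have "\<mu> \<notin> bspectrum A" using d by (auto simp: d_def)
  then obtain R0 where R0: "is_binverse (A - scalar_op \<mu>) R0" by (auto simp: bspectrum_def)
  note low = selfadjoint_resolvent_lower_bound[OF A real ne, folded d_def]
  have nR0: "norm R0 \<le> 1 / d"
  proof (rule norm_blinfun_bound)
    fix y show "norm (blinfun_apply R0 y) \<le> 1 / d * norm y"
      using low[of \<mu> "blinfun_apply R0 y"] d
      by (simp add: is_binverseD[OF R0] field_simps d_def)
  qed (use d in simp)
  have "norm (R0 o\<^sub>L X) \<le> norm R0 * norm X" by (rule norm_blinfun_compose)
  also have "\<dots> \<le> 1 / d * norm X" using nR0 by (intro mult_right_mono) auto
  also have "\<dots> < 1" using d by (simp add: field_simps)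
  finally obtain S where "is_binverse (id_blinfun + (R0 o\<^sub>L X)) S" using neumann_inverse by blast
  from is_binverse_compose[OF R0 this]
  have "is_binverse ((A - scalar_op \<mu>) o\<^sub>L (id_blinfun + (R0 o\<^sub>L X))) (S o\<^sub>L R0)" .
  moreover have "(A - scalar_op \<mu>) o\<^sub>L (id_blinfun + (R0 o\<^sub>L X)) = A + X - scalar_op \<mu>"
  proof (rule blinfun_eqI)
    fix x
    show "blinfun_apply ((A - scalar_op \<mu>) o\<^sub>L (id_blinfun + (R0 o\<^sub>L X))) x
        = blinfun_apply (A + X - scalar_op \<mu>) x"
      using is_binverseD(1)[OF R0, of "blinfun_apply X x"]
      by (simp add: blinfun.add_left blinfun.diff_left blinfun.add_right scaleC_add_right
          algebra_simps)
  qed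
  ultimately have R: "is_binverse (A + X - scalar_op \<mu>) (S o\<^sub>L R0)" by simp
  have "norm (S o\<^sub>L R0) \<le> 1 / (d - norm X)"
  proof (rule norm_blinfun_bound)
    fix y
    let ?x = "blinfun_apply (S o\<^sub>L R0) y"
    have "norm (blinfun_apply (A - scalar_op \<mu>) ?x) \<le> norm y + norm X * norm ?x"
    proof -
      have "blinfun_apply (A - scalar_op \<mu>) ?x = y - blinfun_apply X ?x"
        using is_binverseD(1)[OF R, of y]
        by (simp add: blinfun.add_left blinfun.diff_left algebra_simps del: blinfun_apply_blinfun_compose)
      then show ?thesis
        by (metis norm_triangle_ineq4 norm_blinfun add_left_mono order_trans)
    qed
    then have "(d - norm X) * norm ?x \<le> norm y"
      using low[of \<mu> ?x] by (simp add: d_def algebra_simps)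
    then show "norm ?x \<le> 1 / (d - norm X) * norm y"
      using d by (simp add: pos_le_divide_eq mult.commute)
  qed (use d in simp)
  then show ?thesis using R unfolding d_def by blast
qed

section \<open>Integration of dominated functions with values in a Banach space\<close>

text \<open>The operator-valued integrals are gauge integrals in a Banach space that need not be separable, so
  that integrability has to be obtained from approximations. Uniform approximation is too strong near
  a singularity; approximation in the mean with an integrable error bound suffices, because Riemann
  sums of the error are dominated by those of the bound.\<close>

lemma integrable_cbox_mean_approximation:
  fixes f :: "'n::euclidean_space \<Rightarrow> 'a::banach"
  assumes approx: "\<And>e. 0 < e \<Longrightarrow> \<exists>g h. g integrable_on cbox a b \<and> h integrable_on cbox a b \<and>
      (\<forall>x\<in>cbox a b. norm (f x - g x) \<le> h x) \<and> integral (cbox a b) h \<le> e"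
  shows "f integrable_on cbox a b"
  unfolding integrable_Cauchy
proof (intro allI impI)
  fix e :: real assume e: "0 < e"
  then obtain g h where g: "g integrable_on cbox a b" and h: "h integrable_on cbox a b"
    and fg: "\<And>x. x \<in> cbox a b \<Longrightarrow> norm (f x - g x) \<le> h x" and h_le: "integral (cbox a b) h \<le> e / 8"
    using approx[of "e / 8"] by auto
  define I where "I = integral (cbox a b) g"
  obtain \<gamma>1 where \<gamma>1: "gauge \<gamma>1" "\<And>\<D>. \<D> tagged_division_of cbox a b \<Longrightarrow> \<gamma>1 fine \<D> \<Longrightarrow>
      norm ((\<Sum>(x, K)\<in>\<D>. measure lborel K *\<^sub>R g x) - I) < e / 8"
    using integrable_integral[OF g, unfolded has_integral] e unfolding I_def
    by (metis zero_less_divide_iff zero_less_numeral)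
  obtain \<gamma>2 where \<gamma>2: "gauge \<gamma>2" "\<And>\<D>. \<D> tagged_division_of cbox a b \<Longrightarrow> \<gamma>2 fine \<D> \<Longrightarrow>
      norm ((\<Sum>(x, K)\<in>\<D>. measure lborel K *\<^sub>R h x) - integral (cbox a b) h) < e / 8"
    using integrable_integral[OF h, unfolded has_integral] e
    by (metis zero_less_divide_iff zero_less_numeral)
  have near: "norm ((\<Sum>(x, K)\<in>\<D>. measure lborel K *\<^sub>R f x) - I) < 3 * e / 8"
    if D: "\<D> tagged_division_of cbox a b" "\<gamma>1 fine \<D>" "\<gamma>2 fine \<D>" for \<D>
  proof -
    have "norm ((\<Sum>(x, K)\<in>\<D>. measure lborel K *\<^sub>R f x) - (\<Sum>(x, K)\<in>\<D>. measure lborel K *\<^sub>R g x))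
        = norm (\<Sum>(x, K)\<in>\<D>. measure lborel K *\<^sub>R (f x - g x))"
      by (simp add: sum_subtractf[symmetric] scaleR_diff_right case_prod_unfold)
    also have "\<dots> \<le> (\<Sum>(x, K)\<in>\<D>. measure lborel K *\<^sub>R h x)"
    proof (rule sum_norm_le, clarify)
      fix x K assume "(x, K) \<in> \<D>"
      then have "x \<in> cbox a b" using tagged_division_ofD(2,3)[OF D(1)] by blast
      then show "norm (measure lborel K *\<^sub>R (f x - g x)) \<le> measure lborel K *\<^sub>R h x"
        using fg by (simp add: mult_left_mono)
    qed
    also have "\<dots> < 2 * e / 8" using \<gamma>2(2)[OF D(1,3)] h_le
      unfolding real_norm_def by linarith
    finally have "norm ((\<Sum>(x, K)\<in>\<D>. measure lborel K *\<^sub>R f x) - (\<Sum>(x, K)\<in>\<D>. measure lborel K *\<^sub>R g x))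
        < 2 * e / 8" .
    from norm_diff_triangle_less[OF this \<gamma>1(2)[OF D(1,2)]] show ?thesis by simp
  qed
  show "\<exists>\<gamma>. gauge \<gamma> \<and> (\<forall>\<D>1 \<D>2. \<D>1 tagged_division_of cbox a b \<and> \<gamma> fine \<D>1 \<and>
      \<D>2 tagged_division_of cbox a b \<and> \<gamma> fine \<D>2 \<longrightarrow>
      norm ((\<Sum>(x, K)\<in>\<D>1. measure lborel K *\<^sub>R f x) - (\<Sum>(x, K)\<in>\<D>2. measure lborel K *\<^sub>R f x)) < e)"
  proof (intro exI conjI allI impI)
    show "gauge (\<lambda>x. \<gamma>1 x \<inter> \<gamma>2 x)" using \<gamma>1(1) \<gamma>2(1) by (rule gauge_Int)
    fix \<D>1 \<D>2
    assume A: "\<D>1 tagged_division_of cbox a b \<and> (\<lambda>x. \<gamma>1 x \<inter> \<gamma>2 x) fine \<D>1 \<and>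
      \<D>2 tagged_division_of cbox a b \<and> (\<lambda>x. \<gamma>1 x \<inter> \<gamma>2 x) fine \<D>2"
    then have "norm ((\<Sum>(x, K)\<in>\<D>1. measure lborel K *\<^sub>R f x) - I) < 3 * e / 8"
      "norm ((\<Sum>(x, K)\<in>\<D>2. measure lborel K *\<^sub>R f x) - I) < 3 * e / 8"
      by (simp_all only: near fine_Int)
    then have "norm (((\<Sum>(x, K)\<in>\<D>1. measure lborel K *\<^sub>R f x) - I) - ((\<Sum>(x, K)\<in>\<D>2. measure lborel K *\<^sub>R f x) - I)) < e"
      using norm_triangle_ineq4[of "(\<Sum>(x, K)\<in>\<D>1. measure lborel K *\<^sub>R f x) - I"
        "(\<Sum>(x, K)\<in>\<D>2. measure lborel K *\<^sub>R f x) - I"] e by linarith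
    then show "norm ((\<Sum>(x, K)\<in>\<D>1. measure lborel K *\<^sub>R f x) - (\<Sum>(x, K)\<in>\<D>2. measure lborel K *\<^sub>R f x)) < e"
      by simp
  qed
qed

text \<open>Over all of space the Cauchy criterion for growing boxes is inherited from the majorant.\<close>

lemma integrable_UNIV_dominated:
  fixes f :: "'n::euclidean_space \<Rightarrow> 'a::banach"
  assumes f: "\<And>a b. f integrable_on cbox a b" and h: "h integrable_on UNIV"
    and fh: "\<And>x. norm (f x) \<le> h x"
  shows "f integrable_on UNIV"
  unfolding integrable_alt[of f UNIV]
proof (intro conjI allI impI)
  fix a b show "(\<lambda>x. if x \<in> UNIV then f x else 0) integrable_on cbox a b" using f by simp
next
  fix e :: real assume e: "0 < e"
  have hc: "h integrable_on cbox a b" for a b using h by (rule integrable_on_subcbox) simp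
  obtain B where B: "B > 0" "\<And>a b c d. ball 0 B \<subseteq> cbox a b \<and> ball 0 B \<subseteq> cbox c d \<Longrightarrow>
      norm (integral (cbox a b) h - integral (cbox c d) h) < e / 2"
    using h[unfolded integrable_alt[of h UNIV], THEN conjunct2, rule_format, OF half_gt_zero[OF e]]
    by (simp only: UNIV_I if_True) blast
  have sub: "norm (integral (cbox u v) f - integral (cbox a b) f) < e / 2"
    if "cbox a b \<subseteq> cbox u v" "ball 0 B \<subseteq> cbox a b" for a b u v
  proof -
    let ?cut = "\<lambda>\<phi> x. if x \<in> cbox a b then \<phi> x else 0"
    have [simp]: "cbox a b \<inter> cbox u v = cbox a b" using that by blast
    have cut_h: "?cut h integrable_on cbox u v" "integral (cbox u v) (?cut h) = integral (cbox a b) h"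
      by (simp_all add: integrable_restrict_Int integral_restrict_Int hc)
    have cut_f: "?cut f integrable_on cbox u v" "integral (cbox u v) (?cut f) = integral (cbox a b) f"
      by (simp_all add: integrable_restrict_Int integral_restrict_Int f)
    have "norm (integral (cbox u v) (\<lambda>x. f x - ?cut f x)) \<le> integral (cbox u v) (\<lambda>x. h x - ?cut h x)"
      by (rule integral_norm_bound_integral) (use fh f hc cut_f cut_h in \<open>auto intro!: integrable_diff\<close>)
    then have "norm (integral (cbox u v) f - integral (cbox a b) f)
        \<le> integral (cbox u v) h - integral (cbox a b) h"
      using f hc cut_f cut_h by (simp add: integral_diff)
    also have "\<dots> < e / 2"
      using B(2)[of u v a b] subset_trans[OF that(2,1)] that(2) unfolding real_norm_def by linarith
    finally show ?thesis .
  qed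
  show "\<exists>B>0. \<forall>a b c d. ball 0 B \<subseteq> cbox a b \<and> ball 0 B \<subseteq> cbox c d \<longrightarrow>
      norm (integral (cbox a b) (\<lambda>x. if x \<in> UNIV then f x else 0) -
        integral (cbox c d) (\<lambda>x. if x \<in> UNIV then f x else 0)) < e"
  proof (intro exI[of _ B] conjI allI impI)
    fix a b c d :: 'n
    assume A: "ball 0 B \<subseteq> cbox a b \<and> ball 0 B \<subseteq> cbox c d"
    have "bounded (cbox a b \<union> cbox c d)" by simp
    then obtain m where m: "cbox a b \<union> cbox c d \<subseteq> cbox (- m) m"
      using bounded_subset_cbox_symmetric by metis
    then have "norm (integral (cbox (-m) m) f - integral (cbox a b) f) < e / 2"
      "norm (integral (cbox (-m) m) f - integral (cbox c d) f) < e / 2"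
      using A by (simp_all only: sub Un_subset_iff)
    then have "norm ((integral (cbox (-m) m) f - integral (cbox c d) f)
        - (integral (cbox (-m) m) f - integral (cbox a b) f)) < e"
      using norm_triangle_ineq4[of "integral (cbox (-m) m) f - integral (cbox c d) f"
          "integral (cbox (-m) m) f - integral (cbox a b) f"] by linarith
    then show "norm (integral (cbox a b) (\<lambda>x. if x \<in> UNIV then f x else 0) -
        integral (cbox c d) (\<lambda>x. if x \<in> UNIV then f x else 0)) < e" by simp
  qed (rule B(1))
qed

text \<open>An integrable majorant controls both ends of the half line, also an integrable
  singularity at \<open>0\<close>.\<close>

lemma integrable_halfline_dominated:
  fixes f :: "real \<Rightarrow> 'a::banach"
  assumes f: "\<And>a b. 0 < a \<Longrightarrow> f integrable_on {a..b}" and h: "h integrable_on {0..}"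
    and fh: "\<And>t. 0 \<le> t \<Longrightarrow> norm (f t) \<le> h t"
  shows "f integrable_on {0..}"
proof -
  have hc: "h integrable_on {0..b}" for b
    using h by (rule integrable_on_subinterval) auto
  have pos: "f integrable_on {0..b}" if b: "0 < b" for b
    unfolding cbox_interval[symmetric]
  proof (rule integrable_cbox_mean_approximation)
    fix e :: real assume e: "0 < e"
    have "continuous_on {0..b} (\<lambda>x. integral {0..x} h)"
      using hc by (rule indefinite_integral_continuous_1)
    then obtain d where d: "0 < d"
      "\<And>x. x \<in> {0..b} \<Longrightarrow> dist x 0 < d \<Longrightarrow> dist (integral {0..x} h) (integral {0..0} h) < e"
      using e b unfolding continuous_on_iff by (metis atLeastAtMost_iff less_eq_real_def order_refl)
    define s where "s = min b (d / 2)"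
    have s: "0 < s" "s \<le> b" "s < d" using b d(1) by (auto simp: s_def)
    let ?g = "\<lambda>x. if x \<in> {s..b} then f x else 0"
    let ?h = "\<lambda>x. if x \<in> {0..s} then h x else 0"
    have [simp]: "{s..b} \<inter> {0..b} = {s..b}" "{0..s} \<inter> {0..b} = {0..s}" "min s b = s" using s by auto
    have "integral {0..s} h \<le> e"
      using d(2)[of s] s by (simp add: dist_norm)
    moreover have "norm (f x - ?g x) \<le> ?h x" if "x \<in> {0..b}" for x
      using that fh[of x] order_trans[OF norm_ge_zero fh[of x]] by auto
    ultimately show "\<exists>g h. g integrable_on cbox 0 b \<and> h integrable_on cbox 0 b \<and>
        (\<forall>x\<in>cbox 0 b. norm (f x - g x) \<le> h x) \<and> integral (cbox 0 b) h \<le> e"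
      by (intro exI[of _ ?g] exI[of _ ?h])
         (simp add: integrable_restrict_Int integral_restrict_Int f hc s(1) del: atLeastAtMost_iff)
  qed
  have "(\<lambda>x. if x \<in> {0..} then f x else 0) integrable_on UNIV"
  proof (rule integrable_UNIV_dominated)
    show "(\<lambda>x. if x \<in> {0..} then h x else 0) integrable_on UNIV"
      using h by (simp only: integrable_restrict_Int Int_UNIV_right)
    fix a b :: real
    have "{0..} \<inter> cbox a b = {max 0 a..b}" by auto
    moreover have "f integrable_on {max 0 a..b}"
      by (rule integrable_on_subinterval[OF pos[of "max 1 b"]]) auto
    ultimately show "(\<lambda>x. if x \<in> {0..} then f x else 0) integrable_on cbox a b"
      by (simp only: integrable_restrict_Int)
  qed (use fh in auto)
  then show ?thesis by (simp only: integrable_restrict_Int Int_UNIV_right)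
qed

lemma bounded_linear_scalar_compose:
  fixes A :: "'a::complex_hilbert_space \<Rightarrow>\<^sub>L 'a"
  shows "bounded_linear (\<lambda>c. scalar_op c o\<^sub>L A)"
proof (rule bounded_linear_intro[where K = "norm A"])
  show "norm (scalar_op c o\<^sub>L A) \<le> cmod c * norm A" for c
    by (intro order_trans[OF norm_blinfun_compose] mult_right_mono norm_scalar_op_le) simp
qed (auto intro!: blinfun_eqI simp: blinfun.add_left scaleC_add_left blinfun.scaleR_left
      scaleR_conv_of_real scaleC_of_real scaleC_simps simp flip: scaleC_scaleC)

lemma norm_scalar_compose_le: "norm (scalar_op c o\<^sub>L A) \<le> cmod c * norm A"
  by (intro order_trans[OF norm_blinfun_compose] mult_right_mono norm_scalar_op_le) simp

text \<open>The scalar factor is merely measurable. Replacing \<open>P\<close> on small intervals by its value at a tag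
  leaves an integrable scalar function times a constant operator.\<close>

lemma scalar_density_integrable_interval:
  fixes P :: "real \<Rightarrow> ('a::complex_hilbert_space \<Rightarrow>\<^sub>L 'a)" and g :: "real \<Rightarrow> complex"
  assumes g: "g integrable_on {a..b}" and g1: "\<And>t. cmod (g t) \<le> 1"
    and P: "continuous_on {a..b} P"
  shows "(\<lambda>t. scalar_op (g t) o\<^sub>L P t) integrable_on {a..b}"
  unfolding cbox_interval[symmetric]
proof (rule integrable_uniform_limit)
  fix e :: real assume e: "0 < e"
  obtain d where "0 < d" and d: "\<And>x x'. x \<in> cbox a b \<Longrightarrow> x' \<in> cbox a b \<Longrightarrow> dist x' x < d \<Longrightarrow>
      dist (P x') (P x) < e"
    using compact_uniformly_continuous[OF P] e unfolding uniformly_continuous_on_def cbox_interval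
    by (metis compact_Icc)
  obtain p where ptag: "p tagged_division_of cbox a b" and fine: "(\<lambda>x. ball x d) fine p"
    using fine_division_exists[OF gauge_ball[OF \<open>0 < d\<close>], of a b] .
  let ?f = "\<lambda>x. scalar_op (g x) o\<^sub>L P x"
  have "\<forall>i\<in>snd ` p. \<exists>G. (\<forall>x\<in>i. norm ((scalar_op (g x) o\<^sub>L P x) - G x) \<le> e) \<and> G integrable_on i"
  proof clarsimp
    fix x l assume as: "(x, l) \<in> p"
    obtain u v where l: "l = cbox u v" using tagged_division_ofD(4)[OF ptag as] by blast
    have x: "x \<in> l" "l \<subseteq> cbox a b" using tagged_division_ofD(2,3)[OF ptag as] .
    have "g integrable_on l"
      unfolding l by (rule integrable_on_subcbox[OF g]) (use x l in \<open>simp add: cbox_interval\<close>)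
    from integrable_linear[OF this bounded_linear_scalar_compose[of "P x"]]
    have "(\<lambda>y. scalar_op (g y) o\<^sub>L P x) integrable_on l" by (simp add: o_def)
    moreover have "norm ((scalar_op (g y) o\<^sub>L P y) - (scalar_op (g y) o\<^sub>L P x)) \<le> e" if y: "y \<in> l" for y
    proof -
      have "dist y x < d" using fineD[OF fine as] y by (auto simp: dist_commute)
      moreover have "x \<in> cbox a b" "y \<in> cbox a b" using x y by blast+
      ultimately have "norm (P y - P x) \<le> e" using d[of x y] by (simp add: dist_norm)
      have "(scalar_op (g y) o\<^sub>L P y) - (scalar_op (g y) o\<^sub>L P x) = scalar_op (g y) o\<^sub>L (P y - P x)"
        by (rule blinfun_eqI) (simp add: blinfun.diff_left scaleC_simps)
      then have "norm ((scalar_op (g y) o\<^sub>L P y) - (scalar_op (g y) o\<^sub>L P x)) \<le> cmod (g y) * norm (P y - P x)"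
        by (simp add: norm_scalar_compose_le)
      also have "\<dots> \<le> 1 * e" by (intro mult_mono g1 \<open>norm (P y - P x) \<le> e\<close>) auto
      finally show ?thesis by simp
    qed
    ultimately show "\<exists>G. (\<forall>x\<in>l. norm ((scalar_op (g x) o\<^sub>L P x) - G x) \<le> e) \<and> G integrable_on l"
      by (intro exI[of _ "\<lambda>y. scalar_op (g y) o\<^sub>L P x"] conjI ballI)
  qed
  then obtain G where "\<forall>x\<in>cbox a b. norm (?f x - G x) \<le> e" "G integrable_on cbox a b"
    by (rule approximable_on_division[OF less_imp_le[OF e] division_of_tagged_division[OF ptag], of ?f])
  then show "\<exists>G. (\<forall>x\<in>cbox a b. norm (?f x - G x) \<le> e) \<and> G integrable_on cbox a b"
    by (intro exI[of _ G] conjI)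
qed

lemma scalar_density_integrable:
  fixes P :: "real \<Rightarrow> ('a::complex_hilbert_space \<Rightarrow>\<^sub>L 'a)" and g :: "real \<Rightarrow> complex"
  assumes g: "\<And>a b. 0 \<le> a \<Longrightarrow> g integrable_on {a..b}"
    and N: "negligible N" and g1: "\<And>t. 0 \<le> t \<Longrightarrow> t \<notin> N \<Longrightarrow> cmod (g t) \<le> 1"
    and P: "continuous_on {0<..} P" and nP: "set_integrable lborel {0..} (\<lambda>t. norm (P t))"
  shows "(\<lambda>t. scalar_op (g t) o\<^sub>L P t) integrable_on {0..}" (is ?thesis1)
    and "norm (integral {0..} (\<lambda>t. scalar_op (g t) o\<^sub>L P t)) \<le> (LINT t:{0..}|lborel. norm (P t))"
      (is ?thesis2)
proof -
  \<comment> \<open>A version of \<open>g\<close> that satisfies the bound everywhere.\<close>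
  let ?g = "\<lambda>t. if cmod (g t) \<le> 1 then g t else 0"
  have nP': "(\<lambda>t. norm (P t)) integrable_on {0..}"
    "(LINT t:{0..}|lborel. norm (P t)) = integral {0..} (\<lambda>t. norm (P t))"
    using set_borel_integral_eq_integral[OF nP] by auto
  have bound: "norm (scalar_op (?g t) o\<^sub>L P t) \<le> norm (P t)" for t
  proof -
    have "norm (scalar_op (?g t) o\<^sub>L P t) \<le> cmod (?g t) * norm (P t)" by (rule norm_scalar_compose_le)
    also have "\<dots> \<le> 1 * norm (P t)" by (rule mult_right_mono) auto
    finally show ?thesis by simp
  qed
  have "(\<lambda>t. scalar_op (?g t) o\<^sub>L P t) integrable_on {a..b}" if "0 < a" for a b
  proof (rule scalar_density_integrable_interval)
    show "?g integrable_on {a..b}"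
      by (rule integrable_spike[OF g[of a b] N]) (use that g1 in auto)
    show "continuous_on {a..b} P" by (rule continuous_on_subset[OF P]) (use that in auto)
  qed auto
  from integrable_halfline_dominated[OF this nP'(1) bound]
  have int: "(\<lambda>t. scalar_op (?g t) o\<^sub>L P t) integrable_on {0..}" by simp
  show ?thesis1
    by (rule integrable_spike[OF int N]) (use g1 in auto)
  have "integral {0..} (\<lambda>t. scalar_op (g t) o\<^sub>L P t) = integral {0..} (\<lambda>t. scalar_op (?g t) o\<^sub>L P t)"
    by (rule integral_spike[OF N]) (use g1 in auto)
  then show ?thesis2
    using integral_norm_bound_integral[OF int nP'(1) bound] nP'(2) by simp
qed

section \<open>Densities of Lipschitz curves\<close>

text \<open>The increasing functions $(t \pm u(t))/2$ define two measures that add up to Lebesgue measure;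
  their Radon--Nikodym derivatives therefore take values in $[0,1]$.\<close>

lemma lipschitz_real_density_exists:
  fixes u :: "real \<Rightarrow> real"
  assumes u: "\<And>s t. 0 \<le> s \<Longrightarrow> s \<le> t \<Longrightarrow> \<bar>u t - u s\<bar> \<le> t - s"
  shows "\<exists>g. (\<forall>t. \<bar>g t\<bar> \<le> 1) \<and>
    (\<forall>s t. 0 \<le> s \<longrightarrow> s \<le> t \<longrightarrow> (g has_integral (u t - u s)) {s..t})"
proof -
  \<comment> \<open>The extension of \<open>u\<close> to the whole line that is constant on $(-\infty,0]$.\<close>
  define U where "U x = u (max 0 x)" for x
  have U: "\<bar>U y - U x\<bar> \<le> y - x" if "x \<le> y" for x y
    using u[of "max 0 x" "max 0 y"] that by (auto simp: U_def max_def split: if_splits)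
  define F where "F x = (x + U x) / 2" for x
  define G where "G x = (x - U x) / 2" for x
  have F_mono: "F x \<le> F y" and G_mono: "G x \<le> G y" if "x \<le> y" for x y
    using U[OF that] by (auto simp: F_def G_def abs_le_iff)
  have "1-lipschitz_on UNIV U"
  proof (rule lipschitz_onI)
    fix x y :: real show "dist (U x) (U y) \<le> 1 * dist x y"
      using U[of x y] U[of y x] by (cases "x \<le> y") (auto simp: dist_real_def)
  qed simp
  then have U_cont: "continuous_on UNIV U" by (rule lipschitz_on_continuous_on)
  have F_cont: "continuous_on UNIV F" and G_cont: "continuous_on UNIV G"
    unfolding F_def G_def by (intro continuous_intros U_cont; simp)+
  define \<nu> where "\<nu> = interval_measure F"
  define \<kappa> where "\<kappa> = interval_measure G"
  have [simp]: "sets \<nu> = sets borel" "sets \<kappa> = sets borel" by (simp_all add: \<nu>_def \<kappa>_def)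
  have \<nu>_Icc: "emeasure \<nu> {a..b} = ennreal (F b - F a)" if "a \<le> b" for a b
    unfolding \<nu>_def using that F_mono F_cont by (rule emeasure_interval_measure_Icc)
  have \<kappa>_Icc: "emeasure \<kappa> {a..b} = ennreal (G b - G a)" if "a \<le> b" for a b
    unfolding \<kappa>_def using that G_mono G_cont by (rule emeasure_interval_measure_Icc)
  define M where "M = measure_of UNIV (sets borel) (\<lambda>A. emeasure \<nu> A + emeasure \<kappa> A)"
  have M_sets [simp]: "sets M = sets borel"
    unfolding M_def by (metis sets.sets_measure_of_eq space_borel)
  have M_em: "emeasure M A = emeasure \<nu> A + emeasure \<kappa> A" if "A \<in> sets borel" for A
    unfolding M_def
  proof (rule emeasure_measure_of_sigma)
    show "sigma_algebra UNIV (sets borel :: real set set)"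
      using sets.sigma_algebra_axioms[of "borel :: real measure"] by simp
    show "positive (sets borel) (\<lambda>A. emeasure \<nu> A + emeasure \<kappa> A)" by (simp add: positive_def)
    show "countably_additive (sets borel) (\<lambda>A. emeasure \<nu> A + emeasure \<kappa> A)"
    proof (rule countably_additiveI)
      fix A :: "nat \<Rightarrow> real set"
      assume A: "range A \<subseteq> sets borel" "disjoint_family A"
      have "(\<Sum>i. emeasure \<nu> (A i) + emeasure \<kappa> (A i))
          = (\<Sum>i. emeasure \<nu> (A i)) + (\<Sum>i. emeasure \<kappa> (A i))"
        by (intro suminf_add[symmetric]) auto
      then show "(\<Sum>i. emeasure \<nu> (A i) + emeasure \<kappa> (A i)) = emeasure \<nu> (\<Union>i. A i) + emeasure \<kappa> (\<Union>i. A i)"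
        using A by (simp add: suminf_emeasure)
    qed
  qed (rule that)
  have M_eq: "lborel = M"
  proof (rule lborel_eqI)
    fix l v :: real assume "\<And>b. b \<in> Basis \<Longrightarrow> l \<bullet> b \<le> v \<bullet> b"
    then have lv: "l \<le> v" by auto
    have "emeasure M {c..c} = 0" for c by (simp add: M_em \<nu>_Icc \<kappa>_Icc flip: atLeastAtMost_singleton)
    then have N: "{l} \<in> null_sets M" "{v} \<in> null_sets M" by (auto simp: null_sets_def)
    have "box l v = {l..v} - ({l} \<union> {v})" by auto
    moreover have "emeasure M ({l..v} - ({l} \<union> {v})) = emeasure M {l..v}"
      by (rule emeasure_Diff_null_set[OF null_sets.Un[OF N]]) simp
    moreover have "emeasure M {l..v} = ennreal (v - l)"
      using lv F_mono[OF lv] G_mono[OF lv]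
      by (simp add: M_em \<nu>_Icc \<kappa>_Icc flip: ennreal_plus) (simp add: F_def G_def field_simps)
    ultimately show "emeasure M (box l v) = ennreal (\<Prod>b\<in>Basis. (v - l) \<bullet> b)" by simp
  qed simp
  have "absolutely_continuous lborel \<nu>" "absolutely_continuous lborel \<kappa>"
    unfolding absolutely_continuous_def M_eq by (auto simp: null_sets_def M_em)
  then obtain f k where f: "f \<in> borel_measurable lborel" "density lborel f = \<nu>"
    and k: "k \<in> borel_measurable lborel" "density lborel k = \<kappa>"
    using sigma_finite_measure.Radon_Nikodym[OF sigma_finite_lborel, of \<nu>]
      sigma_finite_measure.Radon_Nikodym[OF sigma_finite_lborel, of \<kappa>] by auto
  have "density lborel (\<lambda>x. f x + k x) = density lborel (\<lambda>x. 1)"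
  proof (rule measure_eqI)
    fix A assume "A \<in> sets (density lborel (\<lambda>x. f x + k x))"
    then have A: "A \<in> sets borel" by simp
    have "emeasure (density lborel (\<lambda>x. f x + k x)) A = emeasure (density lborel f) A + emeasure (density lborel k) A"
      using f(1) k(1) A by (simp add: emeasure_density distrib_right nn_integral_add)
    also have "\<dots> = emeasure M A" using A by (simp add: f(2) k(2) M_em)
    finally show "emeasure (density lborel (\<lambda>x. f x + k x)) A = emeasure (density lborel (\<lambda>x. 1)) A"
      using A by (simp add: emeasure_density flip: M_eq)
  qed simp
  then have "AE x in lborel. f x + k x = 1"
    using f(1) k(1) by (subst sigma_finite_measure.density_unique_iff[OF sigma_finite_lborel, symmetric]) auto
  then have f1: "AE x in lborel. f x \<le> 1"
    by eventually_elim (metis add_increasing2 order_refl zero_le)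
  define w where "w x = (if f x \<le> 1 then enn2real (f x) else 0)" for x
  have w_meas: "w \<in> borel_measurable borel"
    unfolding w_def using f(1) by simp
  have w01: "0 \<le> w x" "w x \<le> 1" for x
    by (auto simp: w_def enn2real_leI)
  have w_int: "(w has_integral (F t - F s)) {s..t}" if "s \<le> t" for s t
  proof -
    have "(\<integral>\<^sup>+x. ennreal (indicator {s..t} x * w x) \<partial>lborel) = (\<integral>\<^sup>+x. f x * indicator {s..t} x \<partial>lborel)"
    proof (rule nn_integral_cong_AE)
      show "AE x in lborel. ennreal (indicator {s..t} x * w x) = f x * indicator {s..t} x"
        using f1 by eventually_elim
          (auto simp: w_def indicator_def ennreal_enn2real_if top_unique)
    qed
    also have "\<dots> = ennreal (F t - F s)"
      using emeasure_density[OF f(1), of "{s..t}"] \<nu>_Icc[OF that] by (simp add: f(2))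
    finally have "((\<lambda>x. indicator {s..t} x * w x) has_integral (F t - F s)) UNIV"
      using w_meas w01 F_mono[OF that] by (intro nn_integral_has_integral) auto
    moreover have "(\<lambda>x. indicator {s..t} x * w x) = (\<lambda>x. if x \<in> {s..t} then w x else 0)"
      by (auto simp: indicator_def)
    ultimately show ?thesis by (simp only: has_integral_restrict_UNIV)
  qed
  show ?thesis
  proof (intro exI[of _ "\<lambda>x. 2 * w x - 1"] conjI allI impI)
    show "\<bar>2 * w x - 1\<bar> \<le> 1" for x using w01[of x] by (simp add: abs_le_iff)
    fix s t :: real assume st: "0 \<le> s" "s \<le> t"
    have "((\<lambda>x. 2 * w x - 1) has_integral (2 * (F t - F s) - (t - s) *\<^sub>R 1)) {s..t}"
      using st by (intro has_integral_diff has_integral_mult_right w_int)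
        (use has_integral_const_real[of "1::real" s t] in \<open>simp_all\<close>)
    moreover have "2 * (F t - F s) - (t - s) *\<^sub>R 1 = u t - u s"
      using st by (simp add: F_def U_def add_divide_distrib)
    ultimately show "((\<lambda>x. 2 * w x - 1) has_integral (u t - u s)) {s..t}"
      by (simp only:)
  qed
qed

text \<open>The sets over which \<open>h\<close> has integral zero form a Dynkin system, which contains all Borel sets
  once it contains the half lines.\<close>

lemma interval_integrals_zero_imp_ae_zero:
  fixes h :: "real \<Rightarrow> real"
  assumes ai: "\<And>s t. 0 \<le> s \<Longrightarrow> s \<le> t \<Longrightarrow> h absolutely_integrable_on {s..t}"
    and z: "\<And>s t. 0 \<le> s \<Longrightarrow> s \<le> t \<Longrightarrow> integral {s..t} h = 0"
  shows "negligible {t. 0 \<le> t \<and> h t \<noteq> 0}"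
proof -
  have "negligible {t \<in> {0..real n}. h t \<noteq> 0}" for n :: nat
  proof -
    define \<phi> where "\<phi> x = indicator {0..real n} x *\<^sub>R h x" for x
    have \<phi>: "integrable lebesgue \<phi>"
      using ai[of 0 "real n"] by (simp add: set_integrable_def \<phi>_def[abs_def])
    \<comment> \<open>\<open>h\<close> is only Lebesgue measurable; its Borel version \<open>\<psi>\<close> is integrable over \<open>lborel\<close>.\<close>
    then obtain \<psi> where \<psi>: "\<psi> \<in> borel_measurable lborel" "AE x in lborel. \<phi> x = \<psi> x"
      using completion_ex_borel_measurable_real[of \<phi> lborel] by auto
    have \<phi>\<psi>: "AE x in lebesgue. \<phi> x = \<psi> x" using \<psi>(2) by (rule AE_completion)
    have \<psi>_leb: "\<psi> \<in> borel_measurable lebesgue" using \<psi>(1) by (rule measurable_completion)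
    have "integrable lebesgue \<psi>"
      using \<phi> integrable_cong_AE[of \<phi> lebesgue \<psi>] \<phi>\<psi> \<psi>_leb by auto
    then have \<psi>_int: "integrable lborel \<psi>" using \<psi>(1) integrable_completion by blast
    have \<psi>_set: "set_integrable lborel A \<psi>" if "A \<in> sets borel" for A
      using integrable_mult_indicator[of A lborel \<psi>] \<psi>_int that by (simp add: set_integrable_def)
    have \<psi>_has: "((\<lambda>y. indicator A y *\<^sub>R \<psi> y) has_integral (set_lebesgue_integral lborel A \<psi>)) UNIV"
      if "A \<in> sets borel" for A
      unfolding set_lebesgue_integral_def
      by (rule has_integral_integral_lborel) (use \<psi>_set[OF that] in \<open>simp add: set_integrable_def\<close>)
    obtain N where N: "negligible N" "\<And>x. x \<notin> N \<Longrightarrow> \<phi> x = \<psi> x"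
      using AE_E3[OF \<phi>\<psi>] by (auto simp: negligible_iff_null_sets)
    have ray: "set_lebesgue_integral lborel A \<psi> = 0" if A: "A \<in> range greaterThan \<or> A = UNIV" for A
    proof -
      have "A \<in> sets borel" using A by auto
      from \<psi>_has[OF this]
      have "((\<lambda>y. indicator A y *\<^sub>R \<phi> y) has_integral (set_lebesgue_integral lborel A \<psi>)) UNIV"
        by (rule has_integral_spike[OF N(1), rotated]) (simp add: N(2))
      moreover have "(\<lambda>y. indicator A y *\<^sub>R \<phi> y) = (\<lambda>y. if y \<in> A \<inter> {0..real n} then h y else 0)"
        by (auto simp: \<phi>_def indicator_def)
      ultimately have "(h has_integral (set_lebesgue_integral lborel A \<psi>)) (A \<inter> {0..real n})"
        by (simp only: has_integral_restrict_UNIV)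
      moreover have "(h has_integral 0) (A \<inter> {0..real n})"
      proof -
        obtain c where c: "0 \<le> c" "A \<inter> {0..real n} = {c..real n} \<or> A \<inter> {0..real n} = {c<..real n}"
        proof (cases "A = UNIV")
          case True then show ?thesis using that[of 0] by simp
        next
          case False
          then obtain a where a: "A = {a<..}" using A by auto
          show ?thesis
          proof (cases "a < 0")
            case True
            then have "A \<inter> {0..real n} = {0..real n}" by (auto simp: a)
            then show ?thesis using that[of 0] by simp
          next
            case False
            then have "A \<inter> {0..real n} = {a<..real n}" by (auto simp: a)
            then show ?thesis using that[of a] False by simp
          qed
        qed
        have "(h has_integral 0) {c..real n}"
        proof (cases "c \<le> real n")
          case True
          then show ?thesis
            using z[OF c(1) True] set_lebesgue_integral_eq_integral(1)[OF ai[OF c(1) True]]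
            by (simp add: has_integral_iff)
        qed auto
        moreover from this have "(h has_integral 0) {c<..real n}"
          by (subst has_integral_spike_set_eq[of "{c<..real n}" "{c..real n}"])
             (auto intro: negligible_subset[of "{c}"])
        ultimately show ?thesis using c(2) by auto
      qed
      ultimately show ?thesis by (rule has_integral_unique)
    qed
    have sig: "sigma_sets UNIV (range greaterThan) = sets (borel :: real measure)"
      unfolding borel_Ioi by auto
    have all: "set_lebesgue_integral lborel A \<psi> = 0" if "A \<in> sets borel" for A
    proof -
      have "Int_stable (range (greaterThan :: real \<Rightarrow> real set))"
        by (auto simp: Int_stable_def lessThan_Int_lessThan)
      moreover have "range greaterThan \<subseteq> Pow (UNIV :: real set)" by simp
      moreover have "A \<in> sigma_sets UNIV (range greaterThan)"
        using that by (simp add: sig)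
      ultimately show ?thesis
      proof (induction rule: sigma_sets_induct_disjoint[consumes 3])
        case (basic A) then show ?case using ray by blast
      next
        case empty then show ?case by (simp add: set_lebesgue_integral_def)
      next
        case (compl A)
        then have A: "A \<in> sets borel" by (simp add: sig)
        have "set_lebesgue_integral lborel (A \<union> (UNIV - A)) \<psi>
            = set_lebesgue_integral lborel A \<psi> + set_lebesgue_integral lborel (UNIV - A) \<psi>"
          by (rule set_integral_Un) (use A \<psi>_set in auto)
        then show ?case using compl ray[of UNIV] by simp
      next
        case (union A)
        then have A: "A i \<in> sets lborel" for i by (auto simp: sig)
        have U: "set_integrable lborel (\<Union>(range A)) \<psi>"
          by (rule \<psi>_set) (use A in auto)
        have "set_lebesgue_integral lborel (\<Union>(range A)) \<psi> = (\<Sum>i. set_lebesgue_integral lborel (A i) \<psi>)"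
          by (rule lebesgue_integral_countable_add[OF A _ U]) (use union.hyps in \<open>auto simp: disjoint_family_on_def\<close>)
        then show ?case using union.IH by simp
      qed
    qed
    then have ae: "AE x in lborel. \<psi> x = 0" using sigma_finite_measure.density_zero[OF sigma_finite_lborel \<psi>_int] by simp
    then obtain N' where N': "N' \<in> null_sets lborel" "\<And>x. x \<notin> N' \<Longrightarrow> \<psi> x = 0"
      using AE_E3[OF ae] by auto
    have "negligible N'" using N'(1) by (simp add: negligible_iff_null_sets null_sets_completionI)
    then have "negligible (N \<union> N')" using N(1) by simp
    moreover have "{t \<in> {0..real n}. h t \<noteq> 0} \<subseteq> N \<union> N'"
      using N(2) N'(2) by (force simp: \<phi>_def indicator_def)
    ultimately show ?thesis by (rule negligible_subset)
  qed
  then have "negligible (\<Union>n. {t \<in> {0..real n}. h t \<noteq> 0})" by (intro negligible_countable_Union) auto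
  moreover have "{t. 0 \<le> t \<and> h t \<noteq> 0} \<subseteq> (\<Union>n. {t \<in> {0..real n}. h t \<noteq> 0})"
    using real_arch_simple by auto
  ultimately show ?thesis by (rule negligible_subset)
qed

text \<open>\<open>g\<close> represents the complex measure $d\mu$ on the curve as $g(t)\,dt$. This is the property by which
  \<open>contour_density\<close> is selected.\<close>

definition is_contour_density :: "(real \<Rightarrow> complex) \<Rightarrow> (real \<Rightarrow> complex) \<Rightarrow> bool" where
  "is_contour_density \<Gamma> g \<longleftrightarrow> (\<forall>s t. 0 \<le> s \<longrightarrow> s \<le> t \<longrightarrow>
     g absolutely_integrable_on {s..t} \<and> integral {s..t} g = \<Gamma> t - \<Gamma> s)"

text \<open>The curve is Lipschitz on $[0,\infty)$ with constant 1; negative parameters are irrelevant.\<close>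

definition lipschitz_curve :: "(real \<Rightarrow> complex) \<Rightarrow> bool" where
  "lipschitz_curve \<Gamma> \<longleftrightarrow> (\<forall>s t. 0 \<le> s \<longrightarrow> s \<le> t \<longrightarrow> dist (\<Gamma> s) (\<Gamma> t) \<le> t - s)"

lemma contour_density_unique:
  assumes "is_contour_density \<Gamma> g" "is_contour_density \<Gamma> k"
  shows "negligible {t. 0 \<le> t \<and> g t \<noteq> k t}"
proof -
  have part: "negligible {t. 0 \<le> t \<and> L (g t - k t) \<noteq> 0}" if L: "bounded_linear L" for L :: "complex \<Rightarrow> real"
  proof (rule interval_integrals_zero_imp_ae_zero)
    fix s t :: real assume st: "0 \<le> s" "s \<le> t"
    have gk: "(\<lambda>t. g t - k t) absolutely_integrable_on {s..t}"
      using assms st by (auto simp: is_contour_density_def)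
    have g: "g integrable_on {s..t}" "k integrable_on {s..t}" "integral {s..t} g = integral {s..t} k"
      using assms st by (auto simp: is_contour_density_def set_lebesgue_integral_eq_integral(1))
    show "(\<lambda>t. L (g t - k t)) absolutely_integrable_on {s..t}"
      using absolutely_integrable_linear[OF gk L] by (simp add: o_def)
    have "integral {s..t} (L \<circ> (\<lambda>t. g t - k t)) = L (integral {s..t} (\<lambda>t. g t - k t))"
      by (rule integral_linear[OF _ L]) (use g in \<open>auto intro: integrable_diff\<close>)
    also have "integral {s..t} (\<lambda>t. g t - k t) = 0" using g by (simp add: integral_diff)
    finally show "integral {s..t} (\<lambda>t. L (g t - k t)) = 0"
      using linear_0[OF bounded_linear.linear[OF L]] by (simp add: o_def)
  qed
  have "negligible ({t. 0 \<le> t \<and> Re (g t - k t) \<noteq> 0} \<union> {t. 0 \<le> t \<and> Im (g t - k t) \<noteq> 0})"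
    using part[OF bounded_linear_Re] part[OF bounded_linear_Im] by (rule negligible_Un)
  then show ?thesis
    by (rule negligible_subset) (auto simp: complex_eq_iff)
qed

lemma is_contour_density_linear_image:
  assumes g: "is_contour_density \<Gamma> g" and L: "bounded_linear L"
  shows "is_contour_density (\<lambda>t. L (\<Gamma> t)) (\<lambda>t. L (g t))"
  unfolding is_contour_density_def
proof (intro allI impI conjI)
  fix s t :: real assume st: "0 \<le> s" "s \<le> t"
  have ai: "g absolutely_integrable_on {s..t}" and i: "integral {s..t} g = \<Gamma> t - \<Gamma> s"
    using g st by (auto simp: is_contour_density_def)
  show "(\<lambda>t. L (g t)) absolutely_integrable_on {s..t}"
    using absolutely_integrable_linear[OF ai L] by (simp add: o_def)
  have "integral {s..t} (L \<circ> g) = L (integral {s..t} g)"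
    by (rule integral_linear[OF set_lebesgue_integral_eq_integral(1)[OF ai] L])
  then show "integral {s..t} (\<lambda>t. L (g t)) = L (\<Gamma> t) - L (\<Gamma> s)"
    by (simp add: o_def i linear_diff[OF bounded_linear.linear[OF L]])
qed

lemma bounded_real_density_of_real:
  fixes g :: "real \<Rightarrow> real"
  assumes "\<And>t. \<bar>g t\<bar> \<le> 1" "(g has_integral I) {s..t}"
  shows "(\<lambda>t. complex_of_real (g t)) absolutely_integrable_on {s..t}"
    "integral {s..t} (\<lambda>t. complex_of_real (g t)) = of_real I"
proof -
  have "g absolutely_integrable_on {s..t}"
    by (rule absolutely_integrable_integrable_bound[where g = "\<lambda>_. 1"]) (use assms in \<open>auto simp: has_integral_iff\<close>)
  from absolutely_integrable_linear[OF this bounded_linear_of_real]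
  show "(\<lambda>t. complex_of_real (g t)) absolutely_integrable_on {s..t}" by (simp add: o_def)
  show "integral {s..t} (\<lambda>t. complex_of_real (g t)) = of_real I"
    using has_integral_linear[OF assms(2) bounded_linear_of_real[where 'a = complex]]
    by (simp add: o_def integral_unique)
qed

lemma contour_density_exists:
  assumes \<Gamma>: "lipschitz_curve \<Gamma>"
  shows "is_contour_density \<Gamma> (contour_density \<Gamma>)"
proof -
  have "\<bar>Re (\<Gamma> t) - Re (\<Gamma> s)\<bar> \<le> t - s" "\<bar>Im (\<Gamma> t) - Im (\<Gamma> s)\<bar> \<le> t - s" if "0 \<le> s" "s \<le> t" for s t
    using \<Gamma> that abs_Re_le_cmod[of "\<Gamma> t - \<Gamma> s"] abs_Im_le_cmod[of "\<Gamma> t - \<Gamma> s"]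
    by (force simp: lipschitz_curve_def dist_norm norm_minus_commute)+
  then obtain a b where a: "\<And>t. \<bar>a t\<bar> \<le> 1" "\<And>s t. 0 \<le> s \<Longrightarrow> s \<le> t \<Longrightarrow> (a has_integral (Re (\<Gamma> t) - Re (\<Gamma> s))) {s..t}"
    and b: "\<And>t. \<bar>b t\<bar> \<le> 1" "\<And>s t. 0 \<le> s \<Longrightarrow> s \<le> t \<Longrightarrow> (b has_integral (Im (\<Gamma> t) - Im (\<Gamma> s))) {s..t}"
    using lipschitz_real_density_exists[of "\<lambda>t. Re (\<Gamma> t)"] lipschitz_real_density_exists[of "\<lambda>t. Im (\<Gamma> t)"]
    by metis
  have "is_contour_density \<Gamma> (\<lambda>t. of_real (a t) + \<i> * of_real (b t))"
    unfolding is_contour_density_def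
  proof (intro allI impI conjI)
    fix s t :: real assume st: "0 \<le> s" "s \<le> t"
    note A = bounded_real_density_of_real[OF a(1) a(2)[OF st]] and B = bounded_real_density_of_real[OF b(1) b(2)[OF st]]
    have iB: "(\<lambda>t. \<i> * complex_of_real (b t)) absolutely_integrable_on {s..t}"
      using absolutely_integrable_linear[OF B(1) bounded_linear_mult_right[of \<i>]] by (simp add: o_def)
    show "(\<lambda>t. complex_of_real (a t) + \<i> * of_real (b t)) absolutely_integrable_on {s..t}"
      using A(1) iB by (rule set_integral_add(1))
    show "integral {s..t} (\<lambda>t. complex_of_real (a t) + \<i> * of_real (b t)) = \<Gamma> t - \<Gamma> s"
      using A B iB by (simp add: integral_add set_lebesgue_integral_eq_integral(1) complex_eq_iff)
  qed
  moreover have "contour_density \<Gamma> = (SOME g. is_contour_density \<Gamma> g)"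
    by (simp add: contour_density_def is_contour_density_def)
  ultimately show ?thesis using someI[of "is_contour_density \<Gamma>"] by simp
qed

text \<open>For every direction $e^{i\theta}$ the real part of $e^{i\theta}\Gamma$ is 1-Lipschitz and so has a
  density bounded by 1; countably many directions suffice.\<close>

lemma contour_density_bounded:
  assumes \<Gamma>: "lipschitz_curve \<Gamma>" and g: "is_contour_density \<Gamma> g"
  shows "\<exists>N. negligible N \<and> (\<forall>t\<ge>0. t \<notin> N \<longrightarrow> cmod (g t) \<le> 1)"
proof -
  have "negligible {t. 0 \<le> t \<and> \<not> Re (cis \<theta> * g t) \<le> 1}" for \<theta>
  proof -
    have "\<bar>Re (cis \<theta> * \<Gamma> t) - Re (cis \<theta> * \<Gamma> s)\<bar> \<le> t - s" if st: "0 \<le> s" "s \<le> t" for s t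
    proof -
      have "\<bar>Re (cis \<theta> * (\<Gamma> t - \<Gamma> s))\<bar> \<le> cmod (cis \<theta> * (\<Gamma> t - \<Gamma> s))" by (rule abs_Re_le_cmod)
      also have "\<dots> \<le> t - s"
        using \<Gamma> st by (simp add: norm_mult lipschitz_curve_def dist_norm norm_minus_commute)
      finally show ?thesis by (simp only: right_diff_distrib minus_complex.sel)
    qed
    then obtain k where k: "\<And>t. \<bar>k t\<bar> \<le> 1"
      "\<And>s t. 0 \<le> s \<Longrightarrow> s \<le> t \<Longrightarrow> (k has_integral (Re (cis \<theta> * \<Gamma> t) - Re (cis \<theta> * \<Gamma> s))) {s..t}"
      using lipschitz_real_density_exists[of "\<lambda>t. Re (cis \<theta> * \<Gamma> t)"] by metis
    have "is_contour_density (\<lambda>t. of_real (Re (cis \<theta> * \<Gamma> t))) (\<lambda>t. of_real (k t))"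
      unfolding is_contour_density_def using bounded_real_density_of_real[OF k(1) k(2)] by simp
    moreover have "bounded_linear (\<lambda>z. complex_of_real (Re (cis \<theta> * z)))"
      by (intro bounded_linear_compose[OF bounded_linear_of_real]
          bounded_linear_compose[OF bounded_linear_Re bounded_linear_mult_right])
    from is_contour_density_linear_image[OF g this]
    have "is_contour_density (\<lambda>t. of_real (Re (cis \<theta> * \<Gamma> t))) (\<lambda>t. of_real (Re (cis \<theta> * g t)))" .
    ultimately have "negligible {t. 0 \<le> t \<and> complex_of_real (k t) \<noteq> of_real (Re (cis \<theta> * g t))}"
      by (rule contour_density_unique)
    then show ?thesis
    proof (rule negligible_subset, clarify)
      fix t assume "complex_of_real (k t) = of_real (Re (cis \<theta> * g t))" "\<not> Re (cis \<theta> * g t) \<le> 1"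
      then show False using k(1)[of t] by (simp only: of_real_eq_iff)
    qed
  qed
  then have N: "negligible (\<Union>\<theta>\<in>\<rat>. {t. 0 \<le> t \<and> \<not> Re (cis \<theta> * g t) \<le> 1})"
    by (intro negligible_countable_Union countable_image countable_rat) auto
  have "cmod (g t) \<le> 1" if t: "0 \<le> t" "t \<notin> (\<Union>\<theta>\<in>\<rat>. {t. 0 \<le> t \<and> \<not> Re (cis \<theta> * g t) \<le> 1})" for t
  proof -
    have "closed {\<theta>. Re (cis \<theta> * g t) \<le> 1}"
      unfolding cis.ctr by (intro closed_Collect_le) (simp; intro continuous_intros)+
    moreover have "\<rat> \<subseteq> {\<theta>. Re (cis \<theta> * g t) \<le> 1}" using t by auto
    ultimately have "closure \<rat> \<subseteq> {\<theta>. Re (cis \<theta> * g t) \<le> 1}" by (rule closure_minimal[rotated])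
    then have "Re (cis (- Arg (g t)) * g t) \<le> 1"
      by (simp only: Rats_closure_real) blast
    moreover have "cis (- Arg (g t)) * g t = of_real (cmod (g t))"
    proof -
      have "g t = of_real (cmod (g t)) * cis (Arg (g t))"
        using rcis_cmod_Arg[of "g t"] by (simp add: rcis_def)
      then have "cis (- Arg (g t)) * g t = of_real (cmod (g t)) * (cis (Arg (g t)) * cis (- Arg (g t)))"
        by (metis mult.commute mult.left_commute)
      then show ?thesis by (simp add: cis_mult)
    qed
    ultimately show ?thesis by simp
  qed
  with N show ?thesis by blast
qed

section \<open>Operator-valued contour integrals\<close>

text \<open>Absolute integrability of \<open>F\<close> along the curve with respect to $|d\mu|$. Continuity is not required at
  the end point, where \<open>F\<close> may be singular.\<close>

definition contour_integrable ::
  "(real \<Rightarrow> complex) \<Rightarrow> (complex \<Rightarrow> ('b::complex_hilbert_space \<Rightarrow>\<^sub>L 'b)) \<Rightarrow> bool" where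
  "contour_integrable \<Gamma> F \<longleftrightarrow> continuous_on {0<..} (\<lambda>t. F (\<Gamma> t)) \<and>
     set_integrable lborel {0..} (\<lambda>t. norm (F (\<Gamma> t)))"

lemma
  assumes \<Gamma>: "lipschitz_curve \<Gamma>" and F: "contour_integrable \<Gamma> F"
  shows op_contour_has_integral:
      "((\<lambda>t. scalar_op (contour_density \<Gamma> t) o\<^sub>L F (\<Gamma> t)) has_integral op_contour_integral \<Gamma> F) {0..}"
    and norm_op_contour_integral_le:
      "norm (op_contour_integral \<Gamma> F) \<le> (LINT t:{0..}|lborel. norm (F (\<Gamma> t)))"
proof -
  note g = contour_density_exists[OF \<Gamma>]
  obtain N where N: "negligible N" "\<And>t. 0 \<le> t \<Longrightarrow> t \<notin> N \<Longrightarrow> cmod (contour_density \<Gamma> t) \<le> 1"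
    using contour_density_bounded[OF \<Gamma> g] by blast
  have gi: "contour_density \<Gamma> integrable_on {a..b}" if "0 \<le> a" for a b
  proof (cases "a \<le> b")
    case True
    then show ?thesis
      using g that by (auto simp: is_contour_density_def set_lebesgue_integral_eq_integral(1))
  qed auto
  note int = scalar_density_integrable[OF gi N, of "\<lambda>t. F (\<Gamma> t)"]
  show "((\<lambda>t. scalar_op (contour_density \<Gamma> t) o\<^sub>L F (\<Gamma> t)) has_integral op_contour_integral \<Gamma> F) {0..}"
    unfolding op_contour_integral_def using F int(1) by (simp add: contour_integrable_def integrable_integral)
  show "norm (op_contour_integral \<Gamma> F) \<le> (LINT t:{0..}|lborel. norm (F (\<Gamma> t)))"
    unfolding op_contour_integral_def using F int(2) by (simp add: contour_integrable_def)
qed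

lemma has_integral_blinfun_apply:
  fixes F :: "real \<Rightarrow> ('a::real_normed_vector \<Rightarrow>\<^sub>L 'b::banach)"
  assumes "(F has_integral I) S"
  shows "((\<lambda>t. blinfun_apply (F t) x) has_integral blinfun_apply I x) S"
  using has_integral_linear[OF assms blinfun.bounded_linear_left[of x]] by (simp add: o_def)

lemma bounded_linear_scaleC: "bounded_linear (\<lambda>x::'a::complex_hilbert_space. c *\<^sub>C x)"
  using blinfun.bounded_linear_right[of "scalar_op c :: 'a \<Rightarrow>\<^sub>L 'a"] by simp

lemma clinear_op_contour_integral:
  assumes \<Gamma>: "lipschitz_curve \<Gamma>" and F: "contour_integrable \<Gamma> F"
    and lin: "\<And>t. 0 < t \<Longrightarrow> clinear_op (F (\<Gamma> t))"
  shows "clinear_op (op_contour_integral \<Gamma> F)"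
  unfolding clinear_op_def
proof (intro allI)
  fix c x
  note I = has_integral_blinfun_apply[OF op_contour_has_integral[OF \<Gamma> F]]
  let ?f = "\<lambda>t x. blinfun_apply (scalar_op (contour_density \<Gamma> t) o\<^sub>L F (\<Gamma> t)) x"
  have "((\<lambda>t. c *\<^sub>C ?f t x) has_integral c *\<^sub>C blinfun_apply (op_contour_integral \<Gamma> F) x) {0..}"
    using has_integral_linear[OF I bounded_linear_scaleC[of c]] by (simp only: o_def)
  \<comment> \<open>The value at the end point \<open>0\<close> need not be complex linear, but does not affect the integral.\<close>
  then have "((\<lambda>t. ?f t (c *\<^sub>C x)) has_integral c *\<^sub>C blinfun_apply (op_contour_integral \<Gamma> F) x) {0..}"
    by (rule has_integral_spike[of "{0}", rotated 2])
       (use lin in \<open>auto simp: clinear_op_def scaleC_scaleC mult.commute\<close>)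
  then show "blinfun_apply (op_contour_integral \<Gamma> F) (c *\<^sub>C x) = c *\<^sub>C blinfun_apply (op_contour_integral \<Gamma> F) x"
    using I has_integral_unique by blast
qed

lemma lipschitz_curve_cnj: "lipschitz_curve \<Gamma> \<Longrightarrow> lipschitz_curve (cnj \<circ> \<Gamma>)"
  unfolding lipschitz_curve_def by (simp add: dist_norm flip: complex_cnj_diff)

lemma contour_density_cnj:
  assumes "lipschitz_curve \<Gamma>"
  shows "negligible {t. 0 \<le> t \<and> contour_density (cnj \<circ> \<Gamma>) t \<noteq> cnj (contour_density \<Gamma> t)}"
proof (rule contour_density_unique)
  show "is_contour_density (cnj \<circ> \<Gamma>) (contour_density (cnj \<circ> \<Gamma>))"
    using assms by (intro contour_density_exists lipschitz_curve_cnj)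
  show "is_contour_density (cnj \<circ> \<Gamma>) (\<lambda>t. cnj (contour_density \<Gamma> t))"
    unfolding o_def
    by (rule is_contour_density_linear_image[OF contour_density_exists[OF assms] bounded_linear_cnj])
qed

lemma badj_op_contour_integral:
  assumes \<Gamma>: "lipschitz_curve \<Gamma>" and F: "contour_integrable \<Gamma> F"
    and G: "contour_integrable (cnj \<circ> \<Gamma>) G"
    and lin: "\<And>t. 0 < t \<Longrightarrow> clinear_op (F (\<Gamma> t))"
    and adj: "\<And>t. 0 < t \<Longrightarrow> G (cnj (\<Gamma> t)) = badj (F (\<Gamma> t))"
  shows "badj (op_contour_integral \<Gamma> F) = op_contour_integral (cnj \<circ> \<Gamma>) G"
proof (rule badj_eqI)
  fix x y
  let ?g = "contour_density \<Gamma>" and ?k = "contour_density (cnj \<circ> \<Gamma>)"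
  let ?N = "{0} \<union> {t. 0 \<le> t \<and> ?k t \<noteq> cnj (?g t)}"
  have N: "negligible ?N" using contour_density_cnj[OF \<Gamma>] by simp
  have "((\<lambda>t. cinner (blinfun_apply (scalar_op (?g t) o\<^sub>L F (\<Gamma> t)) x) y) has_integral
      cinner (blinfun_apply (op_contour_integral \<Gamma> F) x) y) {0..}"
    using has_integral_linear[OF has_integral_blinfun_apply[OF op_contour_has_integral[OF \<Gamma> F]]
        bounded_linear_cinner_left] by (simp only: o_def)
  moreover have "((\<lambda>t. cinner x (blinfun_apply (scalar_op (?k t) o\<^sub>L G ((cnj \<circ> \<Gamma>) t)) y)) has_integral
      cinner x (blinfun_apply (op_contour_integral (cnj \<circ> \<Gamma>) G) y)) {0..}"
    using has_integral_linear[OF has_integral_blinfun_apply[OF op_contour_has_integral[OF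
        lipschitz_curve_cnj[OF \<Gamma>] G]] bounded_linear_cinner_right] by (simp only: o_def)
  then have "((\<lambda>t. cinner (blinfun_apply (scalar_op (?g t) o\<^sub>L F (\<Gamma> t)) x) y) has_integral
      cinner x (blinfun_apply (op_contour_integral (cnj \<circ> \<Gamma>) G) y)) {0..}"
  proof (rule has_integral_spike[OF N, rotated])
    fix t :: real assume t: "t \<in> {0..} - ?N"
    then have "0 < t" "?k t = cnj (?g t)" by auto
    then show "cinner (blinfun_apply (scalar_op (?g t) o\<^sub>L F (\<Gamma> t)) x) y
        = cinner x (blinfun_apply (scalar_op (?k t) o\<^sub>L G ((cnj \<circ> \<Gamma>) t)) y)"
      using lin[of t] adj[of t] by (simp add: cinner_simps cinner_badj_right)
  qed
  ultimately show "cinner (blinfun_apply (op_contour_integral \<Gamma> F) x) y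
      = cinner x (blinfun_apply (op_contour_integral (cnj \<circ> \<Gamma>) G) y)"
    by (rule has_integral_unique)
qed

lemma bounded_linear_scalar_op: "bounded_linear (scalar_op :: complex \<Rightarrow> 'a::complex_hilbert_space \<Rightarrow>\<^sub>L 'a)"
proof -
  have "(\<lambda>c. scalar_op c o\<^sub>L id_blinfun) = (scalar_op :: complex \<Rightarrow> 'a \<Rightarrow>\<^sub>L 'a)"
    by (auto intro!: blinfun_eqI)
  then show ?thesis using bounded_linear_scalar_compose[of "id_blinfun :: 'a \<Rightarrow>\<^sub>L 'a"] by simp
qed

lemma set_borel_measurable_halfline:
  fixes f :: "real \<Rightarrow> real"
  assumes "continuous_on {0<..} f"
  shows "set_borel_measurable lborel {0..} f"
proof -
  have "(\<lambda>t. indicator {0<..} t *\<^sub>R f t) \<in> borel_measurable borel"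
    by (rule borel_measurable_continuous_on_indicator[OF _ assms]) simp
  then have "(\<lambda>t. if t = 0 then f 0 else indicator {0<..} t *\<^sub>R f t) \<in> borel_measurable borel"
    by (intro measurable_If) auto
  moreover have "(\<lambda>t. if t = 0 then f 0 else indicator {0<..} t *\<^sub>R f t) = (\<lambda>t. indicator {0..} t *\<^sub>R f t)"
    by (auto simp: indicator_def)
  ultimately show ?thesis by (simp add: set_borel_measurable_def)
qed

lemma set_integrable_halfline:
  fixes f :: "real \<Rightarrow> real"
  assumes f: "continuous_on {0<..} f" and pos: "\<And>t. 0 \<le> t \<Longrightarrow> 0 \<le> f t"
    and fin: "(\<integral>\<^sup>+t\<in>{0..}. ennreal (f t) \<partial>lborel) < \<infinity>"
  shows "set_integrable lborel {0..} f"
  unfolding set_integrable_def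
proof (rule integrableI_nonneg)
  show "(\<lambda>t. indicator {0..} t *\<^sub>R f t) \<in> borel_measurable lborel"
    using set_borel_measurable_halfline[OF f] by (simp add: set_borel_measurable_def)
  show "AE t in lborel. 0 \<le> indicator {0..} t *\<^sub>R f t"
    using pos by (auto simp: indicator_def)
  have "(\<integral>\<^sup>+t. ennreal (indicator {0..} t *\<^sub>R f t) \<partial>lborel) = (\<integral>\<^sup>+t\<in>{0..}. ennreal (f t) \<partial>lborel)"
    by (intro nn_integral_cong) (auto simp: indicator_def)
  then show "(\<integral>\<^sup>+t. ennreal (indicator {0..} t *\<^sub>R f t) \<partial>lborel) < \<infinity>" using fin by simp
qed

lemma set_integrable_halfline_bound:
  fixes f h :: "real \<Rightarrow> real"
  assumes f: "continuous_on {0<..} f" and h: "set_integrable lborel {0..} h"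
    and fh: "\<And>t. 0 \<le> t \<Longrightarrow> \<bar>f t\<bar> \<le> h t"
  shows "set_integrable lborel {0..} f"
proof (rule set_integrable_bound[OF h set_borel_measurable_halfline[OF f]])
  show "AE x in lborel. x \<in> {0..} \<longrightarrow> norm (f x) \<le> norm (h x)"
    using fh by (intro AE_I2) (auto intro: order_trans[OF _ abs_ge_self])
qed

section \<open>Factorization along one contour\<close>

text \<open>The data of the basic equation along a single contour. The hypotheses are invariant under complex
  conjugation of the contour if \<open>KB'\<close> is reflected into its adjoint there.\<close>

locale contour_problem =
  fixes KB' :: "complex \<Rightarrow> ('b::complex_hilbert_space \<Rightarrow>\<^sub>L 'b)" and A :: "'b \<Rightarrow>\<^sub>L 'b"
    and \<Gamma> :: "real \<Rightarrow> complex"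
  assumes A_selfadjoint: "bselfadjoint A"
    and A_spectrum: "bspectrum A \<subseteq> \<real>"
    and lipschitz: "lipschitz_curve \<Gamma>"
    and to_infinity: "\<exists>T. \<forall>t\<ge>T. 0 \<le> t \<longrightarrow> \<rho> \<le> cmod (\<Gamma> t)"
    and KB'_cont: "continuous_on {0<..} (\<lambda>t. KB' (\<Gamma> t))"
    and KB'_lin: "0 < t \<Longrightarrow> clinear_op (KB' (\<Gamma> t))"
    and bounded: "KB_bounded KB' \<Gamma>"
    and d_pos: "0 < d_0 A \<Gamma>"
    and Var_less: "Var_A KB' A \<Gamma> < 1"
    and Var_small: "Var_A KB' A \<Gamma> * norm A < 1/4 * d_0 A \<Gamma> * (1 - Var_A KB' A \<Gamma>)\<^sup>2"
begin

text \<open>\<open>\<delta> w\<close> is the distance of \<open>w\<close> from the spectrum of \<open>A\<close>; on the contour it is at least \<open>d\<close>.\<close>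

abbreviation "\<delta> \<equiv> \<lambda>w. infdist w (bspectrum A)"
abbreviation "d \<equiv> d_0 A \<Gamma>"
abbreviation "V \<equiv> Var_A KB' A \<Gamma>"
abbreviation "r \<equiv> r_min KB' A \<Gamma>"

lemma A_lin: "clinear_op A"
  using A_selfadjoint by (rule bselfadjoint_clinear)

lemma spectrum_nonempty: "bspectrum A \<noteq> {}"
  using d_pos by (auto simp: d_0_def)

lemma \<Gamma>_cont: "continuous_on {0..} \<Gamma>"
proof (rule continuous_onI)
  fix s e :: real assume s: "s \<in> {0..}" and e: "0 < e"
  have "dist (\<Gamma> t) (\<Gamma> s) \<le> dist t s" if "t \<in> {0..}" for t
    using lipschitz s that
    by (cases "t \<le> s") (auto simp: lipschitz_curve_def dist_real_def dist_commute)
  then show "\<exists>\<eta>>0. \<forall>t\<in>{0..}. dist t s < \<eta> \<longrightarrow> dist (\<Gamma> t) (\<Gamma> s) \<le> e"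
    using e by (intro exI[of _ e]) force
qed

lemma \<Gamma>_cont': "continuous_on {0<..} \<Gamma>"
  by (rule continuous_on_subset[OF \<Gamma>_cont]) auto

lemma \<delta>_ge_d: "0 \<le> t \<Longrightarrow> d \<le> \<delta> (\<Gamma> t)"
  unfolding d_0_def infdist_notempty[OF spectrum_nonempty]
  by (rule cINF_greatest[OF spectrum_nonempty]) (auto intro: setdist_le_dist simp: dist_commute)

lemma \<delta>_ge_norm: "cmod w - norm A \<le> \<delta> w"
  by (rule infdist_bspectrum_ge[OF A_lin spectrum_nonempty])

lemma V_nonneg: "0 \<le> V"
  unfolding Var_A_def set_lebesgue_integral_def
  by (rule integral_nonneg_AE) (auto simp: indicator_def infdist_nonneg)

text \<open>The quadratic equation of which \<open>r_min\<close> is the smaller root.\<close>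

lemma r_facts: "0 \<le> r" "2 * r < d * (1 - V)" "r * (d - r) = d * V * (norm A + r)" "2 * r \<le> d"
proof -
  define p where "p = 1/2 * d * (1 - V)"
  define q where "q = 1/4 * d\<^sup>2 * (1 - V)\<^sup>2 - d * V * norm A"
  have r_eq: "r = p - sqrt q" by (simp add: r_min_def p_def q_def)
  have "d * (V * norm A) < d * (1/4 * d * (1 - V)\<^sup>2)"
    using d_pos Var_small by (intro mult_strict_left_mono) auto
  then have q: "0 < q" by (simp add: q_def power2_eq_square algebra_simps)
  have p: "0 < p" using d_pos Var_less by (simp add: p_def)
  have pq: "q = p\<^sup>2 - d * V * norm A"
    by (simp add: p_def q_def power2_eq_square algebra_simps)
  have "0 \<le> d * V * norm A" using d_pos V_nonneg by simp
  then have "sqrt q \<le> sqrt (p\<^sup>2)" using pq by (intro real_sqrt_le_mono) simp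
  then have "sqrt q \<le> p" using p by simp
  then show "0 \<le> r" by (simp add: r_eq)
  have "r < p" using q by (simp add: r_eq)
  then show 1: "2 * r < d * (1 - V)" by (simp add: p_def)
  have "d * (1 - V) \<le> d" using d_pos V_nonneg by (simp add: algebra_simps)
  then show "2 * r \<le> d" using 1 by linarith
  have "(p - r)\<^sup>2 = q" using q by (simp add: r_eq)
  then have "r * (2 * p - r) = d * V * norm A" unfolding pq by (simp add: power2_eq_square algebra_simps)
  moreover have "2 * p = d - d * V" by (simp add: p_def algebra_simps diff_divide_distrib)
  ultimately have "r * (d - d * V - r) = d * V * norm A" by (simp only:)
  then show "r * (d - r) = d * V * (norm A + r)" by (simp add: algebra_simps)
qed

lemma \<delta>_minus_r: "0 \<le> t \<Longrightarrow> \<delta> (\<Gamma> t) / 2 \<le> \<delta> (\<Gamma> t) - r"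
  using \<delta>_ge_d[of t] r_facts(4) by linarith

text \<open>A constant for which $1+|\mu| \le c_1\,\mathrm{dist}(\mu,\sigma(A))$ on the contour.\<close>

definition "c1 = 1 + (1 + norm A) / d"

lemma weight_le_\<delta>:
  assumes t: "0 \<le> t"
  shows "1 + cmod (\<Gamma> t) \<le> c1 * \<delta> (\<Gamma> t)"
proof -
  have "1 + norm A \<le> (1 + norm A) * (\<delta> (\<Gamma> t) / d)"
    using d_pos \<delta>_ge_d[OF t] mult_left_mono[of 1 "\<delta> (\<Gamma> t) / d" "1 + norm A"] by simp
  then show ?thesis using \<delta>_ge_norm[of "\<Gamma> t"] by (simp add: c1_def algebra_simps)
qed

text \<open>The weight of which \<open>KB_bounded\<close> asserts the integrability majorizes, up to constant
  factors, all integrands below.\<close>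

lemma weight_integrable: "set_integrable lborel {0..} (\<lambda>t. norm (KB' (\<Gamma> t)) / (1 + cmod (\<Gamma> t)))"
proof (rule set_integrable_halfline)
  show "continuous_on {0<..} (\<lambda>t. norm (KB' (\<Gamma> t)) / (1 + cmod (\<Gamma> t)))"
  proof (intro continuous_intros KB'_cont \<Gamma>_cont' ballI)
    fix t show "1 + cmod (\<Gamma> t) \<noteq> 0" using norm_ge_zero[of "\<Gamma> t"] by linarith
  qed
  show "(\<integral>\<^sup>+t\<in>{0..}. ennreal (norm (KB' (\<Gamma> t)) / (1 + cmod (\<Gamma> t))) \<partial>lborel) < \<infinity>"
    using bounded by (simp add: KB_bounded_def Var_1_def)
qed simp

lemma contour_integrableI:
  assumes cont: "continuous_on {0<..} (\<lambda>t. G (\<Gamma> t))"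
    and bound: "\<And>t. 0 \<le> t \<Longrightarrow> norm (G (\<Gamma> t)) \<le> norm (KB' (\<Gamma> t)) * (c / (1 + cmod (\<Gamma> t)))"
  shows "contour_integrable \<Gamma> (\<lambda>\<mu>. G \<mu>)"
  unfolding contour_integrable_def
proof (intro conjI cont, rule set_integrable_halfline_bound)
  show "set_integrable lborel {0..} (\<lambda>t. c * (norm (KB' (\<Gamma> t)) / (1 + cmod (\<Gamma> t))))"
    by (rule set_integrable_mult_right) (rule weight_integrable)
  show "\<bar>norm (G (\<Gamma> t))\<bar> \<le> c * (norm (KB' (\<Gamma> t)) / (1 + cmod (\<Gamma> t)))" if "0 \<le> t" for t
    using bound[OF that] by (simp add: field_simps)
qed (intro continuous_intros cont)

text \<open>The contour is closed because it tends to infinity. The bound makes the Cauchy kernel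
  $(z-\mu)^{-1}$ as small at infinity as the weight in \<open>KB_bounded\<close>.\<close>

lemma separated_from_contour:
  assumes z: "z \<notin> \<Gamma> ` {0..}"
  obtains c where "0 < c" "\<And>t. 0 \<le> t \<Longrightarrow> 1 + cmod (\<Gamma> t) \<le> c * cmod (z - \<Gamma> t)"
proof -
  obtain T where T: "\<And>t. T \<le> t \<Longrightarrow> 0 \<le> t \<Longrightarrow> cmod z + 1 \<le> cmod (\<Gamma> t)"
    using to_infinity[of "cmod z + 1"] by auto
  have "compact (\<Gamma> ` {0..T})"
    by (intro compact_continuous_image continuous_on_subset[OF \<Gamma>_cont]) auto
  then have "open (- (\<Gamma> ` {0..T}))" by (simp add: compact_imp_closed open_Compl)
  moreover have "z \<in> - (\<Gamma> ` {0..T})" using z by auto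
  ultimately obtain e where e: "0 < e" "ball z e \<subseteq> - (\<Gamma> ` {0..T})" by (meson open_contains_ball)
  define \<epsilon> where "\<epsilon> = min e 1"
  have \<epsilon>: "0 < \<epsilon>" using e by (simp add: \<epsilon>_def)
  have low: "\<epsilon> \<le> cmod (z - \<Gamma> t)" if t: "0 \<le> t" for t
  proof (cases "t \<le> T")
    case True
    then have "\<Gamma> t \<notin> ball z e" using e(2) t by auto
    then show ?thesis by (auto simp: \<epsilon>_def dist_norm)
  next
    case False
    then have "cmod z + 1 \<le> cmod (\<Gamma> t)" using T[of t] t by simp
    then show ?thesis using norm_triangle_ineq2[of "\<Gamma> t" z] by (simp add: \<epsilon>_def norm_minus_commute)
  qed
  show ?thesis
  proof (rule that[of "1 + (1 + cmod z) / \<epsilon>"])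
    show "0 < 1 + (1 + cmod z) / \<epsilon>" using \<epsilon> by (intro add_pos_nonneg divide_nonneg_pos) auto
    fix t :: real assume t: "0 \<le> t"
    have "1 + cmod z \<le> (1 + cmod z) * (cmod (z - \<Gamma> t) / \<epsilon>)"
      using \<epsilon> low[OF t] mult_left_mono[of 1 "cmod (z - \<Gamma> t) / \<epsilon>" "1 + cmod z"] by simp
    moreover have "cmod (\<Gamma> t) - cmod z \<le> cmod (z - \<Gamma> t)"
      using norm_triangle_ineq2[of "\<Gamma> t" z] by (simp add: norm_minus_commute)
    ultimately show "1 + cmod (\<Gamma> t) \<le> (1 + (1 + cmod z) / \<epsilon>) * cmod (z - \<Gamma> t)"
      by (simp add: algebra_simps)
  qed
qed

lemma Cauchy_kernel_integrable:
  assumes z: "z \<notin> \<Gamma> ` {0..}"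
  shows "contour_integrable \<Gamma> (\<lambda>\<mu>. KB' \<mu> o\<^sub>L scalar_op (inverse (z - \<mu>)))"
proof -
  obtain c where c: "0 < c" "\<And>t. 0 \<le> t \<Longrightarrow> 1 + cmod (\<Gamma> t) \<le> c * cmod (z - \<Gamma> t)"
    using separated_from_contour[OF z] by blast
  show ?thesis
  proof (rule contour_integrableI)
    show "continuous_on {0<..} (\<lambda>t. KB' (\<Gamma> t) o\<^sub>L scalar_op (inverse (z - \<Gamma> t)))"
      using z
      by (intro bounded_bilinear.continuous_on[OF bounded_bilinear_blinfun_compose] KB'_cont
          bounded_linear.continuous_on[OF bounded_linear_scalar_op] continuous_intros \<Gamma>_cont') auto
    fix t :: real assume t: "0 \<le> t"
    have pos: "0 < cmod (z - \<Gamma> t)" using z t by auto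
    have "norm (KB' (\<Gamma> t) o\<^sub>L scalar_op (inverse (z - \<Gamma> t)))
        \<le> norm (KB' (\<Gamma> t)) * cmod (inverse (z - \<Gamma> t))"
      by (intro order_trans[OF norm_blinfun_compose] mult_left_mono norm_scalar_op_le) auto
    also have "cmod (inverse (z - \<Gamma> t)) \<le> c / (1 + cmod (\<Gamma> t))"
      using c(2)[OF t] pos by (simp only: norm_inverse) (simp add: field_simps add_pos_nonneg)
    finally show "norm (KB' (\<Gamma> t) o\<^sub>L scalar_op (inverse (z - \<Gamma> t)))
        \<le> norm (KB' (\<Gamma> t)) * (c / (1 + cmod (\<Gamma> t)))" by (simp add: mult_left_mono)
  qed
qed

end

text \<open>\<open>X\<close> solves the basic equation, \<open>H\<close> is the operator that it defines and \<open>R\<close> the resolvent of \<open>H\<close>.\<close>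

locale contour_solution = contour_problem KB' A \<Gamma> for KB' A \<Gamma> +
  fixes X :: "'a::complex_hilbert_space \<Rightarrow>\<^sub>L 'a"
  assumes X: "basic_solution KB' A \<Gamma> X"
begin

abbreviation "H \<equiv> A + X"
abbreviation "R \<equiv> \<lambda>\<mu>. binverse (H - scalar_op \<mu>)"

lemma X_lin: "clinear_op X" and X_norm: "norm X \<le> r" and X_eq: "X = V_1 KB' H \<Gamma>"
  using X by (auto simp: basic_solution_def)

lemma H_lin: "clinear_op H"
  by (intro clinear_op_intros A_lin X_lin)

lemma resolvent_exists:
  assumes "r < \<delta> w"
  shows "\<exists>S. is_binverse (H - scalar_op w) S"
  using selfadjoint_perturbation_resolvent[OF A_selfadjoint A_spectrum spectrum_nonempty, of X w]
    X_norm assms by auto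

lemma
  assumes t: "0 \<le> t"
  shows R_inverse: "is_binverse (H - scalar_op (\<Gamma> t)) (R (\<Gamma> t))"
    and R_norm: "norm (R (\<Gamma> t)) \<le> 1 / (\<delta> (\<Gamma> t) - r)"
    and R_lin: "clinear_op (R (\<Gamma> t))"
proof -
  have 1: "0 < \<delta> (\<Gamma> t) - r" using \<delta>_minus_r[OF t] \<delta>_ge_d[OF t] d_pos by linarith
  then obtain S where S: "is_binverse (H - scalar_op (\<Gamma> t)) S" "norm S \<le> 1 / (\<delta> (\<Gamma> t) - norm X)"
    using selfadjoint_perturbation_resolvent[OF A_selfadjoint A_spectrum spectrum_nonempty, of X "\<Gamma> t"]
      X_norm by auto
  have "R (\<Gamma> t) = S" using S(1) by (rule binverse_eq)
  moreover have "1 / (\<delta> (\<Gamma> t) - norm X) \<le> 1 / (\<delta> (\<Gamma> t) - r)"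
    using 1 X_norm by (intro divide_left_mono mult_pos_pos) auto
  ultimately show "is_binverse (H - scalar_op (\<Gamma> t)) (R (\<Gamma> t))"
    and "norm (R (\<Gamma> t)) \<le> 1 / (\<delta> (\<Gamma> t) - r)" using S by auto
  then show "clinear_op (R (\<Gamma> t))"
    using is_binverse_clinear[OF _ clinear_op_diff[OF H_lin clinear_op_scalar]] by blast
qed

lemma R_weight:
  assumes t: "0 \<le> t"
  shows "norm (R (\<Gamma> t)) \<le> 2 * c1 / (1 + cmod (\<Gamma> t))"
proof -
  have p: "0 < \<delta> (\<Gamma> t)" using \<delta>_ge_d[OF t] d_pos by linarith
  have "norm (R (\<Gamma> t)) \<le> 1 / (\<delta> (\<Gamma> t) - r)" by (rule R_norm[OF t])
  also have "\<dots> \<le> 1 / (\<delta> (\<Gamma> t) / 2)"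
    using \<delta>_minus_r[OF t] p by (intro divide_left_mono mult_pos_pos) auto
  also have "\<dots> \<le> 2 * c1 / (1 + cmod (\<Gamma> t))"
    using weight_le_\<delta>[OF t] p by (simp add: field_simps add_pos_nonneg)
  finally show ?thesis .
qed

lemma R_cont: "continuous_on {0<..} (\<lambda>t. R (\<Gamma> t))"
proof -
  have R_le: "norm (R (\<Gamma> t)) \<le> 2 / d" if t: "0 \<le> t" for t
  proof -
    have "norm (R (\<Gamma> t)) \<le> 1 / (\<delta> (\<Gamma> t) - r)" by (rule R_norm[OF t])
    also have "\<dots> \<le> 1 / (d / 2)"
      using \<delta>_minus_r[OF t] \<delta>_ge_d[OF t] d_pos by (intro divide_left_mono mult_pos_pos) auto
    finally show ?thesis by simp
  qed
  have diff: "dist (R (\<Gamma> t)) (R (\<Gamma> s)) \<le> (2 / d) * (2 / d) * dist (\<Gamma> t) (\<Gamma> s)" if "0 \<le> t" "0 \<le> s" for s t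
  proof -
    have "R (\<Gamma> t) - R (\<Gamma> s) = R (\<Gamma> t) o\<^sub>L scalar_op (\<Gamma> t - \<Gamma> s) o\<^sub>L R (\<Gamma> s)"
    proof (rule blinfun_eqI)
      fix x
      let ?y = "blinfun_apply (R (\<Gamma> s)) x"
      have "x = blinfun_apply (H - scalar_op (\<Gamma> s)) ?y"
        by (simp only: is_binverseD(1)[OF R_inverse[OF that(2)]])
      also have "\<dots> = blinfun_apply (H - scalar_op (\<Gamma> t)) ?y + (\<Gamma> t - \<Gamma> s) *\<^sub>C ?y"
        by (simp add: blinfun.diff_left scaleC_simps)
      finally have "blinfun_apply (R (\<Gamma> t)) x = blinfun_apply (R (\<Gamma> t))
          (blinfun_apply (H - scalar_op (\<Gamma> t)) ?y + (\<Gamma> t - \<Gamma> s) *\<^sub>C ?y)" by (rule arg_cong)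
      also have "\<dots> = ?y + blinfun_apply (R (\<Gamma> t)) ((\<Gamma> t - \<Gamma> s) *\<^sub>C ?y)"
        by (simp only: blinfun.add_right is_binverseD(2)[OF R_inverse[OF that(1)]])
      finally show "blinfun_apply (R (\<Gamma> t) - R (\<Gamma> s)) x
          = blinfun_apply (R (\<Gamma> t) o\<^sub>L scalar_op (\<Gamma> t - \<Gamma> s) o\<^sub>L R (\<Gamma> s)) x"
        by (simp add: blinfun.diff_left)
    qed
    then have "dist (R (\<Gamma> t)) (R (\<Gamma> s)) \<le> norm (R (\<Gamma> t)) * cmod (\<Gamma> t - \<Gamma> s) * norm (R (\<Gamma> s))"
      unfolding dist_norm
      by (simp only:) (intro order_trans[OF norm_blinfun_compose] mult_mono order_refl mult_nonneg_nonneg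
          norm_scalar_op_le; simp)
    also have "\<dots> \<le> (2 / d) * cmod (\<Gamma> t - \<Gamma> s) * (2 / d)"
      using R_le that d_pos by (intro mult_mono) auto
    finally show ?thesis by (simp add: dist_norm)
  qed
  show ?thesis
  proof (rule continuous_onI)
    fix s e :: real assume s: "s \<in> {0<..}" and e: "0 < e"
    define k where "k = (2 / d) * (2 / d)"
    have k: "0 < k" using d_pos by (simp add: k_def)
    obtain \<eta> where \<eta>: "0 < \<eta>" "\<And>t. t \<in> {0<..} \<Longrightarrow> dist t s < \<eta> \<Longrightarrow> dist (\<Gamma> t) (\<Gamma> s) < e / k"
      using \<Gamma>_cont' s divide_pos_pos[OF e k] unfolding continuous_on_iff by metis
    show "\<exists>\<eta>>0. \<forall>t\<in>{0<..}. dist t s < \<eta> \<longrightarrow> dist (R (\<Gamma> t)) (R (\<Gamma> s)) \<le> e"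
    proof (intro exI[of _ \<eta>] conjI ballI impI)
      fix t assume t: "t \<in> {0<..}" "dist t s < \<eta>"
      have "dist (R (\<Gamma> t)) (R (\<Gamma> s)) \<le> k * dist (\<Gamma> t) (\<Gamma> s)"
        unfolding k_def using t s by (intro diff) auto
      also have "\<dots> \<le> k * (e / k)" using \<eta>(2)[OF t] k by (intro mult_left_mono) auto
      finally show "dist (R (\<Gamma> t)) (R (\<Gamma> s)) \<le> e" using k by simp
    qed (rule \<eta>(1))
  qed
qed

lemma resolvent_integrand_integrable:
  assumes Q: "continuous_on {0<..} (\<lambda>t. Q (\<Gamma> t))" "\<And>t. 0 \<le> t \<Longrightarrow> norm (Q (\<Gamma> t)) \<le> c"
  shows "contour_integrable \<Gamma> (\<lambda>\<mu>. KB' \<mu> o\<^sub>L Q \<mu> o\<^sub>L R \<mu>)"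
proof (rule contour_integrableI)
  show "continuous_on {0<..} (\<lambda>t. KB' (\<Gamma> t) o\<^sub>L Q (\<Gamma> t) o\<^sub>L R (\<Gamma> t))"
    by (intro bounded_bilinear.continuous_on[OF bounded_bilinear_blinfun_compose] KB'_cont Q R_cont)
  fix t :: real assume t: "0 \<le> t"
  have "norm (KB' (\<Gamma> t) o\<^sub>L Q (\<Gamma> t) o\<^sub>L R (\<Gamma> t)) \<le> norm (KB' (\<Gamma> t)) * norm (Q (\<Gamma> t)) * norm (R (\<Gamma> t))"
    by (intro order_trans[OF norm_blinfun_compose] mult_right_mono norm_blinfun_compose) auto
  also have "\<dots> \<le> norm (KB' (\<Gamma> t)) * c * (2 * c1 / (1 + cmod (\<Gamma> t)))"
    using Q(2)[OF t] R_weight[OF t] order_trans[OF norm_ge_zero Q(2)[OF t]]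
    by (intro mult_mono mult_nonneg_nonneg) auto
  finally show "norm (KB' (\<Gamma> t) o\<^sub>L Q (\<Gamma> t) o\<^sub>L R (\<Gamma> t))
      \<le> norm (KB' (\<Gamma> t)) * (c * (2 * c1) / (1 + cmod (\<Gamma> t)))" by (simp add: mult.assoc)
qed

lemma integrands_integrable:
  shows int1: "contour_integrable \<Gamma> (\<lambda>\<mu>. KB' \<mu> o\<^sub>L R \<mu>)"
    and intX: "contour_integrable \<Gamma> (\<lambda>\<mu>. KB' \<mu> o\<^sub>L H o\<^sub>L R \<mu>)"
    and int2: "z \<notin> \<Gamma> ` {0..} \<Longrightarrow>
      contour_integrable \<Gamma> (\<lambda>\<mu>. KB' \<mu> o\<^sub>L scalar_op (inverse (z - \<mu>)) o\<^sub>L R \<mu>)"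
proof -
  have id: "U o\<^sub>L id_blinfun = U" for U :: "'a \<Rightarrow>\<^sub>L 'a" by (rule blinfun_eqI) simp
  show "contour_integrable \<Gamma> (\<lambda>\<mu>. KB' \<mu> o\<^sub>L R \<mu>)"
    using resolvent_integrand_integrable[of "\<lambda>_. id_blinfun" "norm (id_blinfun :: 'a \<Rightarrow>\<^sub>L 'a)"] by (simp add: id)
  show "contour_integrable \<Gamma> (\<lambda>\<mu>. KB' \<mu> o\<^sub>L H o\<^sub>L R \<mu>)"
    by (rule resolvent_integrand_integrable[of "\<lambda>_. H" "norm H"]) auto
  assume z: "z \<notin> \<Gamma> ` {0..}"
  obtain c where c: "0 < c" "\<And>t. 0 \<le> t \<Longrightarrow> 1 + cmod (\<Gamma> t) \<le> c * cmod (z - \<Gamma> t)"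
    using separated_from_contour[OF z] by blast
  show "contour_integrable \<Gamma> (\<lambda>\<mu>. KB' \<mu> o\<^sub>L scalar_op (inverse (z - \<mu>)) o\<^sub>L R \<mu>)"
  proof (rule resolvent_integrand_integrable[of "\<lambda>\<mu>. scalar_op (inverse (z - \<mu>))" c])
    show "continuous_on {0<..} (\<lambda>t. scalar_op (inverse (z - \<Gamma> t)) :: 'a \<Rightarrow>\<^sub>L 'a)"
      using z by (intro bounded_linear.continuous_on[OF bounded_linear_scalar_op] continuous_intros \<Gamma>_cont') auto
    fix t :: real assume t: "0 \<le> t"
    have pos: "0 < cmod (z - \<Gamma> t)" using z t by auto
    have "cmod (inverse (z - \<Gamma> t)) \<le> c"
    proof -
      have "1 \<le> c * cmod (z - \<Gamma> t)" using c(2)[OF t] norm_ge_zero[of "\<Gamma> t"] by linarith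
      then show ?thesis using pos by (simp only: norm_inverse) (simp add: field_simps)
    qed
    then show "norm (scalar_op (inverse (z - \<Gamma> t)) :: 'a \<Rightarrow>\<^sub>L 'a) \<le> c"
      using norm_scalar_op_le order_trans by blast
  qed
qed

lemma W_lin:
  assumes "z \<notin> \<Gamma> ` {0..}"
  shows "clinear_op (W_1 KB' H z \<Gamma>)"
  unfolding W_1_def
  by (intro clinear_op_intros clinear_op_contour_integral lipschitz int1 int2[OF assms] KB'_lin R_lin) simp_all

text \<open>With $R_\mu=(H-\mu)^{-1}$ one has $R_\mu(H-z) = I + (\mu-z)R_\mu$ and $HR_\mu = I+\mu R_\mu$.
  Under the integral the terms containing $R_\mu$ therefore add up to the integrand of $-X$, and
  what remains does not depend on the solution \<open>X\<close>.\<close>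

theorem W_factorization:
  assumes z: "z \<notin> \<Gamma> ` {0..}"
  shows "W_1 KB' H z \<Gamma> o\<^sub>L (H - scalar_op z) = A - scalar_op z +
    (scalar_op z o\<^sub>L op_contour_integral \<Gamma> (\<lambda>\<mu>. KB' \<mu> o\<^sub>L scalar_op (inverse (z - \<mu>))))"
proof -
  let ?Q = "H - scalar_op z"
  define I1 where "I1 = op_contour_integral \<Gamma> (\<lambda>\<mu>. KB' \<mu> o\<^sub>L R \<mu>)"
  define I2 where "I2 = op_contour_integral \<Gamma> (\<lambda>\<mu>. KB' \<mu> o\<^sub>L scalar_op (inverse (z - \<mu>)) o\<^sub>L R \<mu>)"
  define J where "J = op_contour_integral \<Gamma> (\<lambda>\<mu>. KB' \<mu> o\<^sub>L scalar_op (inverse (z - \<mu>)))"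
  have XI: "X = op_contour_integral \<Gamma> (\<lambda>\<mu>. KB' \<mu> o\<^sub>L H o\<^sub>L R \<mu>)"
    using X_eq by (simp add: V_1_def)
  let ?s = "\<lambda>t. scalar_op (contour_density \<Gamma> t) :: 'a \<Rightarrow>\<^sub>L 'a"
  let ?K = "\<lambda>t. KB' (\<Gamma> t)" and ?i = "\<lambda>t. scalar_op (inverse (z - \<Gamma> t)) :: 'a \<Rightarrow>\<^sub>L 'a"
  note right = bounded_bilinear.bounded_linear_left[OF bounded_bilinear_blinfun_compose]
  note left = bounded_bilinear.bounded_linear_right[OF bounded_bilinear_blinfun_compose]
  have h1: "((\<lambda>t. (?s t o\<^sub>L (?K t o\<^sub>L R (\<Gamma> t))) o\<^sub>L ?Q) has_integral (I1 o\<^sub>L ?Q)) {0..}"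
    using has_integral_linear[OF op_contour_has_integral[OF lipschitz int1] right] by (simp only: o_def I1_def)
  have "((\<lambda>t. (?s t o\<^sub>L (?K t o\<^sub>L ?i t o\<^sub>L R (\<Gamma> t))) o\<^sub>L ?Q) has_integral (I2 o\<^sub>L ?Q)) {0..}"
    using has_integral_linear[OF op_contour_has_integral[OF lipschitz int2[OF z]] right] by (simp only: o_def I2_def)
  from has_integral_linear[OF this left[of "scalar_op z"]]
  have h2: "((\<lambda>t. scalar_op z o\<^sub>L ((?s t o\<^sub>L (?K t o\<^sub>L ?i t o\<^sub>L R (\<Gamma> t))) o\<^sub>L ?Q)) has_integral
      (scalar_op z o\<^sub>L (I2 o\<^sub>L ?Q))) {0..}" by (simp only: o_def)
  have hX: "((\<lambda>t. ?s t o\<^sub>L (?K t o\<^sub>L H o\<^sub>L R (\<Gamma> t))) has_integral X) {0..}"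
    by (subst XI) (rule op_contour_has_integral[OF lipschitz intX])
  have "((\<lambda>t. ?s t o\<^sub>L (?K t o\<^sub>L ?i t)) has_integral J) {0..}"
    unfolding J_def by (rule op_contour_has_integral[OF lipschitz Cauchy_kernel_integrable[OF z]])
  from has_integral_linear[OF this left[of "scalar_op z"]]
  have hJ: "((\<lambda>t. scalar_op z o\<^sub>L (?s t o\<^sub>L (?K t o\<^sub>L ?i t))) has_integral (scalar_op z o\<^sub>L J)) {0..}"
    by (simp only: o_def)
  have "(scalar_op z o\<^sub>L (I2 o\<^sub>L ?Q)) - (I1 o\<^sub>L ?Q) = (scalar_op z o\<^sub>L J) - X"
  proof (rule has_integral_unique[OF has_integral_diff[OF h2 h1]])
    show "((\<lambda>t. (scalar_op z o\<^sub>L ((?s t o\<^sub>L (?K t o\<^sub>L ?i t o\<^sub>L R (\<Gamma> t))) o\<^sub>L ?Q))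
        - ((?s t o\<^sub>L (?K t o\<^sub>L R (\<Gamma> t))) o\<^sub>L ?Q)) has_integral ((scalar_op z o\<^sub>L J) - X)) {0..}"
    proof (rule has_integral_spike[of "{0}", OF _ _ has_integral_diff[OF hJ hX]])
      fix t :: real assume "t \<in> {0..} - {0}"
      then have t: "0 \<le> t" "0 < t" by auto
      define \<mu> where "\<mu> = \<Gamma> t"
      have z\<mu>: "z - \<mu> \<noteq> 0" using z t by (auto simp: \<mu>_def)
      show "(scalar_op z o\<^sub>L ((?s t o\<^sub>L (?K t o\<^sub>L ?i t o\<^sub>L R (\<Gamma> t))) o\<^sub>L ?Q))
          - ((?s t o\<^sub>L (?K t o\<^sub>L R (\<Gamma> t))) o\<^sub>L ?Q)
          = (scalar_op z o\<^sub>L (?s t o\<^sub>L (?K t o\<^sub>L ?i t))) - (?s t o\<^sub>L (?K t o\<^sub>L H o\<^sub>L R (\<Gamma> t)))"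
        unfolding \<mu>_def[symmetric]
      proof (rule blinfun_eqI)
        fix x
        let ?y = "blinfun_apply (R \<mu>) x"
        note Rinv = is_binverseD[OF R_inverse[OF t(1)], folded \<mu>_def]
        have Rs: "blinfun_apply (R \<mu>) (c *\<^sub>C v) = c *\<^sub>C blinfun_apply (R \<mu>) v" for c v
          using R_lin[OF t(1)] by (simp add: clinear_op_def \<mu>_def)
        have Ks: "blinfun_apply (KB' \<mu>) (c *\<^sub>C v) = c *\<^sub>C blinfun_apply (KB' \<mu>) v" for c v
          using KB'_lin[OF t(2)] by (simp add: clinear_op_def \<mu>_def)
        have "blinfun_apply ?Q x = blinfun_apply (H - scalar_op \<mu>) x + (\<mu> - z) *\<^sub>C x"
          by (simp add: blinfun.diff_left scaleC_simps)
        then have "blinfun_apply (R \<mu>) (blinfun_apply ?Q x)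
            = blinfun_apply (R \<mu>) (blinfun_apply (H - scalar_op \<mu>) x + (\<mu> - z) *\<^sub>C x)" by (rule arg_cong)
        also have "\<dots> = x + (\<mu> - z) *\<^sub>C ?y"
          by (simp only: blinfun.add_right Rinv(2) Rs)
        finally have e1: "blinfun_apply (R \<mu>) (blinfun_apply ?Q x) = x + (\<mu> - z) *\<^sub>C ?y" .
        have "blinfun_apply H ?y = blinfun_apply (H - scalar_op \<mu>) ?y + \<mu> *\<^sub>C ?y"
          by (simp add: blinfun.diff_left)
        then have e2: "blinfun_apply H ?y = x + \<mu> *\<^sub>C ?y" by (simp only: Rinv(1))
        show "blinfun_apply ((scalar_op z o\<^sub>L ((?s t o\<^sub>L (KB' \<mu> o\<^sub>L scalar_op (inverse (z - \<mu>)) o\<^sub>L R \<mu>)) o\<^sub>L ?Q))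
            - ((?s t o\<^sub>L (KB' \<mu> o\<^sub>L R \<mu>)) o\<^sub>L ?Q)) x
          = blinfun_apply ((scalar_op z o\<^sub>L (?s t o\<^sub>L (KB' \<mu> o\<^sub>L scalar_op (inverse (z - \<mu>)))))
            - (?s t o\<^sub>L (KB' \<mu> o\<^sub>L H o\<^sub>L R \<mu>))) x"
        proof (rule cinner_right_eqI)
          fix w
          have canc: "inverse (z - \<mu>) * ((\<mu> - z) * b) = - b" for b
            using z\<mu> by (simp add: field_simps)
          show "cinner w (blinfun_apply ((scalar_op z o\<^sub>L ((?s t o\<^sub>L (KB' \<mu> o\<^sub>L scalar_op (inverse (z - \<mu>)) o\<^sub>L R \<mu>)) o\<^sub>L ?Q))
            - ((?s t o\<^sub>L (KB' \<mu> o\<^sub>L R \<mu>)) o\<^sub>L ?Q)) x)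
          = cinner w (blinfun_apply ((scalar_op z o\<^sub>L (?s t o\<^sub>L (KB' \<mu> o\<^sub>L scalar_op (inverse (z - \<mu>)))))
            - (?s t o\<^sub>L (KB' \<mu> o\<^sub>L H o\<^sub>L R \<mu>))) x)"
            by (simp only: blinfun.diff_left blinfun_apply_blinfun_compose scalar_op_apply e1[unfolded blinfun.diff_left scalar_op_apply] e2
                blinfun.add_right Ks cinner_simps canc) (simp add: algebra_simps)
        qed
      qed
    qed simp
  qed
  moreover have "W_1 KB' H z \<Gamma> o\<^sub>L ?Q = ?Q + ((scalar_op z o\<^sub>L (I2 o\<^sub>L ?Q)) - (I1 o\<^sub>L ?Q))"
    unfolding W_1_def I1_def[symmetric] I2_def[symmetric]
    by (rule blinfun_eqI) (simp add: blinfun.add_left blinfun.diff_left)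
  ultimately have "W_1 KB' H z \<Gamma> o\<^sub>L ?Q = ?Q + ((scalar_op z o\<^sub>L J) - X)" by simp
  then show ?thesis unfolding J_def by simp
qed

text \<open>Combining the two integrals gives $W_1(z)-I=\int K_B'(\mu)\,\mu(z-\mu)^{-1}(H-\mu)^{-1}d\mu$. For \<open>z\<close>
  within distance \<open>r\<close> of the spectrum of \<open>A\<close> its norm is at most
  $Vd(d+\|A\|)/(d-r)^2 = (Vd+r)/(d-r) < 1$.\<close>

theorem W_invertible:
  assumes z: "\<delta> z \<le> r"
  shows "z \<notin> \<Gamma> ` {0..}" "\<exists>S. is_binverse (W_1 KB' H z \<Gamma>) S"
proof -
  have far: "\<delta> (\<Gamma> t) - r \<le> cmod (z - \<Gamma> t)" "0 < \<delta> (\<Gamma> t) - r" if t: "0 \<le> t" for t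
  proof -
    show "0 < \<delta> (\<Gamma> t) - r" using \<delta>_minus_r[OF t] \<delta>_ge_d[OF t] d_pos by linarith
    have "\<delta> (\<Gamma> t) \<le> \<delta> z + dist (\<Gamma> t) z" by (rule infdist_triangle)
    then show "\<delta> (\<Gamma> t) - r \<le> cmod (z - \<Gamma> t)" using z by (simp add: dist_norm norm_minus_commute)
  qed
  then have ne: "z \<noteq> \<Gamma> t" if "0 \<le> t" for t using that by fastforce
  then show zG: "z \<notin> \<Gamma> ` {0..}" by auto
  define F where "F \<mu> = KB' \<mu> o\<^sub>L scalar_op (\<mu> / (z - \<mu>)) o\<^sub>L R \<mu>" for \<mu>
  define c where "c = (d + norm A) / (d - r)"
  have dr: "0 < d - r" using r_facts(4) d_pos by linarith
  have c: "cmod (\<Gamma> t / (z - \<Gamma> t)) \<le> c" if t: "0 \<le> t" for t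
  proof -
    have zA: "cmod z \<le> norm A + r" using \<delta>_ge_norm[of z] z by linarith
    have zp: "0 < cmod (z - \<Gamma> t)" "d - r \<le> cmod (z - \<Gamma> t)"
      using far[OF t] \<delta>_ge_d[OF t] by linarith+
    have "cmod (\<Gamma> t) \<le> cmod (z - \<Gamma> t) + cmod z"
      using norm_triangle_ineq2[of "\<Gamma> t" z] by (simp add: norm_minus_commute)
    then have "cmod (\<Gamma> t / (z - \<Gamma> t)) \<le> (cmod (z - \<Gamma> t) + (norm A + r)) / cmod (z - \<Gamma> t)"
      using zA zp by (simp add: norm_divide divide_right_mono)
    also have "\<dots> = 1 + (norm A + r) / cmod (z - \<Gamma> t)" using zp by (simp add: add_divide_distrib)
    also have "\<dots> \<le> 1 + (norm A + r) / (d - r)"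
      using zp dr r_facts(1) by (intro add_left_mono divide_left_mono mult_pos_pos) auto
    also have "\<dots> = c" using dr by (simp add: c_def field_simps)
    finally show ?thesis .
  qed
  have F_int: "contour_integrable \<Gamma> F"
    unfolding F_def
  proof (rule resolvent_integrand_integrable[of "\<lambda>\<mu>. scalar_op (\<mu> / (z - \<mu>))" c])
    show "continuous_on {0<..} (\<lambda>t. scalar_op (\<Gamma> t / (z - \<Gamma> t)) :: 'a \<Rightarrow>\<^sub>L 'a)"
      using ne by (intro bounded_linear.continuous_on[OF bounded_linear_scalar_op] continuous_intros \<Gamma>_cont') auto
    show "norm (scalar_op (\<Gamma> t / (z - \<Gamma> t)) :: 'a \<Rightarrow>\<^sub>L 'a) \<le> c" if "0 \<le> t" for t
      using c[OF that] norm_scalar_op_le order_trans by blast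
  qed
  have W_eq: "W_1 KB' H z \<Gamma> = id_blinfun + op_contour_integral \<Gamma> F"
  proof -
    define I1 where "I1 = op_contour_integral \<Gamma> (\<lambda>\<mu>. KB' \<mu> o\<^sub>L R \<mu>)"
    define I2 where "I2 = op_contour_integral \<Gamma> (\<lambda>\<mu>. KB' \<mu> o\<^sub>L scalar_op (inverse (z - \<mu>)) o\<^sub>L R \<mu>)"
    note h1 = op_contour_has_integral[OF lipschitz int1, folded I1_def]
    note left = bounded_bilinear.bounded_linear_right[OF bounded_bilinear_blinfun_compose]
    note h2 = has_integral_linear[OF op_contour_has_integral[OF lipschitz int2[OF zG], folded I2_def]
        left[of "scalar_op z"], unfolded o_def]
    have "((\<lambda>t. scalar_op (contour_density \<Gamma> t) o\<^sub>L F (\<Gamma> t)) has_integral ((scalar_op z o\<^sub>L I2) - I1)) {0..}"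
    proof (rule has_integral_spike[of "{0}", OF _ _ has_integral_diff[OF h2 h1]])
      fix t :: real assume "t \<in> {0..} - {0}"
      then have t: "0 \<le> t" "0 < t" by auto
      have zt: "z - \<Gamma> t \<noteq> 0" using ne[OF t(1)] by simp
      show "scalar_op (contour_density \<Gamma> t) o\<^sub>L F (\<Gamma> t)
        = (scalar_op z o\<^sub>L (scalar_op (contour_density \<Gamma> t) o\<^sub>L
            (KB' (\<Gamma> t) o\<^sub>L scalar_op (inverse (z - \<Gamma> t)) o\<^sub>L R (\<Gamma> t))))
          - (scalar_op (contour_density \<Gamma> t) o\<^sub>L (KB' (\<Gamma> t) o\<^sub>L R (\<Gamma> t)))"
      proof (rule blinfun_eqI, rule cinner_right_eqI)
        fix x w
        let ?a = "cinner w (blinfun_apply (KB' (\<Gamma> t)) (blinfun_apply (R (\<Gamma> t)) x))"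
        let ?g = "contour_density \<Gamma> t"
        have Ks: "blinfun_apply (KB' (\<Gamma> t)) (c *\<^sub>C v) = c *\<^sub>C blinfun_apply (KB' (\<Gamma> t)) v" for c v
          using KB'_lin[OF t(2)] by (simp add: clinear_op_def)
        have "?g * (\<Gamma> t / (z - \<Gamma> t) * ?a) = z * (?g * (inverse (z - \<Gamma> t) * ?a)) - ?g * ?a"
          using zt by (simp add: field_simps)
        then show "cinner w (blinfun_apply (scalar_op ?g o\<^sub>L F (\<Gamma> t)) x) = cinner w (blinfun_apply
          ((scalar_op z o\<^sub>L (scalar_op ?g o\<^sub>L
            (KB' (\<Gamma> t) o\<^sub>L scalar_op (inverse (z - \<Gamma> t)) o\<^sub>L R (\<Gamma> t))))
          - (scalar_op ?g o\<^sub>L (KB' (\<Gamma> t) o\<^sub>L R (\<Gamma> t)))) x)"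
          by (simp only: F_def blinfun.diff_left blinfun_apply_blinfun_compose scalar_op_apply Ks cinner_simps)
      qed
    qed simp
    then have "op_contour_integral \<Gamma> F = (scalar_op z o\<^sub>L I2) - I1"
      using op_contour_has_integral[OF lipschitz F_int] has_integral_unique by blast
    then show ?thesis unfolding W_1_def I1_def[symmetric] I2_def[symmetric] by simp
  qed
  have F_le: "norm (F (\<Gamma> t)) \<le> c * (d / (d - r)) * (norm (KB' (\<Gamma> t)) / \<delta> (\<Gamma> t))" if t: "0 \<le> t" for t
  proof -
    have p: "0 < \<delta> (\<Gamma> t)" using \<delta>_ge_d[OF t] d_pos by linarith
    have "norm (F (\<Gamma> t)) \<le> norm (KB' (\<Gamma> t)) * norm (scalar_op (\<Gamma> t / (z - \<Gamma> t)) :: 'a \<Rightarrow>\<^sub>L 'a) * norm (R (\<Gamma> t))"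
      unfolding F_def by (intro order_trans[OF norm_blinfun_compose] mult_right_mono norm_blinfun_compose) auto
    also have "\<dots> \<le> norm (KB' (\<Gamma> t)) * c * (d / (d - r) / \<delta> (\<Gamma> t))"
    proof (intro mult_mono mult_nonneg_nonneg)
      show "norm (scalar_op (\<Gamma> t / (z - \<Gamma> t)) :: 'a \<Rightarrow>\<^sub>L 'a) \<le> c"
        using c[OF t] norm_scalar_op_le order_trans by blast
      show "0 \<le> c" using dr d_pos by (simp add: c_def)
      have "(d - r) * \<delta> (\<Gamma> t) \<le> d * (\<delta> (\<Gamma> t) - r)"
        using mult_right_mono[OF \<delta>_ge_d[OF t] r_facts(1)] by (simp add: algebra_simps)
      then have "1 / (\<delta> (\<Gamma> t) - r) \<le> d / (d - r) / \<delta> (\<Gamma> t)"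
        using dr p far(2)[OF t] by (simp add: field_simps)
      then show "norm (R (\<Gamma> t)) \<le> d / (d - r) / \<delta> (\<Gamma> t)" using R_norm[OF t] by linarith
    qed auto
    finally show ?thesis by (simp add: field_simps)
  qed
  have \<delta>_int: "set_integrable lborel {0..} (\<lambda>t. norm (KB' (\<Gamma> t)) / \<delta> (\<Gamma> t))"
  proof (rule set_integrable_halfline_bound)
    show "set_integrable lborel {0..} (\<lambda>t. c1 * (norm (KB' (\<Gamma> t)) / (1 + cmod (\<Gamma> t))))"
      by (rule set_integrable_mult_right) (rule weight_integrable)
    show "continuous_on {0<..} (\<lambda>t. norm (KB' (\<Gamma> t)) / \<delta> (\<Gamma> t))"
    proof (intro continuous_intros KB'_cont \<Gamma>_cont' ballI)
      fix t :: real assume "t \<in> {0<..}"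
      then show "\<delta> (\<Gamma> t) \<noteq> 0" using \<delta>_ge_d[of t] d_pos by simp
    qed
    fix t :: real assume t: "0 \<le> t"
    have p: "0 < \<delta> (\<Gamma> t)" using \<delta>_ge_d[OF t] d_pos by linarith
    have "1 / \<delta> (\<Gamma> t) \<le> c1 / (1 + cmod (\<Gamma> t))"
      using weight_le_\<delta>[OF t] p by (simp add: field_simps add_pos_nonneg)
    from mult_left_mono[OF this norm_ge_zero[of "KB' (\<Gamma> t)"]]
    show "\<bar>norm (KB' (\<Gamma> t)) / \<delta> (\<Gamma> t)\<bar> \<le> c1 * (norm (KB' (\<Gamma> t)) / (1 + cmod (\<Gamma> t)))"
      using p by (simp add: mult.commute)
  qed
  have "norm (op_contour_integral \<Gamma> F) \<le> (LINT t:{0..}|lborel. norm (F (\<Gamma> t)))"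
    by (rule norm_op_contour_integral_le[OF lipschitz F_int])
  also have "\<dots> \<le> (LINT t:{0..}|lborel. c * (d / (d - r)) * (norm (KB' (\<Gamma> t)) / \<delta> (\<Gamma> t)))"
  proof (rule set_integral_mono)
    show "set_integrable lborel {0..} (\<lambda>t. c * (d / (d - r)) * (norm (KB' (\<Gamma> t)) / \<delta> (\<Gamma> t)))"
      by (rule set_integrable_mult_right) (rule \<delta>_int)
  qed (use F_int F_le in \<open>auto simp: contour_integrable_def\<close>)
  also have "\<dots> = c * (d / (d - r)) * V"
    unfolding Var_A_def by (rule set_integral_mult_right)
  also have "\<dots> < 1"
  proof -
    have "d * V * (d + norm A) = d * V * (d - r) + d * V * (norm A + r)" by (simp add: algebra_simps)
    also have "\<dots> = d * V * (d - r) + r * (d - r)" by (simp only: r_facts(3))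
    also have "\<dots> = (d * V + r) * (d - r)" by (simp add: algebra_simps)
    also have "\<dots> < (d - r) * (d - r)"
      using r_facts(2) dr by (intro mult_strict_right_mono) (simp_all add: algebra_simps)
    finally have "d * V * (d + norm A) < (d - r) * (d - r)" .
    moreover have "c * (d / (d - r)) * V = d * V * (d + norm A) / ((d - r) * (d - r))"
      by (simp add: c_def)
    ultimately show ?thesis using dr by simp
  qed
  finally show "\<exists>S. is_binverse (W_1 KB' H z \<Gamma>) S"
    unfolding W_eq by (rule neumann_inverse)
qed

end

section \<open>Conjugate contours\<close>

lemma infdist_cnj:
  assumes "S \<subseteq> \<real>"
  shows "infdist (cnj w) S = infdist w S"
proof -
  have "dist (cnj w) a = dist w a" if "a \<in> S" for a
  proof -
    have "cnj w - a = cnj (w - a)" using assms that by (auto elim!: Reals_cases)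
    then show ?thesis by (simp only: dist_norm complex_mod_cnj)
  qed
  then have "dist (cnj w) ` S = dist w ` S" by (rule image_cong[OF refl])
  then show ?thesis unfolding infdist_def by simp
qed

lemma d_0_cnj:
  assumes S: "bspectrum A \<subseteq> \<real>"
  shows "d_0 A (cnj \<circ> \<Gamma>) = d_0 A \<Gamma>"
proof -
  have "dist a (cnj w) = dist a w" if "a \<in> bspectrum A" for a w
  proof -
    have "a - cnj w = cnj (a - w)" using S that by (auto elim!: Reals_cases)
    then show ?thesis by (simp only: dist_norm complex_mod_cnj)
  qed
  then have "{dist a b |a b. a \<in> bspectrum A \<and> b \<in> (cnj \<circ> \<Gamma>) ` {0..}} =
      {dist a b |a b. a \<in> bspectrum A \<and> b \<in> \<Gamma> ` {0..}}"
    by (auto; metis atLeast_iff image_eqI)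
  then show ?thesis unfolding d_0_def setdist_def by auto
qed

lemma continuous_on_badj:
  fixes F :: "'c::metric_space \<Rightarrow> ('a::complex_hilbert_space \<Rightarrow>\<^sub>L 'b::complex_hilbert_space)"
  assumes F: "continuous_on S F" and lin: "\<And>t. t \<in> S \<Longrightarrow> clinear_op (F t)"
  shows "continuous_on S (\<lambda>t. badj (F t))"
proof -
  have "dist (badj (F t)) (badj (F s)) = dist (F t) (F s)" if "s \<in> S" "t \<in> S" for s t
    using lin[OF that(1)] lin[OF that(2)]
    by (simp add: dist_norm norm_badj clinear_op_diff flip: badj_diff)
  then show ?thesis using F unfolding continuous_on_iff by simp
qed

lemma
  assumes S: "bspectrum A \<subseteq> \<real>" and nrm: "\<And>t. 0 \<le> t \<Longrightarrow> norm (KB' (cnj (\<Gamma> t))) = norm (KB' (\<Gamma> t))"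
  shows Var_A_cnj: "Var_A KB' A (cnj \<circ> \<Gamma>) = Var_A KB' A \<Gamma>"
    and KB_bounded_cnj: "KB_bounded KB' (cnj \<circ> \<Gamma>) = KB_bounded KB' \<Gamma>"
    and r_min_cnj: "r_min KB' A (cnj \<circ> \<Gamma>) = r_min KB' A \<Gamma>"
proof -
  show V: "Var_A KB' A (cnj \<circ> \<Gamma>) = Var_A KB' A \<Gamma>"
    unfolding Var_A_def set_lebesgue_integral_def
    by (rule Bochner_Integration.integral_cong) (auto simp: nrm infdist_cnj[OF S] indicator_def)
  have "Var_1 KB' (cnj \<circ> \<Gamma>) = Var_1 KB' \<Gamma>"
    unfolding Var_1_def by (rule nn_integral_cong) (auto simp: nrm indicator_def)
  then show "KB_bounded KB' (cnj \<circ> \<Gamma>) = KB_bounded KB' \<Gamma>" by (simp add: KB_bounded_def)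
  show "r_min KB' A (cnj \<circ> \<Gamma>) = r_min KB' A \<Gamma>"
    unfolding r_min_def V d_0_cnj[OF S] ..
qed

lemma contour_problem_cnj:
  assumes P: "contour_problem KB' A \<Gamma>"
    and adj: "\<And>t. 0 < t \<Longrightarrow> KB' (cnj (\<Gamma> t)) = badj (KB' (\<Gamma> t))"
    and real0: "\<Gamma> 0 \<in> \<real>"
  shows "contour_problem KB' A (cnj \<circ> \<Gamma>)"
    and "r_min KB' A (cnj \<circ> \<Gamma>) = r_min KB' A \<Gamma>"
proof -
  interpret P: contour_problem KB' A \<Gamma> by (rule P)
  have nrm: "norm (KB' (cnj (\<Gamma> t))) = norm (KB' (\<Gamma> t))" if "0 \<le> t" for t
    using that real0 P.KB'_lin[of t] adj[of t] by (cases "t = 0") (auto simp: norm_badj Reals_cnj_iff)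
  note inv = Var_A_cnj[OF P.A_spectrum nrm] KB_bounded_cnj[OF P.A_spectrum nrm] d_0_cnj[OF P.A_spectrum]
  show "contour_problem KB' A (cnj \<circ> \<Gamma>)"
  proof
    show "continuous_on {0<..} (\<lambda>t. KB' ((cnj \<circ> \<Gamma>) t))"
    proof -
      have "continuous_on {0<..} (\<lambda>t. badj (KB' (\<Gamma> t)))"
        by (rule continuous_on_badj[OF P.KB'_cont]) (simp add: P.KB'_lin)
      moreover have "badj (KB' (\<Gamma> t)) = KB' ((cnj \<circ> \<Gamma>) t)" if "t \<in> {0<..}" for t
        using that by (simp add: adj)
      ultimately show ?thesis by (rule continuous_on_eq)
    qed
    show "clinear_op (KB' ((cnj \<circ> \<Gamma>) t))" if "0 < t" for t
      using that by (simp add: adj clinear_op_badj P.KB'_lin)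
  qed (use P.A_selfadjoint P.A_spectrum lipschitz_curve_cnj[OF P.lipschitz] P.to_infinity P.bounded
      P.d_pos P.Var_less P.Var_small in \<open>simp_all add: inv\<close>)
  show "r_min KB' A (cnj \<circ> \<Gamma>) = r_min KB' A \<Gamma>" by (rule r_min_cnj[OF P.A_spectrum nrm])
qed

lemma intertwined_invertible_iff:
  assumes W: "is_binverse W S" and U: "is_binverse U S'" and eq: "W o\<^sub>L B = C o\<^sub>L U"
  shows "(\<exists>R. is_binverse B R) \<longleftrightarrow> (\<exists>R. is_binverse C R)"
proof -
  have eq': "blinfun_apply W (blinfun_apply B x) = blinfun_apply C (blinfun_apply U x)" for x
    using arg_cong[OF eq, of "\<lambda>T. blinfun_apply T x"] by simp
  have "B = S o\<^sub>L (C o\<^sub>L U)"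
    by (rule blinfun_eqI) (simp add: is_binverseD[OF W] flip: eq')
  moreover have "C = (W o\<^sub>L B) o\<^sub>L S'"
    by (rule blinfun_eqI) (simp add: is_binverseD[OF U] eq')
  ultimately show ?thesis
    by (metis is_binverse_compose is_binverse_sym W U)
qed

text \<open>The right-hand side of the factorization is $A - z + z\int K_B'(\mu)(z-\mu)^{-1}d\mu$. Its adjoint is
  the same expression for $\overline z$ and the conjugate contour, whatever the two solutions are. For
  \<open>z\<close> within distance \<open>r\<close> of the spectrum of \<open>A\<close> the relation intertwines \<open>H - z\<close> and
  $H_c^*-z$ by invertible factors; all other \<open>z\<close> belong to both resolvent sets.\<close>

theorem conjugate_contours:
  assumes "contour_solution KB' A \<Gamma> X" and "contour_solution KB' A (cnj \<circ> \<Gamma>) Xc"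
    and adj: "\<And>t. 0 < t \<Longrightarrow> KB' (cnj (\<Gamma> t)) = badj (KB' (\<Gamma> t))"
    and r_eq: "r_min KB' A (cnj \<circ> \<Gamma>) = r_min KB' A \<Gamma>"
  shows W_adjoint_relation: "z \<notin> \<Gamma> ` {0..} \<Longrightarrow> W_1 KB' (A + X) z \<Gamma> o\<^sub>L (A + X - scalar_op z) =
      (badj (A + Xc) - scalar_op z) o\<^sub>L badj (W_1 KB' (A + Xc) (cnj z) (cnj \<circ> \<Gamma>))"
    and same_spectrum: "bspectrum (badj (A + Xc)) = bspectrum (A + X)"
proof -
  interpret P: contour_solution KB' A \<Gamma> X by fact
  interpret Q: contour_solution KB' A "cnj \<circ> \<Gamma>" Xc by fact
  have rel: "W_1 KB' P.H z \<Gamma> o\<^sub>L (P.H - scalar_op z) =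
      (badj Q.H - scalar_op z) o\<^sub>L badj (W_1 KB' Q.H (cnj z) (cnj \<circ> \<Gamma>))"
    if z: "z \<notin> \<Gamma> ` {0..}" for z
  proof -
    have zc: "cnj z \<notin> (cnj \<circ> \<Gamma>) ` {0..}"
      using z by (auto simp: image_iff)
    define F where "F \<mu> = KB' \<mu> o\<^sub>L scalar_op (inverse (z - \<mu>))" for \<mu>
    define Fc where "Fc \<mu> = KB' \<mu> o\<^sub>L scalar_op (inverse (cnj z - \<mu>))" for \<mu>
    define J where "J = op_contour_integral \<Gamma> F"
    define Jc where "Jc = op_contour_integral (cnj \<circ> \<Gamma>) Fc"
    have F: "contour_integrable \<Gamma> F" unfolding F_def by (rule P.Cauchy_kernel_integrable[OF z])
    have Fc: "contour_integrable (cnj \<circ> \<Gamma>) Fc" unfolding Fc_def by (rule Q.Cauchy_kernel_integrable[OF zc])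
    have F_lin: "clinear_op (F (\<Gamma> t))" if "0 < t" for t
      unfolding F_def by (intro clinear_op_intros P.KB'_lin that)
    have J_lin: "clinear_op J"
      unfolding J_def by (rule clinear_op_contour_integral[OF P.lipschitz F F_lin])
    have J_adj: "badj J = Jc"
      unfolding J_def Jc_def
    proof (rule badj_op_contour_integral[OF P.lipschitz F Fc F_lin])
      fix t :: real assume t: "0 < t"
      have "badj (F (\<Gamma> t)) = scalar_op (cnj (inverse (z - \<Gamma> t))) o\<^sub>L badj (KB' (\<Gamma> t))"
        unfolding F_def by (simp add: badj_compose P.KB'_lin t clinear_op_scalar badj_scalar)
      also have "\<dots> = badj (KB' (\<Gamma> t)) o\<^sub>L scalar_op (cnj (inverse (z - \<Gamma> t)))"
        by (rule clinear_op_commute_scalar[symmetric]) (intro clinear_op_badj P.KB'_lin t)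
      also have "\<dots> = Fc (cnj (\<Gamma> t))" by (simp add: Fc_def adj[OF t])
      finally show "Fc (cnj (\<Gamma> t)) = badj (F (\<Gamma> t))" ..
    qed
    have Jc_lin: "clinear_op Jc" unfolding J_adj[symmetric] by (rule clinear_op_badj[OF J_lin])
    have "(badj Q.H - scalar_op z) o\<^sub>L badj (W_1 KB' Q.H (cnj z) (cnj \<circ> \<Gamma>))
        = badj (Q.H - scalar_op (cnj z)) o\<^sub>L badj (W_1 KB' Q.H (cnj z) (cnj \<circ> \<Gamma>))"
      by (simp add: badj_diff Q.H_lin clinear_op_scalar badj_scalar)
    also have "\<dots> = badj (W_1 KB' Q.H (cnj z) (cnj \<circ> \<Gamma>) o\<^sub>L (Q.H - scalar_op (cnj z)))"
      by (rule badj_compose[symmetric]) (intro Q.W_lin zc clinear_op_diff Q.H_lin clinear_op_scalar)+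
    also have "\<dots> = badj (A - scalar_op (cnj z) + (scalar_op (cnj z) o\<^sub>L Jc))"
      unfolding Jc_def Fc_def by (rule arg_cong[OF Q.W_factorization[OF zc]])
    also have "\<dots> = A - scalar_op z + (badj Jc o\<^sub>L scalar_op z)"
      by (simp add: badj_add badj_diff badj_compose badj_scalar clinear_op_intros P.A_lin Jc_lin
          badj_bselfadjoint[OF P.A_selfadjoint])
    also have "badj Jc = J" unfolding J_adj[symmetric] by (rule badj_badj[OF J_lin])
    also have "J o\<^sub>L scalar_op z = scalar_op z o\<^sub>L J" by (rule clinear_op_commute_scalar[OF J_lin])
    also have "A - scalar_op z + (scalar_op z o\<^sub>L J) = W_1 KB' P.H z \<Gamma> o\<^sub>L (P.H - scalar_op z)"
      unfolding J_def F_def by (rule P.W_factorization[OF z, symmetric])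
    finally show ?thesis ..
  qed
  then show "z \<notin> \<Gamma> ` {0..} \<Longrightarrow> W_1 KB' P.H z \<Gamma> o\<^sub>L (P.H - scalar_op z) =
      (badj Q.H - scalar_op z) o\<^sub>L badj (W_1 KB' Q.H (cnj z) (cnj \<circ> \<Gamma>))" .
  have badj_inv: "\<exists>S. is_binverse (badj Q.H - scalar_op z) S"
    if "is_binverse (Q.H - scalar_op (cnj z)) S" for S z
  proof -
    have "is_binverse (badj (Q.H - scalar_op (cnj z))) (badj S)"
      by (rule is_binverse_badj[OF that]) (intro clinear_op_diff Q.H_lin clinear_op_scalar)
    then show ?thesis
      by (auto simp: badj_diff Q.H_lin clinear_op_scalar badj_scalar)
  qed
  have "(\<exists>S. is_binverse (P.H - scalar_op z) S) \<longleftrightarrow> (\<exists>S. is_binverse (badj Q.H - scalar_op z) S)" for z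
  proof (cases "P.\<delta> z \<le> P.r")
    case True
    then have True': "P.\<delta> (cnj z) \<le> Q.r" by (simp add: infdist_cnj[OF P.A_spectrum] r_eq)
    obtain S where S: "is_binverse (W_1 KB' P.H z \<Gamma>) S" using P.W_invertible(2)[OF True] by blast
    obtain S' where S': "is_binverse (W_1 KB' Q.H (cnj z) (cnj \<circ> \<Gamma>)) S'"
      using Q.W_invertible(2)[OF True'] by blast
    have "is_binverse (badj (W_1 KB' Q.H (cnj z) (cnj \<circ> \<Gamma>))) (badj S')"
      by (rule is_binverse_badj[OF S' Q.W_lin[OF Q.W_invertible(1)[OF True']]])
    then show ?thesis
      by (rule intertwined_invertible_iff[OF S _ rel[OF P.W_invertible(1)[OF True]]])
  next
    case False
    then have "Q.r < P.\<delta> (cnj z)" by (simp add: infdist_cnj[OF P.A_spectrum] r_eq)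
    then obtain S where "is_binverse (Q.H - scalar_op (cnj z)) S" using Q.resolvent_exists by blast
    from badj_inv[OF this] show ?thesis using P.resolvent_exists[of z] False by auto
  qed
  then show "bspectrum (badj Q.H) = bspectrum P.H"
    unfolding bspectrum_def by auto
qed

section \<open>Contours in the continuation domain\<close>

text \<open>\<open>B10\<close> is given as an everywhere defined product of partial maps; its complex linearity is
  inherited from \<open>T10\<close> and the uniqueness of preimages under \<open>sqrtA0\<close>.\<close>

lemma (in block_operator_setting) clinear_op_B10: "clinear_op B10"
  unfolding clinear_op_def
proof (intro allI)
  have lin: "linear_operator sqrtA0"
    using sqrtA0 by (simp add: is_positive_sqrt_def selfadjoint_operator_def)
  have inv: "\<exists>y. sqrtA0 y = Some x \<and> (\<forall>y'. sqrtA0 y' = Some x \<longrightarrow> y' = y) \<and> T10 y = Some (blinfun_apply B10 x)" for x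
  proof -
    have eq: "Some (blinfun_apply B10 x) = (T10 \<circ>\<^sub>m op_inverse sqrtA0) x" using fun_cong[OF B10] .
    then obtain y where y: "op_inverse sqrtA0 x = Some y" "T10 y = Some (blinfun_apply B10 x)"
      by (cases "op_inverse sqrtA0 x") (auto simp: map_comp_def)
    have ex: "\<exists>!y. sqrtA0 y = Some x" using y(1) by (simp add: op_inverse_def split: if_splits)
    then have "y = (THE y. sqrtA0 y = Some x)" using y(1) by (simp add: op_inverse_def)
    then show ?thesis using theI'[OF ex] ex y(2) by metis
  qed
  fix c x
  obtain y where y: "sqrtA0 y = Some x" "T10 y = Some (blinfun_apply B10 x)" using inv by blast
  obtain y' where y': "\<And>v. sqrtA0 v = Some (c *\<^sub>C x) \<Longrightarrow> v = y'"
    "T10 y' = Some (blinfun_apply B10 (c *\<^sub>C x))" using inv[of "c *\<^sub>C x"] by metis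
  have "c *\<^sub>C y = y'" using lin y(1) by (intro y'(1)) (simp add: linear_operator_def)
  moreover have "T10 (c *\<^sub>C y) = Some (c *\<^sub>C blinfun_apply B10 x)"
    using T10_linear y(2) by (simp add: linear_operator_def)
  ultimately show "blinfun_apply B10 (c *\<^sub>C x) = c *\<^sub>C blinfun_apply B10 x" using y'(2) by simp
qed

lemma (in block_operator_setting) bselfadjoint_At: "bselfadjoint At"
  unfolding bselfadjoint_def
proof (intro conjI allI)
  show "clinear_op At" unfolding At
    by (intro clinear_op_intros clinear_op_badj clinear_op_B10 bselfadjoint_clinear[OF A1_selfadjoint])
  fix x y
  have "cinner (blinfun_apply A1 x) y = cinner x (blinfun_apply A1 y)"
    using A1_selfadjoint by (simp add: bselfadjoint_def)
  then show "cinner (blinfun_apply At x) y = cinner x (blinfun_apply At y)"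
    unfolding At
    by (simp add: blinfun.diff_left cinner_simps cinner_badj_left[OF clinear_op_B10]
        flip: cinner_badj_right[OF clinear_op_B10])
qed

lemma arc_length_parametrized_imp_lipschitz:
  assumes "arc_length_parametrized \<Gamma>"
  shows "lipschitz_curve \<Gamma>"
  unfolding lipschitz_curve_def
proof (intro allI impI)
  fix s t :: real assume st: "0 \<le> s" "s \<le> t"
  have "ennreal (dist (\<Gamma> s) (\<Gamma> t)) \<le> curve_length \<Gamma> s t"
    unfolding curve_length_def by (rule SUP_upper2[of "[s, t]"]) (use st in auto)
  also have "\<dots> = ennreal (t - s)"
    using assms st by (simp add: arc_length_parametrized_def)
  finally show "dist (\<Gamma> s) (\<Gamma> t) \<le> t - s" using st by simp
qed

lemma deformation_of_ray_to_infinity: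
  assumes "deformation_of_ray \<alpha> D \<Gamma>"
  shows "\<exists>T. \<forall>t\<ge>T. 0 \<le> t \<longrightarrow> \<rho> \<le> cmod (\<Gamma> t)"
proof -
  obtain h :: "real \<times> real \<Rightarrow> complex" where h: "\<forall>t\<ge>0. h (1, t) = \<Gamma> t"
    "\<forall>R. \<exists>T. \<forall>s\<in>{0..1}. \<forall>t\<ge>0. T \<le> t \<longrightarrow> R \<le> cmod (h (s, t))"
    using assms unfolding deformation_of_ray_def by blast
  obtain T where "\<forall>s\<in>{0..1}. \<forall>t\<ge>0. T \<le> t \<longrightarrow> \<rho> \<le> cmod (h (s, t))" using h(2) by blast
  then have "\<forall>t\<ge>0. T \<le> t \<longrightarrow> \<rho> \<le> cmod (h (1, t))" by simp
  then show ?thesis using h(1) by auto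
qed

text \<open>On either side of the real axis the values of \<open>KB'\<close> along a contour are complex linear,
  depend continuously on the parameter and are reflected into their adjoints.\<close>

lemma (in block_operator_setting) KB'_along_contour:
  assumes l: "l \<in> {1, -1}" and \<Gamma>: "contour_in \<alpha>0 (D_side Dp l) \<Gamma>"
  shows "continuous_on {0<..} (\<lambda>t. KB' (\<Gamma> t))"
    and "\<And>t. 0 < t \<Longrightarrow> clinear_op (KB' (\<Gamma> t))"
    and "\<And>t. 0 < t \<Longrightarrow> KB' (cnj (\<Gamma> t)) = badj (KB' (\<Gamma> t))"
proof -
  have side: "\<Gamma> t \<in> D_side Dp l" if "0 < t" for t using \<Gamma> that by (simp add: contour_in_def)
  have cont: "continuous_on {0<..} \<Gamma>"
    using \<Gamma> by (auto simp: contour_in_def intro: continuous_on_subset)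
  have upper: "continuous_on {0<..} (\<lambda>t. KB' (\<gamma> t))" if "continuous_on {0<..} \<gamma>" "\<And>t. 0 < t \<Longrightarrow> \<gamma> t \<in> Dp" for \<gamma>
    using that by (intro continuous_on_compose2[OF KB'_continuous that(1)]) auto
  have "continuous_on {0<..} (\<lambda>t. KB' (\<Gamma> t)) \<and> (\<forall>t>0. clinear_op (KB' (\<Gamma> t))) \<and>
    (\<forall>t>0. KB' (cnj (\<Gamma> t)) = badj (KB' (\<Gamma> t)))"
  proof (cases "l = 1")
    case True
    then have D: "\<Gamma> t \<in> Dp" if "0 < t" for t using side[OF that] by (simp add: D_side_def)
    then show ?thesis
      using upper[OF cont] KB'_clinear KB'_reflection[of "cnj (\<Gamma> t)" for t] by auto
  next
    case False
    then have D: "cnj (\<Gamma> t) \<in> Dp" "\<Gamma> t \<in> cnj ` Dp" if "0 < t" for t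
      using side[OF that] by (auto simp: D_side_def)
    have refl: "KB' (\<Gamma> t) = badj (KB' (cnj (\<Gamma> t)))" if "0 < t" for t
      using D(2)[OF that] by (rule KB'_reflection)
    have lin: "clinear_op (KB' (cnj (\<Gamma> t)))" if "0 < t" for t
      using D(1)[OF that] by (rule KB'_clinear)
    have "continuous_on {0<..} (\<lambda>t. KB' (cnj (\<Gamma> t)))"
      by (rule upper) (use D cont in \<open>auto intro!: continuous_intros\<close>)
    then have "continuous_on {0<..} (\<lambda>t. badj (KB' (cnj (\<Gamma> t))))"
      by (rule continuous_on_badj) (simp add: lin)
    then have "continuous_on {0<..} (\<lambda>t. KB' (\<Gamma> t))"
      by (rule continuous_on_eq) (simp add: refl)
    then show ?thesis using refl lin by (simp add: clinear_op_badj badj_badj)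
  qed
  then show "continuous_on {0<..} (\<lambda>t. KB' (\<Gamma> t))"
    and "\<And>t. 0 < t \<Longrightarrow> clinear_op (KB' (\<Gamma> t))"
    and "\<And>t. 0 < t \<Longrightarrow> KB' (cnj (\<Gamma> t)) = badj (KB' (\<Gamma> t))" by auto
qed

theorem lemma3p1:
  fixes A0 :: "'a::{complex_hilbert_space, second_countable_topology} \<rightharpoonup> 'a"
    and A1 :: "'b::{complex_hilbert_space, second_countable_topology} \<Rightarrow>\<^sub>L 'b"
    and l :: int
    and \<Gamma> :: "real \<Rightarrow> complex"
  assumes "block_operator_setting \<alpha>0 A0 sqrtA0 E0 A1 T01 T10 B10 At Dp KB' C \<gamma>"
    and "l \<in> {1, -1}"
    and "contour_in \<alpha>0 (D_side Dp l) \<Gamma>"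
    and "KB_bounded KB' \<Gamma>"
    and "d_0 At \<Gamma> > 0"
    and "Var_A KB' At \<Gamma> < 1"
    and "Var_A KB' At \<Gamma> * norm At < 1/4 * d_0 At \<Gamma> * (1 - Var_A KB' At \<Gamma>)\<^sup>2"
    and "basic_solution KB' At \<Gamma> X" and "H = At + X"
    and "basic_solution KB' At (cnj \<circ> \<Gamma>) Xc" and "Hc = At + Xc"
  shows "(\<forall>z. z \<notin> \<Gamma> ` {0..} \<longrightarrow>
            W_1 KB' H z \<Gamma> o\<^sub>L (H - scalar_op z) =
            (badj Hc - scalar_op z) o\<^sub>L badj (W_1 KB' Hc (cnj z) (cnj \<circ> \<Gamma>)))
         \<and> bspectrum (badj Hc) = bspectrum H"
proof -
  interpret block_operator_setting \<alpha>0 A0 sqrtA0 E0 A1 T01 T10 B10 At Dp KB' C \<gamma> by fact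
  note along = KB'_along_contour[OF assms(2,3)]
  have problem: "contour_problem KB' At \<Gamma>"
  proof
    show "bspectrum At \<subseteq> \<real>" using At_spectrum by (auto simp: real_ray_def)
    show "lipschitz_curve \<Gamma>"
      using assms(3) by (auto simp: contour_in_def intro: arc_length_parametrized_imp_lipschitz)
    show "\<exists>T. \<forall>t\<ge>T. 0 \<le> t \<longrightarrow> \<rho> \<le> cmod (\<Gamma> t)" for \<rho>
      using assms(3) deformation_of_ray_to_infinity by (auto simp: contour_in_def)
  qed (fact bselfadjoint_At along assms)+
  have "\<Gamma> 0 \<in> \<real>" using assms(3) by (simp add: contour_in_def)
  note conj = contour_problem_cnj[OF problem along(3) this]
  have "contour_solution KB' At \<Gamma> X"
    using problem assms(8) by (simp add: contour_solution_def contour_solution_axioms_def)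
  moreover have "contour_solution KB' At (cnj \<circ> \<Gamma>) Xc"
    using conj(1) assms(10) by (simp add: contour_solution_def contour_solution_axioms_def)
  ultimately show ?thesis
    unfolding assms(9,11)
    using W_adjoint_relation[OF _ _ along(3) conj(2)] same_spectrum[OF _ _ along(3) conj(2)] by blast
qed

end
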